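(* Let $\Phi=\{\phi^t\}_{t\in\mathbb{R}}$ be a continuous flow on a compact metric space $X$. Then $$h(\Phi,G_\mu(\Phi))\le h_\mu(\Phi)$$ for every $\Phi$-invariant Borel probability measure $\mu$, and equality holds whenever $\mu$ is ergodic (for $\Phi$).
   Context: A continuous flow on a compact metric space $X$ is a continuous map $\Phi:\mathbb{R}\times X\to X$, $\phi^t(x)=\Phi(t,x)$, with $\phi^0=\mathrm{id}$ and $\phi^{s+t}=\phi^s\circ\phi^t$. A measure is $\Phi$-invariant if it is invariant under $\phi^t$ for all $t\in\mathbb{R}$. It is ergodic for $\Phi$ if $\mu(A)\in\{0,1\}$ for every $\Phi$-invariant Borel set $A$. The metric entropy of $\Phi$ is $h_\mu(\Phi):=h_\mu(\phi^1)$, the Kolmogorov–Sinai entropy of the time-one map. $G_\mu(\Phi)$ is the set of generic points: $x\in X$ with $\lim_{T\to\infty}\frac1T\int_0^T\varphi(\phi^t(x))\,dt=\int\varphi\,d\mu$ for every continuous $\varphi:X\to\mathbb{R}$. Topological entropy of a flow on an arbitrary subset. Let $\mathcal U$ be a finite open cover of $X$. For $B\subseteq X$ write $B\prec\mathcal U$ if $B$ is contained in some element of $\mathcal U$. Let $N(B)=N(\Phi,\mathcal U,B)$ be the largest nonnegative number such that $\phi^t(B)\prec\mathcal U$ for all $0\le t<N(B)$, with $N(B)=0$ if $B\not\prec\mathcal U$ and $N(B)=\infty$ if $\phi^t(B)\prec\mathcal U$ for all $t\ge0$. Put $D(B)=e^{-N(B)}$ if $N(B)<\infty$ and $D(B)=0$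 if $N(B)=\infty$. For $\alpha>0$ and a countable collection $\mathcal B=\{B_i\}_{i\ge1}$ of subsets of $X$ put $S_\alpha(\mathcal B)=\sum_{i\ge1}D(B_i)^\alpha$. For $Y\subseteq X$ put $\Gamma_\alpha(Y)=\lim_{\varepsilon\to0}\inf\{S_\alpha(\mathcal E):\mathcal E=\{E_i\}_{i\ge1}\text{ a countable cover of }Y\text{ with }D(E_i)<\varepsilon\text{ for all }i\}$, $h_{\mathcal U}(\Phi,Y)=\inf\{\alpha>0:\Gamma_\alpha(Y)=0\}$ (with $\inf\emptyset=\infty$), and $h(\Phi,Y)=\sup\{h_{\mathcal U}(\Phi,Y):\mathcal U\text{ a finite open cover of }X\}$. *)

theory Defs
  imports "HOL-Analysis.Analysis" "HOL-Probability.Probability_Measure" "HOL-Library.Disjoint_Sets"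
begin

definition continuous_flow :: "(real \<Rightarrow> 'a::topological_space \<Rightarrow> 'a) \<Rightarrow> bool" where
  "continuous_flow \<phi> \<longleftrightarrow>
     continuous_on UNIV (\<lambda>(t, x). \<phi> t x) \<and> \<phi> 0 = id \<and> (\<forall>s t. \<phi> (s + t) = \<phi> s \<circ> \<phi> t)"

definition borel_probability :: "'a::topological_space measure \<Rightarrow> bool" where
  "borel_probability M \<longleftrightarrow> sets M = sets borel \<and> prob_space M"

definition flow_invariant :: "(real \<Rightarrow> 'a \<Rightarrow> 'a) \<Rightarrow> 'a measure \<Rightarrow> bool" where
  "flow_invariant \<phi> M \<longleftrightarrow> (\<forall>t. \<forall>A\<in>sets M. emeasure M (\<phi> t -` A \<inter> space M) = emeasure M A)"

definition flow_ergodic :: "(real \<Rightarrow> 'a \<Rightarrow> 'a) \<Rightarrow> 'a measure \<Rightarrow> bool" where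
  "flow_ergodic \<phi> M \<longleftrightarrow>
     (\<forall>A\<in>sets M. (\<forall>t. \<phi> t -` A \<inter> space M = A) \<longrightarrow> measure M A \<in> {0, 1})"


section \<open>Kolmogorov--Sinai entropy\<close>

text \<open>Empty cells are excluded, cells of measure zero are allowed; since \<open>0 * ln 0 = 0\<close> in HOL
  they do not contribute to the entropy.\<close>

definition finite_measurable_partition :: "'a measure \<Rightarrow> 'a set set \<Rightarrow> bool" where
  "finite_measurable_partition M \<xi> \<longleftrightarrow> finite \<xi> \<and> \<xi> \<subseteq> sets M \<and> partition_on (space M) \<xi>"

definition partition_entropy :: "'a measure \<Rightarrow> 'a set set \<Rightarrow> real" where
  "partition_entropy M \<xi> = - (\<Sum>A\<in>\<xi>. measure M A * ln (measure M A))"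

text \<open>The join of the preimages of \<open>\<xi>\<close> under \<open>T ^^ i\<close> for \<open>i < n\<close>, without empty cells.\<close>

definition iterated_join :: "'a measure \<Rightarrow> ('a \<Rightarrow> 'a) \<Rightarrow> 'a set set \<Rightarrow> nat \<Rightarrow> 'a set set" where
  "iterated_join M T \<xi> n =
     common_refinement ((\<lambda>i. (\<lambda>A. (T ^^ i) -` A \<inter> space M) ` \<xi>) ` {..<n})"

text \<open>The limit exists, by subadditivity, whenever \<open>T\<close> preserves the probability measure \<open>M\<close>.\<close>

definition entropy_wrt_partition :: "'a measure \<Rightarrow> ('a \<Rightarrow> 'a) \<Rightarrow> 'a set set \<Rightarrow> real" where
  "entropy_wrt_partition M T \<xi> = lim (\<lambda>n. partition_entropy M (iterated_join M T \<xi> n) / real n)"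

definition KS_entropy :: "'a measure \<Rightarrow> ('a \<Rightarrow> 'a) \<Rightarrow> ereal" where
  "KS_entropy M T =
     (SUP \<xi>\<in>{\<xi>. finite_measurable_partition M \<xi>}. ereal (entropy_wrt_partition M T \<xi>))"

definition flow_metric_entropy :: "'a measure \<Rightarrow> (real \<Rightarrow> 'a \<Rightarrow> 'a) \<Rightarrow> ereal" where
  "flow_metric_entropy M \<phi> = KS_entropy M (\<phi> 1)"


section \<open>Generic points\<close>

definition generic_points :: "(real \<Rightarrow> 'a \<Rightarrow> 'a) \<Rightarrow> 'a::topological_space measure \<Rightarrow> 'a set" where
  "generic_points \<phi> M =
     {x. \<forall>f::'a \<Rightarrow> real. continuous_on UNIV f \<longrightarrow>
           ((\<lambda>T. (1 / T) * integral {0..T} (\<lambda>t. f (\<phi> t x))) \<longlongrightarrow> (\<integral>y. f y \<partial>M)) at_top}"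


section \<open>Topological entropy of a flow on a subset\<close>

definition finite_open_cover :: "'a::topological_space set set \<Rightarrow> bool" where
  "finite_open_cover \<U> \<longleftrightarrow> finite \<U> \<and> (\<forall>U\<in>\<U>. open U) \<and> \<Union>\<U> = UNIV"

definition subordinate :: "'a set \<Rightarrow> 'a set set \<Rightarrow> bool" where
  "subordinate B \<U> \<longleftrightarrow> (\<exists>U\<in>\<U>. B \<subseteq> U)"

definition stays_subordinate ::
    "(real \<Rightarrow> 'a \<Rightarrow> 'a) \<Rightarrow> 'a set set \<Rightarrow> 'a set \<Rightarrow> ereal \<Rightarrow> bool" where
  "stays_subordinate \<phi> \<U> B n \<longleftrightarrow> (\<forall>t\<ge>0. ereal t < n \<longrightarrow> subordinate (\<phi> t ` B) \<U>)"

text \<open>The supremum below is attained (see \<open>escape_time_greatest\<close>). The value is \<open>0\<close> if \<open>B\<close> is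
  contained in no element of the cover, and \<open>\<infinity>\<close> if \<open>\<phi> t ` B\<close> is subordinate to it for all
  \<open>t \<ge> 0\<close>.\<close>

definition escape_time :: "(real \<Rightarrow> 'a \<Rightarrow> 'a) \<Rightarrow> 'a set set \<Rightarrow> 'a set \<Rightarrow> ereal" where
  "escape_time \<phi> \<U> B = Sup {n. 0 \<le> n \<and> stays_subordinate \<phi> \<U> B n}"

lemma escape_time_greatest:
  shows "0 \<le> escape_time \<phi> \<U> B"
    and "stays_subordinate \<phi> \<U> B (escape_time \<phi> \<U> B)"
    and "0 \<le> n \<Longrightarrow> stays_subordinate \<phi> \<U> B n \<Longrightarrow> n \<le> escape_time \<phi> \<U> B"
proof -
  have "stays_subordinate \<phi> \<U> B 0"
    by (auto simp: stays_subordinate_def)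
  then show "0 \<le> escape_time \<phi> \<U> B"
    unfolding escape_time_def by (intro Sup_upper) auto
  show "stays_subordinate \<phi> \<U> B (escape_time \<phi> \<U> B)"
    unfolding stays_subordinate_def escape_time_def less_Sup_iff by auto
  show "n \<le> escape_time \<phi> \<U> B" if "0 \<le> n" "stays_subordinate \<phi> \<U> B n"
    using that unfolding escape_time_def by (intro Sup_upper) auto
qed

lemma escape_time_eq_0:
  assumes "\<phi> 0 = id" "\<not> subordinate B \<U>"
  shows "escape_time \<phi> \<U> B = 0"
  using escape_time_greatest(1,2)[of \<phi> \<U> B] assms
  by (fastforce simp: stays_subordinate_def zero_ereal_def[symmetric])

lemma escape_time_eq_PInf:
  assumes "\<And>t. 0 \<le> t \<Longrightarrow> subordinate (\<phi> t ` B) \<U>"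
  shows "escape_time \<phi> \<U> B = \<infinity>"
  using escape_time_greatest(3)[of \<infinity> \<phi> \<U> B] assms
  by (simp add: stays_subordinate_def)

definition D_size :: "(real \<Rightarrow> 'a \<Rightarrow> 'a) \<Rightarrow> 'a set set \<Rightarrow> 'a set \<Rightarrow> real" where
  "D_size \<phi> \<U> B =
     (if escape_time \<phi> \<U> B = \<infinity> then 0 else exp (- real_of_ereal (escape_time \<phi> \<U> B)))"

text \<open>Countable collections are sequences of sets. A finite collection can be padded with empty
  sets, for which \<open>D_size\<close> is \<open>0\<close>.\<close>

definition S_sum :: "(real \<Rightarrow> 'a \<Rightarrow> 'a) \<Rightarrow> 'a set set \<Rightarrow> real \<Rightarrow> (nat \<Rightarrow> 'a set) \<Rightarrow> ennreal" where
  "S_sum \<phi> \<U> \<alpha> E = (\<Sum>i. ennreal (D_size \<phi> \<U> (E i) powr \<alpha>))"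

text \<open>The limit exists because the infimum increases as \<open>\<epsilon>\<close> decreases.\<close>

definition Gamma_measure ::
    "(real \<Rightarrow> 'a \<Rightarrow> 'a) \<Rightarrow> 'a set set \<Rightarrow> real \<Rightarrow> 'a set \<Rightarrow> ennreal" where
  "Gamma_measure \<phi> \<U> \<alpha> Y =
     Lim (at_right 0) (\<lambda>\<epsilon>::real.
       INF E\<in>{E. Y \<subseteq> (\<Union>i. E i) \<and> (\<forall>i. D_size \<phi> \<U> (E i) < \<epsilon>)}. S_sum \<phi> \<U> \<alpha> E)"

definition cover_entropy :: "(real \<Rightarrow> 'a \<Rightarrow> 'a) \<Rightarrow> 'a set set \<Rightarrow> 'a set \<Rightarrow> ereal" where
  "cover_entropy \<phi> \<U> Y = Inf {ereal \<alpha> | \<alpha>. 0 < \<alpha> \<and> Gamma_measure \<phi> \<U> \<alpha> Y = 0}"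

definition flow_top_entropy ::
    "(real \<Rightarrow> 'a::topological_space \<Rightarrow> 'a) \<Rightarrow> 'a set \<Rightarrow> ereal" where
  "flow_top_entropy \<phi> Y = (SUP \<U>\<in>{\<U>. finite_open_cover \<U>}. cover_entropy \<phi> \<U> Y)"

end

theory Submission
  imports Defs "HOL-Real_Asymp.Real_Asymp"
begin

text \<open>
  Both inequalities compare an entropy with the length of a code for orbits, and each of them turns
  one kind of code into the other.

  \<^bold>\<open>Metric entropy is at most topological entropy\<close> of any set \<open>Y\<close> that carries the measure
  (\<open>metric_entropy_le_top_entropy\<close>). If \<open>h(\<Phi>, Y) < \<beta>\<close>, then \<open>Y\<close> is covered by sets \<open>E\<^sub>i\<close> that follow the
  open cover for a time \<open>n\<^sub>i\<close>, with \<open>\<Sum>\<^sub>i exp (- \<alpha> n\<^sub>i)\<close> small and \<open>\<alpha> < \<beta>\<close>. Given a partition, choose the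
  open cover so that each of its members meets essentially one cell. Then \<open>E\<^sub>i\<close> determines, up to rare
  errors, the first \<open>n\<^sub>i\<close> letters of the itinerary of each of its points, and naming \<open>i\<close> costs \<open>\<alpha> n\<^sub>i\<close>, that
  is, \<open>\<alpha>\<close> per letter. An itinerary of length \<open>L\<close> is cut greedily into such blocks. Gibbs' inequality
  bounds the entropy of the blocks of length \<open>L\<close> by the expected length of this code, about
  \<open>\<alpha> L\<close> (\<open>block_entropy_le_by_covering\<close>). An ergodic flow may have a time-one map that is not
  ergodic; working with the expected code length, instead of the code length at a typical point, makes
  the argument insensitive to this.

  \<^bold>\<open>Generic points are almost all points\<close> when the measure is ergodic for the flow (\<open>AE_generic\<close>). If
  the upper averages of an observable exceed \<open>c\<close> almost everywhere, cut orbits greedily into pieces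
  along which the average exceeds \<open>c\<close>; integrating shows that the integral is at least \<open>c\<close>
  (\<open>integral_ge_of_averages_ge\<close>). This is the same cutting argument, and \<open>stopping_time_bound\<close> states
  it once for subadditive cocycles. Ergodicity gives the pointwise convergence of one observable at a
  time, and countably many observables suffice on a compact space.

  \<^bold>\<open>Topological entropy of the generic points is at most metric entropy\<close> (\<open>top_entropy_generic_le\<close>).
  Let \<open>h\<^sub>\<mu>(\<Phi>) < s < \<alpha>\<close>. A fine partition and a large \<open>n\<close> yield a code for the words of length \<open>n\<close>, with
  lengths \<open>- ln\<close> of the word probabilities and mean below \<open>n s\<close>. Replace the code length by a
  continuous function \<open>\<psi>\<close> with integral below \<open>n s\<close>. Along the orbit of a generic point the time average of
  \<open>\<psi>\<close> is eventually below \<open>n s\<close>, so at some phase in \<open>[0, n]\<close> the words read off every \<open>n\<close> units of time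
  have total code length at most about \<open>J n s\<close> for \<open>J\<close> words. By Kraft's inequality there are at most about
  \<open>exp (J n s)\<close> such sequences of words, and each describes a set with escape time at least \<open>n J\<close>. Hence
  the sums of \<open>exp (- \<alpha> n J)\<close> tend to zero (\<open>Gamma_measure_null_by_cost\<close>).
\<close>

section \<open>Cutting orbits at stopping times\<close>

definition birkhoff_sum :: "('a \<Rightarrow> 'a) \<Rightarrow> ('a \<Rightarrow> real) \<Rightarrow> nat \<Rightarrow> 'a \<Rightarrow> real" where
  "birkhoff_sum T g n x = (\<Sum>i<n. g ((T ^^ i) x))"

lemma birkhoff_sum_add:
  "birkhoff_sum T g (m + n) x = birkhoff_sum T g m x + birkhoff_sum T g n ((T ^^ m) x)"
proof (induction n)
  case (Suc n)
  have "(T ^^ (m + n)) x = (T ^^ n) ((T ^^ m) x)"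
    by (metis add.commute comp_apply funpow_add)
  with Suc show ?case
    by (simp add: birkhoff_sum_def)
qed (simp add: birkhoff_sum_def)

text \<open>The orbit segment of length \<open>L\<close> is cut from the left into pieces along which \<open>a\<close> is bounded by the
  sum of \<open>G\<close>. All but the last piece fit into the segment, and what remains has length below \<open>N\<close>; the
  trivial bound \<open>K\<close> per step is paid there.\<close>
lemma stopping_time_bound:
  fixes a :: "nat \<Rightarrow> 'a \<Rightarrow> real"
  assumes sub: "\<And>m n x. a (m + n) x \<le> a m x + a n ((T ^^ m) x)"
    and zero: "\<And>x. a 0 x \<le> 0" and one: "\<And>x. a 1 x \<le> K" and "0 \<le> K"
    and G: "\<And>x. 0 \<le> G x"
    and stop: "\<And>x. \<exists>n. 1 \<le> n \<and> n \<le> N \<and> a n x \<le> birkhoff_sum T G n x"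
  shows "a L x \<le> birkhoff_sum T G L x + real N * K"
proof (induction L arbitrary: x rule: less_induct)
  case (less L)
  have linear: "a n x \<le> real n * K" for n x
  proof (induction n)
    case (Suc n)
    with sub[of n 1 x] one[of "(T ^^ n) x"] show ?case
      by (simp add: algebra_simps)
  qed (use zero in simp)
  obtain n where n: "1 \<le> n" "n \<le> N" "a n x \<le> birkhoff_sum T G n x"
    using stop by blast
  show ?case
  proof (cases "n \<le> L")
    case True
    then have L: "L = n + (L - n)" by simp
    have "a L x \<le> a n x + a (L - n) ((T ^^ n) x)"
      using sub[of n "L - n" x] L by simp
    also have "\<dots> \<le> birkhoff_sum T G n x
        + (birkhoff_sum T G (L - n) ((T ^^ n) x) + real N * K)"
      using n True by (intro add_mono less.IH) auto
    also have "\<dots> = birkhoff_sum T G L x + real N * K"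
      using birkhoff_sum_add[of T G n "L - n" x] L by simp
    finally show ?thesis .
  next
    case False
    then have "real L * K \<le> real N * K"
      using n \<open>0 \<le> K\<close> by (intro mult_right_mono) auto
    moreover have "0 \<le> birkhoff_sum T G L x"
      unfolding birkhoff_sum_def by (intro sum_nonneg G)
    ultimately show ?thesis
      using linear[of L x] by linarith
  qed
qed

locale measure_preserving_map = prob_space M for M :: "'a measure" +
  fixes T :: "'a \<Rightarrow> 'a"
  assumes T_measurable [measurable]: "T \<in> measurable M M"
    and distr_T: "distr M M T = M"
    and space_UNIV: "space M = UNIV"
begin

lemma funpow_measurable [measurable]: "(T ^^ n) \<in> measurable M M"
  by (induction n) (auto intro: measurable_compose simp: comp_def)

lemma distr_funpow: "distr M M (T ^^ n) = M"
proof (induction n)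
  case (Suc n)
  have "distr M M (T ^^ Suc n) = distr (distr M M (T ^^ n)) M T"
    by (simp add: distr_distr)
  with Suc show ?case by (simp only: distr_T)
qed (simp add: id_def)

lemma integral_funpow:
  fixes g :: "'a \<Rightarrow> real"
  assumes [measurable]: "g \<in> borel_measurable M"
  shows "(\<integral>x. g ((T ^^ n) x) \<partial>M) = (\<integral>x. g x \<partial>M)"
  using integral_distr[of "T ^^ n" M M g] by (simp add: distr_funpow)

lemma integrable_funpow:
  fixes g :: "'a \<Rightarrow> real"
  assumes "integrable M g"
  shows "integrable M (\<lambda>x. g ((T ^^ n) x))"
  using assms integrable_distr_eq[of "T ^^ n" M M g] by (simp add: distr_funpow)

lemma prob_funpow:
  assumes "A \<in> events"
  shows "prob {x. (T ^^ n) x \<in> A} = prob A"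
  using measure_distr[of "T ^^ n" M M A] assms by (simp add: distr_funpow space_UNIV vimage_def)

lemma birkhoff_sum_integrable:
  assumes "integrable M g"
  shows "integrable M (birkhoff_sum T g n)"
  unfolding birkhoff_sum_def[abs_def] by (intro Bochner_Integration.integrable_sum integrable_funpow assms)

lemma integral_birkhoff_sum:
  assumes "integrable M g"
  shows "(\<integral>x. birkhoff_sum T g n x \<partial>M) = real n * (\<integral>x. g x \<partial>M)"
  using assms
  by (simp add: birkhoff_sum_def Bochner_Integration.integral_sum integrable_funpow integral_funpow)

lemma integral_stopping_time_bound:
  fixes a :: "nat \<Rightarrow> 'a \<Rightarrow> real"
  assumes "\<And>m n x. a (m + n) x \<le> a m x + a n ((T ^^ m) x)"
    and "\<And>x. a 0 x \<le> 0" "\<And>x. a 1 x \<le> K" "0 \<le> K" "\<And>x. 0 \<le> G x"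
    and "\<And>x. \<exists>n. 1 \<le> n \<and> n \<le> N \<and> a n x \<le> birkhoff_sum T G n x"
    and int: "integrable M G" "integrable M (a L)"
  shows "(\<integral>x. a L x \<partial>M) \<le> real L * (\<integral>x. G x \<partial>M) + real N * K"
proof -
  have "(\<integral>x. a L x \<partial>M) \<le> (\<integral>x. birkhoff_sum T G L x + real N * K \<partial>M)"
    using stopping_time_bound[of a T K G N, OF assms(1-6)] int
    by (intro integral_mono birkhoff_sum_integrable) (auto intro!: birkhoff_sum_integrable)
  also have "\<dots> = real L * (\<integral>x. G x \<partial>M) + real N * K"
    using int by (simp add: integral_birkhoff_sum birkhoff_sum_integrable prob_space)
  finally show ?thesis .
qed

text \<open>Restricts stopping times that are finite almost everywhere to bounded ones, at the price of an
  exceptional set of small measure.\<close>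
lemma exceptional_prob_small:
  fixes A :: "nat \<Rightarrow> 'a set"
  assumes "\<And>n. A n \<in> events" "incseq A" "AE x in M. \<exists>n. x \<in> A n" "0 < \<epsilon>"
  obtains n where "prob (- A n) < \<epsilon>"
proof -
  have "(\<lambda>n. prob (A n)) \<longlonglongrightarrow> prob (\<Union>n. A n)"
    using assms by (intro finite_Lim_measure_incseq) auto
  moreover have "prob (\<Union>n. A n) = 1"
    using assms(1,3) by (subst prob_eq_1) auto
  ultimately have "\<forall>\<^sub>F n in sequentially. prob (A n) > 1 - \<epsilon>"
    using assms(4) by (intro order_tendstoD) auto
  then obtain n where "prob (A n) > 1 - \<epsilon>"
    by (auto simp: eventually_sequentially)
  then show ?thesis
    using that[of n] prob_compl[of "A n"] assms(1) by (simp add: space_UNIV Compl_eq_Diff_UNIV)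
qed

text \<open>The half of Birkhoff's ergodic theorem that carries its content. The stopping time bound is
  applied to the sums of \<open>C - f\<close>, which are nonnegative for large \<open>C\<close>. The stopping time at \<open>x\<close> is some \<open>n\<close> with
  average at least \<open>c\<close>; at the few points without a bounded such \<open>n\<close> a single step is taken and
  \<open>G\<close> is raised to \<open>2 * C\<close>.\<close>
lemma integral_ge_of_averages_ge:
  fixes f :: "'a \<Rightarrow> real"
  assumes f [measurable]: "f \<in> borel_measurable M" and bound: "\<And>x. \<bar>f x\<bar> \<le> B"
    and ae: "AE x in M. \<exists>n\<ge>1. real n * c \<le> birkhoff_sum T f n x"
  shows "c \<le> (\<integral>x. f x \<partial>M)"
proof (rule field_le_epsilon)
  fix e :: real assume "0 < e"
  define C where "C = B + \<bar>c\<bar> + 1"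
  have C: "\<bar>f x\<bar> \<le> C" "\<bar>c\<bar> \<le> C" "0 < C" for x
    using bound[of x] abs_ge_zero[of "f x"] unfolding C_def by linarith+
  define good where "good N = {x. \<exists>n\<in>{1..N}. real n * c \<le> birkhoff_sum T f n x}" for N :: nat
  have [measurable]: "good N \<in> events" for N
  proof -
    have "good N = (\<Union>n\<in>{1..N}. {x\<in>space M. real n * c \<le> birkhoff_sum T f n x})"
      by (auto simp: good_def space_UNIV)
    also have "\<dots> \<in> events"
      unfolding birkhoff_sum_def by measurable
    finally show ?thesis .
  qed
  have "incseq good"
    by (intro monoI) (force simp: good_def)
  moreover have "AE x in M. \<exists>N. x \<in> good N"
    using ae by eventually_elim (force simp: good_def)
  ultimately obtain N where N: "prob (- good N) < e / (2 * C)"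
    using exceptional_prob_small[of good "e / (2 * C)"] \<open>0 < e\<close> C(3) by auto
  define G where "G x = (C - c) + 2 * C * indicator (- good N) x" for x
  have int_f: "integrable M f"
    using bound by (intro integrable_const_bound[of _ B]) auto
  have compl [measurable]: "- good N \<in> events"
    using sets.compl_sets[of "good N" M] by (simp add: space_UNIV Compl_eq_Diff_UNIV)
  have int_G: "integrable M G"
    unfolding G_def[abs_def] by (intro Bochner_Integration.integrable_add integrable_mult_right integrable_real_indicator)
      (auto simp: emeasure_eq_measure)
  have G_ge: "C - c \<le> G x" "0 \<le> G x" for x
    using C by (auto simp: G_def indicator_def)
  have stop: "\<exists>n. 1 \<le> n \<and> n \<le> max 1 N \<and> birkhoff_sum T (\<lambda>x. C - f x) n x \<le> birkhoff_sum T G n x" for x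
  proof (cases "x \<in> good N")
    case True
    then obtain n where n: "1 \<le> n" "n \<le> N" "real n * c \<le> birkhoff_sum T f n x"
      by (auto simp: good_def)
    have "birkhoff_sum T (\<lambda>x. C - f x) n x = real n * C - birkhoff_sum T f n x"
      by (simp add: birkhoff_sum_def sum_subtractf)
    also have "\<dots> \<le> (\<Sum>i<n. C - c)"
      using n by (simp add: algebra_simps)
    also have "\<dots> \<le> birkhoff_sum T G n x"
      unfolding birkhoff_sum_def by (intro sum_mono G_ge)
    finally show ?thesis
      using n by (intro exI[of _ n]) auto
  next
    case False
    then show ?thesis
      using C(1)[of x] C(2) by (intro exI[of _ 1]) (auto simp: birkhoff_sum_def G_def)
  qed
  have main: "real L * (C - (\<integral>x. f x \<partial>M)) \<le> real L * (\<integral>x. G x \<partial>M) + real (max 1 N) * (2 * C)" for L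
  proof -
    have int: "integrable M (\<lambda>x. C - f x)"
      using int_f by auto
    have "(\<integral>x. birkhoff_sum T (\<lambda>x. C - f x) L x \<partial>M) \<le> real L * (\<integral>x. G x \<partial>M) + real (max 1 N) * (2 * C)"
    proof (rule integral_stopping_time_bound)
      show "birkhoff_sum T (\<lambda>x. C - f x) 1 x \<le> 2 * C" for x
        using C(1)[of x] by (simp add: birkhoff_sum_def)
      show "birkhoff_sum T (\<lambda>x. C - f x) 0 x \<le> 0" for x
        by (simp add: birkhoff_sum_def)
    qed (use C(3) G_ge stop int_G birkhoff_sum_integrable[OF int] in \<open>auto simp: birkhoff_sum_add\<close>)
    then show ?thesis
      using int int_f by (simp add: integral_birkhoff_sum prob_space)
  qed
  have "(\<integral>x. G x \<partial>M) = (C - c) + 2 * C * prob (- good N)"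
    unfolding G_def using compl by (subst Bochner_Integration.integral_add)
      (auto simp: prob_space emeasure_eq_measure)
  also have "\<dots> \<le> (C - c) + 2 * C * (e / (2 * C))"
    using N C(3) by (intro add_left_mono mult_left_mono) auto
  also have "\<dots> = C - c + e"
    using C(3) by simp
  finally have G_le: "(\<integral>x. G x \<partial>M) \<le> C - c + e" .
  show "c \<le> (\<integral>x. f x \<partial>M) + e"
  proof (rule ccontr)
    assume "\<not> ?thesis"
    then have pos: "0 < c - (\<integral>x. f x \<partial>M) - e" by simp
    obtain L :: nat where L: "real (max 1 N) * (2 * C) < real L * (c - (\<integral>x. f x \<partial>M) - e)"
      using reals_Archimedean3[OF pos] by blast
    have "real L * (\<integral>x. G x \<partial>M) \<le> real L * (C - c + e)"
      using G_le by (intro mult_left_mono) auto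
    with main[of L] L show False
      by (simp add: algebra_simps)
  qed
qed

end

section \<open>Block entropy of a labelled map\<close>

text \<open>The mean code length is at least the entropy: a code with lengths \<open>- ln (q u)\<close> is worse than the
  one adapted to \<open>p\<close>. Termwise this is \<open>ln t \<le> t - 1\<close> at \<open>t = q u / p u\<close>.\<close>
lemma gibbs_inequality:
  fixes p q :: "'b \<Rightarrow> real"
  assumes "\<And>u. u \<in> W \<Longrightarrow> 0 \<le> p u" "\<And>u. u \<in> W \<Longrightarrow> 0 \<le> q u"
    and pos: "\<And>u. u \<in> W \<Longrightarrow> 0 < p u \<Longrightarrow> 0 < q u"
    and sums: "(\<Sum>u\<in>W. q u) \<le> (\<Sum>u\<in>W. p u)"
  shows "- (\<Sum>u\<in>W. p u * ln (p u)) \<le> (\<Sum>u\<in>W. p u * - ln (q u))"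
proof -
  have "p u * - ln (p u) - p u * - ln (q u) \<le> q u - p u" if u: "u \<in> W" for u
  proof (cases "p u = 0")
    case False
    with assms(1)[OF u] pos[OF u] have *: "0 < p u" "0 < q u" by auto
    then have "p u * - ln (p u) - p u * - ln (q u) = p u * ln (q u / p u)"
      by (simp add: ln_div algebra_simps)
    also have "\<dots> \<le> p u * (q u / p u - 1)"
      using * by (intro mult_left_mono ln_le_minus_one) auto
    also have "\<dots> = q u - p u"
      using * by (simp add: field_simps)
    finally show ?thesis .
  qed (use assms(2)[OF u] in simp)
  then have "(\<Sum>u\<in>W. p u * - ln (p u) - p u * - ln (q u)) \<le> (\<Sum>u\<in>W. q u - p u)"
    by (rule sum_mono)
  then show ?thesis
    using sums by (simp add: sum_subtractf sum_negf)
qed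

text \<open>Writing \<open>n = q * m + r\<close> with \<open>r < m\<close> gives \<open>a n / n \<le> a m / m + C / n\<close>, so the limit is the
  infimum of the quotients.\<close>
lemma fekete:
  fixes a :: "nat \<Rightarrow> real"
  assumes nonneg: "\<And>n. 0 \<le> a n" and sub: "\<And>m n. a (m + n) \<le> a m + a n"
  shows "convergent (\<lambda>n. a n / real n)"
proof -
  define l where "l = (INF m\<in>{1..}. a m / real m)"
  have bdd: "bdd_below ((\<lambda>m. a m / real m) ` {1..})"
    using nonneg by (intro bdd_belowI[of _ 0]) auto
  have lower: "l \<le> a m / real m" if "1 \<le> m" for m
    unfolding l_def using that by (intro cINF_lower bdd) auto
  have mult: "a (k * m + r) \<le> real k * a m + a r" for k m r
  proof (induction k)
    case (Suc k)
    with sub[of m "k * m + r"] show ?case by (simp add: algebra_simps)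
  qed simp
  have "(\<lambda>n. a n / real n) \<longlonglongrightarrow> l"
  proof (rule LIMSEQ_I)
    fix e :: real assume "0 < e"
    have "\<exists>x\<in>(\<lambda>m. a m / real m) ` {1..}. x < l + e / 2"
      using \<open>0 < e\<close> cInf_less_iff[of "(\<lambda>m. a m / real m) ` {1..}" "l + e / 2"] bdd by (auto simp: l_def)
    then obtain m :: nat where m: "1 \<le> m" "a m / real m < l + e / 2"
      by auto
    define C where "C = (\<Sum>r<m. a r)"
    obtain n0 :: nat where n0: "2 * C / e < real n0"
      using reals_Archimedean2 by blast
    have "norm (a n / real n - l) < e" if n: "max 1 n0 \<le> n" for n
    proof -
      have n_pos: "0 < real n" using n by auto
      have "a (n mod m) \<le> C"
        unfolding C_def using m by (intro member_le_sum) (auto simp: nonneg)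
      then have "a n \<le> real (n div m) * a m + C"
        using mult[of "n div m" m "n mod m"] by simp
      also have "real (n div m) * a m \<le> (real n / real m) * a m"
        using of_nat_div_le_of_nat[of n m, where 'a=real] nonneg by (intro mult_right_mono) auto
      finally have "a n / real n \<le> a m / real m + C / real n"
        using n_pos m(1) by (simp add: field_simps)
      moreover have "C / real n < e / 2"
      proof -
        have "2 * C / e < real n" using n n0 by linarith
        then show ?thesis using n_pos \<open>0 < e\<close> by (simp add: field_simps)
      qed
      ultimately have "a n / real n < l + e"
        using m by linarith
      moreover have "l \<le> a n / real n"
        using lower[of n] n by simp
      ultimately show ?thesis by simp
    qed
    then show "\<exists>n0. \<forall>n\<ge>n0. norm (a n / real n - l) < e" by blast
  qed
  then show ?thesis by (rule convergentI)
qed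

definition word :: "('a \<Rightarrow> 'a) \<Rightarrow> ('a \<Rightarrow> 'b) \<Rightarrow> nat \<Rightarrow> 'a \<Rightarrow> 'b list" where
  "word T c n x = map (\<lambda>i. c ((T ^^ i) x)) [0..<n]"

definition words :: "'b set \<Rightarrow> nat \<Rightarrow> 'b list set" where
  "words \<Lambda> n = {u. set u \<subseteq> \<Lambda> \<and> length u = n}"

lemma length_word [simp]: "length (word T c n x) = n"
  by (simp add: word_def)

lemma nth_word [simp]: "i < n \<Longrightarrow> word T c n x ! i = c ((T ^^ i) x)"
  by (simp add: word_def)

lemma word_add: "word T c (m + n) x = word T c m x @ word T c n ((T ^^ m) x)"
proof (rule nth_equalityI)
  fix i assume "i < length (word T c (m + n) x)"
  moreover have "(T ^^ i) x = (T ^^ (i - m)) ((T ^^ m) x)" if "m \<le> i"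
    using that by (metis comp_apply funpow_add le_add_diff_inverse2)
  ultimately show "word T c (m + n) x ! i = (word T c m x @ word T c n ((T ^^ m) x)) ! i"
    by (auto simp: nth_append)
qed simp

lemma finite_words: "finite \<Lambda> \<Longrightarrow> finite (words \<Lambda> n)"
  using finite_lists_length_eq[of \<Lambda> n] by (simp add: words_def)

lemma sum_words_add:
  fixes g h :: "'b list \<Rightarrow> real"
  shows "(\<Sum>u\<in>words \<Lambda> (m + n). g (take m u) * h (drop m u)) = (\<Sum>u\<in>words \<Lambda> m. g u) * (\<Sum>u\<in>words \<Lambda> n. h u)"
proof -
  have "(\<Sum>u\<in>words \<Lambda> (m + n). g (take m u) * h (drop m u))
      = (\<Sum>(u, v)\<in>words \<Lambda> m \<times> words \<Lambda> n. g u * h v)"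
    by (rule sum.reindex_bij_witness[of _ "\<lambda>(u, v). u @ v" "\<lambda>u. (take m u, drop m u)"])
      (auto simp: words_def dest: in_set_takeD in_set_dropD)
  then show ?thesis
    by (simp add: sum_product sum.cartesian_product)
qed

lemma words_0 [simp]: "words \<Lambda> 0 = {[]}"
  by (auto simp: words_def)

lemma words_1: "words \<Lambda> 1 = (\<lambda>b. [b]) ` \<Lambda>"
  by (auto simp: words_def length_Suc_conv)

lemma sum_words_Suc:
  fixes F :: "'b list \<Rightarrow> real"
  shows "(\<Sum>u\<in>words \<Lambda> (Suc n). F u) = (\<Sum>u\<in>words \<Lambda> n. \<Sum>b\<in>\<Lambda>. F (u @ [b]))"
proof -
  have "(\<Sum>u\<in>words \<Lambda> (Suc n). F u) = (\<Sum>(u, b)\<in>words \<Lambda> n \<times> \<Lambda>. F (u @ [b]))"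
    by (rule sum.reindex_bij_witness[of _ "\<lambda>(u, b). u @ [b]" "\<lambda>u. (butlast u, last u)"])
      (auto simp: words_def dest: in_set_butlastD intro!: subsetD[OF _ last_in_set] simp flip: length_greater_0_conv)
  then show ?thesis
    by (simp add: sum.cartesian_product)
qed

text \<open>A product measure on words: with \<open>g\<close> a subprobability in each letter, the total weight of all words is at
  most one. This is where Kraft's inequality passes from letters to words.\<close>
lemma sum_words_prod:
  fixes g :: "nat \<Rightarrow> 'b \<Rightarrow> real"
  shows "(\<Sum>u\<in>words \<Lambda> n. \<Prod>t<n. g t (u ! t)) = (\<Prod>t<n. \<Sum>b\<in>\<Lambda>. g t b)"
proof (induction n)
  case (Suc n)
  have "(\<Sum>u\<in>words \<Lambda> (Suc n). \<Prod>t<Suc n. g t (u ! t))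
      = (\<Sum>u\<in>words \<Lambda> n. \<Sum>b\<in>\<Lambda>. (\<Prod>t<n. g t (u ! t)) * g n b)"
    unfolding sum_words_Suc
    by (intro sum.cong refl) (auto simp: words_def nth_append intro!: arg_cong2[where f = "(*)"] prod.cong)
  then show ?case
    by (simp add: sum_distrib_left[symmetric] sum_distrib_right[symmetric] Suc.IH)
qed simp

text \<open>A finite partition enters as a labelling of points, so that joins of preimages become
  itineraries and concatenation of words replaces refinement.\<close>
locale labelled_map = measure_preserving_map M T for M :: "'a measure" and T +
  fixes c :: "'a \<Rightarrow> 'b" and \<Lambda> :: "'b set"
  assumes finite_labels: "finite \<Lambda>" and label_in: "c x \<in> \<Lambda>"
    and label_measurable: "{x. c x = b} \<in> events"
begin

definition word_prob :: "nat \<Rightarrow> 'b list \<Rightarrow> real" where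
  "word_prob n u = prob {x. word T c n x = u}"

definition block_entropy :: "nat \<Rightarrow> real" where
  "block_entropy n = - (\<Sum>u\<in>words \<Lambda> n. word_prob n u * ln (word_prob n u))"

lemma word_in_words: "word T c n x \<in> words \<Lambda> n"
  using label_in by (auto simp: words_def word_def)

lemma cylinder_measurable [measurable]: "{x. word T c n x = u} \<in> events"
proof (cases "length u = n")
  case True
  have "{x. word T c n x = u} = {x\<in>space M. \<forall>i\<in>{..<n}. (T ^^ i) x \<in> {y. c y = u ! i}}"
    using True by (auto simp: list_eq_iff_nth_eq space_UNIV)
  also have "\<dots> \<in> events"
    using label_measurable by measurable
  finally show ?thesis .
next
  case False
  then have "{x. word T c n x = u} = {}" by auto
  then show ?thesis by simp
qed

lemma
  fixes g :: "'b list \<Rightarrow> real"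
  shows integrable_word: "integrable M (\<lambda>x. g (word T c n x))"
    and integral_word: "(\<integral>x. g (word T c n x) \<partial>M) = (\<Sum>u\<in>words \<Lambda> n. word_prob n u * g u)"
proof -
  have *: "g (word T c n x) = (\<Sum>u\<in>words \<Lambda> n. indicator {x. word T c n x = u} x * g u)" for x
  proof -
    have "(\<Sum>u\<in>words \<Lambda> n. indicator {x. word T c n x = u} x * g u)
        = (\<Sum>u\<in>words \<Lambda> n. if u = word T c n x then g u else 0)"
      by (intro sum.cong) (auto simp: indicator_def)
    then show ?thesis
      using word_in_words[of n x] finite_words[OF finite_labels] by simp
  qed
  have int: "integrable M (\<lambda>x. indicator {x. word T c n x = u} x * g u)" for u
    by (intro integrable_mult_left integrable_real_indicator) (auto simp: emeasure_eq_measure)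
  show "integrable M (\<lambda>x. g (word T c n x))"
    unfolding * by (intro Bochner_Integration.integrable_sum int)
  show "(\<integral>x. g (word T c n x) \<partial>M) = (\<Sum>u\<in>words \<Lambda> n. word_prob n u * g u)"
    unfolding * by (subst Bochner_Integration.integral_sum[OF int])
      (simp add: word_prob_def del: Collect_const)
qed

lemma word_prob_nonneg: "0 \<le> word_prob n u" and word_prob_le_1: "word_prob n u \<le> 1"
  by (auto simp: word_prob_def)

lemma sum_word_prob: "(\<Sum>u\<in>words \<Lambda> n. word_prob n u) = 1"
  using integral_word[of "\<lambda>_. 1" n] by (simp add: prob_space)

lemma block_entropy_nonneg: "0 \<le> block_entropy n"
proof -
  have "word_prob n u * ln (word_prob n u) \<le> 0" for u
    using word_prob_nonneg[of n u] word_prob_le_1[of n u]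
    by (cases "word_prob n u = 0") (auto intro!: mult_nonneg_nonpos)
  then show ?thesis
    unfolding block_entropy_def by (simp add: sum_nonpos)
qed

text \<open>Upper bounds for the entropy are obtained from a subprobability on words.\<close>
lemma block_entropy_le_coding:
  assumes "\<And>u. u \<in> words \<Lambda> n \<Longrightarrow> 0 \<le> q u"
    and "\<And>u. u \<in> words \<Lambda> n \<Longrightarrow> 0 < word_prob n u \<Longrightarrow> 0 < q u"
    and "(\<Sum>u\<in>words \<Lambda> n. q u) \<le> 1"
  shows "block_entropy n \<le> (\<integral>x. - ln (q (word T c n x)) \<partial>M)"
  unfolding integral_word[of "\<lambda>u. - ln (q u)"] block_entropy_def
  using assms by (intro gibbs_inequality) (auto simp: word_prob_nonneg sum_word_prob)

lemma word_prob_add_le: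
  "word_prob (m + n) u \<le> word_prob m (take m u)" "word_prob (m + n) u \<le> word_prob n (drop m u)"
proof -
  show "word_prob (m + n) u \<le> word_prob m (take m u)"
    unfolding word_prob_def by (intro finite_measure_mono) (auto simp: word_add)
  have "prob {x. word T c (m + n) x = u} \<le> prob {x. (T ^^ m) x \<in> {y. word T c n y = drop m u}}"
  proof (intro finite_measure_mono)
    have "(T ^^ m) -` {y. word T c n y = drop m u} \<inter> space M \<in> events"
      by (intro measurable_sets[of _ M M]) auto
    then show "{x. (T ^^ m) x \<in> {y. word T c n y = drop m u}} \<in> events"
      by (simp add: space_UNIV vimage_def)
  qed (auto simp: word_add)
  then show "word_prob (m + n) u \<le> word_prob n (drop m u)"
    unfolding word_prob_def by (simp only: prob_funpow[OF cylinder_measurable])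
qed

text \<open>Code the two halves of a word independently, each by its own distribution.\<close>
lemma block_entropy_subadditive: "block_entropy (m + n) \<le> block_entropy m + block_entropy n"
proof -
  define q where "q u = word_prob m (take m u) * word_prob n (drop m u)" for u
  have "(\<Sum>u\<in>words \<Lambda> (m + n). q u) = 1"
    unfolding q_def sum_words_add sum_word_prob by simp
  moreover have pos: "0 < word_prob m (take m u) \<and> 0 < word_prob n (drop m u)"
    if "0 < word_prob (m + n) u" for u
    using that word_prob_add_le[of m n u] by linarith
  ultimately have "block_entropy (m + n) \<le> (\<integral>x. - ln (q (word T c (m + n) x)) \<partial>M)"
    by (intro block_entropy_le_coding) (auto simp: q_def word_prob_nonneg)
  also have "\<dots> = (\<Sum>u\<in>words \<Lambda> (m + n). word_prob (m + n) u * - ln (q u))"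
    by (rule integral_word)
  also have "\<dots> = (\<Sum>u\<in>words \<Lambda> (m + n). word_prob (m + n) u *
      (- ln (word_prob m (take m u)) - ln (word_prob n (drop m u))))"
  proof (intro sum.cong refl)
    fix u
    show "word_prob (m + n) u * - ln (q u)
      = word_prob (m + n) u * (- ln (word_prob m (take m u)) - ln (word_prob n (drop m u)))"
    proof (cases "word_prob (m + n) u = 0")
      case False
      with word_prob_nonneg[of "m + n" u] pos[of u] show ?thesis
        by (simp add: q_def ln_mult)
    qed simp
  qed
  also have "\<dots> = (\<integral>x. - ln (word_prob m (take m (word T c (m + n) x)))
      - ln (word_prob n (drop m (word T c (m + n) x))) \<partial>M)"
    by (rule integral_word[symmetric])
  also have "\<dots> = (\<integral>x. - ln (word_prob m (word T c m x)) \<partial>M)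
      + (\<integral>x. - ln (word_prob n (word T c n ((T ^^ m) x))) \<partial>M)"
    unfolding word_add
    using integrable_word[of "\<lambda>u. - ln (word_prob m u)" m]
      integrable_funpow[OF integrable_word[of "\<lambda>u. - ln (word_prob n u)" n], of m]
    by (subst Bochner_Integration.integral_add[symmetric]) simp_all
  also have "(\<integral>x. - ln (word_prob n (word T c n ((T ^^ m) x))) \<partial>M)
      = (\<integral>x. - ln (word_prob n (word T c n x)) \<partial>M)"
    using borel_measurable_integrable[OF integrable_word[of "\<lambda>u. - ln (word_prob n u)" n]]
    by (intro integral_funpow[of "\<lambda>x. - ln (word_prob n (word T c n x))"])
  finally show ?thesis
    unfolding integral_word[of "\<lambda>u. - ln (word_prob _ u)"] block_entropy_def by (simp add: sum_negf)
qed

lemma block_entropy_convergent: "convergent (\<lambda>n. block_entropy n / real n)"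
  by (intro fekete block_entropy_nonneg block_entropy_subadditive)

end

definition cell :: "'a set set \<Rightarrow> 'a \<Rightarrow> 'a set" where
  "cell \<xi> x = (THE A. A \<in> \<xi> \<and> x \<in> A)"

lemma cell_eq_iff:
  assumes "partition_on UNIV \<xi>"
  shows "A \<in> \<xi> \<Longrightarrow> cell \<xi> x = A \<longleftrightarrow> x \<in> A" and "cell \<xi> x \<in> \<xi>"
proof -
  have unique: "A = B" if "A \<in> \<xi>" "B \<in> \<xi>" "x \<in> A" "x \<in> B" for A B
    using that partition_onD2[OF assms] by (auto dest: disjointD)
  have "\<exists>A. A \<in> \<xi> \<and> x \<in> A"
    using partition_onD1[OF assms] by blast
  then have *: "cell \<xi> x \<in> \<xi> \<and> x \<in> cell \<xi> x"
    unfolding cell_def using unique by (intro theI'[of "\<lambda>A. A \<in> \<xi> \<and> x \<in> A"] ex_ex1I) blast+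
  then show "cell \<xi> x \<in> \<xi>" by simp
  show "cell \<xi> x = A \<longleftrightarrow> x \<in> A" if "A \<in> \<xi>"
    using * that unique[of "cell \<xi> x" A] by auto
qed

context measure_preserving_map
begin

lemma labelled_map_cell:
  assumes "finite_measurable_partition M \<xi>"
  shows "labelled_map M T (cell \<xi>) \<xi>"
proof
  have part: "partition_on UNIV \<xi>"
    using assms by (simp add: finite_measurable_partition_def space_UNIV)
  show "finite \<xi>" "cell \<xi> x \<in> \<xi>" for x
    using assms cell_eq_iff(2)[OF part] by (auto simp: finite_measurable_partition_def)
  show "{x. cell \<xi> x = A} \<in> events" for A
  proof (cases "A \<in> \<xi>")
    case True
    then show ?thesis
      using assms cell_eq_iff(1)[OF part] by (auto simp: finite_measurable_partition_def)
  next
    case False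
    then have "{x. cell \<xi> x = A} = {}"
      using cell_eq_iff(2)[OF part] by auto
    then show ?thesis by simp
  qed
qed

text \<open>The definition of the iterated join forms a set of partitions, in which coinciding preimages are
  identified. In terms of itineraries this makes no difference.\<close>
lemma iterated_join_eq:
  assumes "finite_measurable_partition M \<xi>"
  shows "iterated_join M T \<xi> n
    = (\<lambda>u. {x. word T (cell \<xi>) n x = u}) ` words \<xi> n - {{}}"
proof -
  have part: "partition_on UNIV \<xi>"
    using assms by (simp add: finite_measurable_partition_def space_UNIV)
  note cell = cell_eq_iff[OF part]
  define pre where "pre i = (\<lambda>A. (T ^^ i) -` A) ` \<xi>" for i
  have join: "iterated_join M T \<xi> n = (\<Union>f \<in> (\<Pi> P\<in>pre ` {..<n}. P). {\<Inter> (f ` pre ` {..<n})}) - {{}}"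
    by (simp add: iterated_join_def common_refinement pre_def space_UNIV)
  show ?thesis
  proof (intro equalityI subsetI)
    fix X assume "X \<in> iterated_join M T \<xi> n"
    then obtain f where f: "f \<in> (\<Pi> P\<in>pre ` {..<n}. P)" "X = \<Inter> (f ` pre ` {..<n})" "X \<noteq> {}"
      by (auto simp: join)
    then obtain x where x: "x \<in> X" by auto
    have "X = {y. word T (cell \<xi>) n y = word T (cell \<xi>) n x}"
    proof (intro equalityI subsetI CollectI)
      fix y assume y: "y \<in> X"
      show "word T (cell \<xi>) n y = word T (cell \<xi>) n x"
      proof (rule nth_equalityI)
        fix i assume "i < length (word T (cell \<xi>) n y)"
        then have i: "i < n" by simp
        then have "f (pre i) \<in> pre i" "y \<in> f (pre i)" "x \<in> f (pre i)"
          using f x y by auto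
        then obtain A where "A \<in> \<xi>" "(T ^^ i) y \<in> A" "(T ^^ i) x \<in> A"
          by (auto simp: pre_def)
        then show "word T (cell \<xi>) n y ! i = word T (cell \<xi>) n x ! i"
          using i cell(1)[of A "(T ^^ i) x"] cell(1)[of A "(T ^^ i) y"] by simp
      qed simp
    next
      fix y assume "y \<in> {y. word T (cell \<xi>) n y = word T (cell \<xi>) n x}"
      then have eq: "word T (cell \<xi>) n y = word T (cell \<xi>) n x" by simp
      have y: "cell \<xi> ((T ^^ i) y) = cell \<xi> ((T ^^ i) x)" if "i < n" for i
        using arg_cong[OF eq, of "\<lambda>u. u ! i"] that by simp
      have "y \<in> f (pre i)" if i: "i < n" for i
      proof -
        have "f (pre i) \<in> pre i" "x \<in> f (pre i)"
          using f x i by auto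
        then obtain A where "A \<in> \<xi>" "f (pre i) = (T ^^ i) -` A" "(T ^^ i) x \<in> A"
          by (auto simp: pre_def)
        then show ?thesis
          using y[OF i] cell(1)[of A "(T ^^ i) x"] cell(1)[of A "(T ^^ i) y"] by simp
      qed
      then show "y \<in> X" by (simp add: f)
    qed
    moreover have "word T (cell \<xi>) n x \<in> words \<xi> n"
      using cell(2) by (auto simp: words_def word_def)
    ultimately show "X \<in> (\<lambda>u. {x. word T (cell \<xi>) n x = u}) ` words \<xi> n - {{}}"
      using f by auto
  next
    fix X assume "X \<in> (\<lambda>u. {x. word T (cell \<xi>) n x = u}) ` words \<xi> n - {{}}"
    then obtain x where x: "X = {y. word T (cell \<xi>) n y = word T (cell \<xi>) n x}"
      by auto
    define f where "f P = (THE B. B \<in> P \<and> x \<in> B)" for P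
    have f: "f (pre i) = {y. cell \<xi> ((T ^^ i) y) = cell \<xi> ((T ^^ i) x)} \<and> f (pre i) \<in> pre i" for i
    proof -
      have *: "(T ^^ i) -` cell \<xi> ((T ^^ i) x) = {y. cell \<xi> ((T ^^ i) y) = cell \<xi> ((T ^^ i) x)}"
        using cell by auto
      have "f (pre i) = (T ^^ i) -` cell \<xi> ((T ^^ i) x)"
        unfolding f_def
      proof (rule the_equality)
        show "(T ^^ i) -` cell \<xi> ((T ^^ i) x) \<in> pre i \<and> x \<in> (T ^^ i) -` cell \<xi> ((T ^^ i) x)"
          using cell by (auto simp: pre_def)
      next
        fix B assume "B \<in> pre i \<and> x \<in> B"
        then show "B = (T ^^ i) -` cell \<xi> ((T ^^ i) x)"
          using cell(1) by (auto simp: pre_def)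
      qed
      with * cell(2) show ?thesis by (auto simp: pre_def)
    qed
    have "X = \<Inter> (f ` pre ` {..<n})"
      using f by (auto simp: x list_eq_iff_nth_eq)
    moreover have "f \<in> (\<Pi> P\<in>pre ` {..<n}. P)"
      using f by auto
    ultimately show "X \<in> iterated_join M T \<xi> n"
      using x unfolding join by blast
  qed
qed

lemma partition_entropy_iterated_join:
  assumes "finite_measurable_partition M \<xi>"
  shows "partition_entropy M (iterated_join M T \<xi> n) = labelled_map.block_entropy M T (cell \<xi>) \<xi> n"
proof -
  interpret labelled_map M T "cell \<xi>" \<xi>
    by (rule labelled_map_cell[OF assms])
  let ?cyl = "\<lambda>u. {x. word T (cell \<xi>) n x = u}"
  let ?W = "{u\<in>words \<xi> n. ?cyl u \<noteq> {}}"
  have join: "iterated_join M T \<xi> n = ?cyl ` ?W"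
    unfolding iterated_join_eq[OF assms] by auto
  have "(\<Sum>A\<in>iterated_join M T \<xi> n. prob A * ln (prob A)) = (\<Sum>u\<in>?W. word_prob n u * ln (word_prob n u))"
    unfolding join word_prob_def by (subst sum.reindex) (auto simp: inj_on_def)
  also have "\<dots> = (\<Sum>u\<in>words \<xi> n. word_prob n u * ln (word_prob n u))"
    using finite_words[OF finite_labels] by (intro sum.mono_neutral_left) (auto simp: word_prob_def)
  finally show ?thesis
    by (simp add: partition_entropy_def block_entropy_def)
qed

lemma entropy_wrt_partition_tendsto:
  assumes "finite_measurable_partition M \<xi>"
  shows "(\<lambda>n. labelled_map.block_entropy M T (cell \<xi>) \<xi> n / real n) \<longlonglongrightarrow> entropy_wrt_partition M T \<xi>"
  unfolding entropy_wrt_partition_def partition_entropy_iterated_join[OF assms]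
  using labelled_map.block_entropy_convergent[OF labelled_map_cell[OF assms]]
  by (simp add: convergent_LIMSEQ_iff)

end

section \<open>Closed sets inside Borel sets\<close>

text \<open>Sets that lie between a closed and an open set with small difference form a \<open>\<sigma>\<close>-algebra. It contains
  each closed set \<open>A\<close>, which is the intersection of its open neighbourhoods of radius \<open>1 / n\<close>.\<close>
lemma closed_inner_regular:
  fixes M :: "'a::metric_space measure"
  assumes "finite_measure M" and sets: "sets M = sets borel"
    and A: "A \<in> sets M" and "0 < e"
  obtains K where "closed K" "K \<subseteq> A" "measure M (A - K) < e"
proof -
  interpret finite_measure M by fact
  note [simp] = sets
  have "A \<in> sigma_sets UNIV (Collect closed)"
    using A by (simp add: borel_eq_closed)
  then have "\<forall>e>0. \<exists>K G. closed K \<and> open G \<and> K \<subseteq> A \<and> A \<subseteq> G \<and> measure M (G - K) < e"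
  proof (induction rule: sigma_sets.induct)
    case (Basic A)
    then have "closed A" by simp
    show ?case
    proof (cases "A = {}")
      case True
      then show ?thesis by (intro allI impI exI[of _ "{}"]) auto
    next
      case False
      define G where "G n = {x. infdist x A < 1 / real (Suc n)}" for n
      have G: "open (G n)" for n
        unfolding G_def by (intro open_Collect_less continuous_intros)
      have "decseq G"
        proof (intro decseq_SucI subsetI)
        fix n x assume "x \<in> G (Suc n)"
        moreover have "1 / real (Suc (Suc n)) \<le> 1 / real (Suc n)"
          by (intro divide_left_mono) auto
        ultimately show "x \<in> G n"
          unfolding G_def by (auto intro: less_le_trans)
      qed
      then have "(\<lambda>n. measure M (G n - A)) \<longlonglongrightarrow> measure M (\<Inter>n. G n - A)"
        using G \<open>closed A\<close> by (intro finite_Lim_measure_decseq) (auto simp: decseq_def)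
      moreover have "(\<Inter>n. G n - A) = {}"
      proof -
        have "x \<in> A" if "\<And>n. x \<in> G n" for x
        proof -
          have "infdist x A \<le> 0"
          proof (rule field_le_epsilon)
            fix d :: real assume "0 < d"
            then obtain n where "1 / real (Suc n) < d"
              using nat_approx_posE by blast
            with that[of n] show "infdist x A \<le> 0 + d"
              by (simp add: G_def)
          qed
          then show ?thesis
            using \<open>closed A\<close> False infdist_nonneg[of x A] in_closed_iff_infdist_zero by fastforce
        qed
        then show ?thesis by blast
      qed
      ultimately have lim: "(\<lambda>n. measure M (G n - A)) \<longlonglongrightarrow> 0"
        by (simp only: measure_empty)
      show ?thesis
      proof (intro allI impI)
        fix e :: real assume "0 < e"
        with lim have "\<forall>\<^sub>F n in sequentially. measure M (G n - A) < e"
          by (intro order_tendstoD)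
        then obtain n where "measure M (G n - A) < e"
          by (auto simp: eventually_sequentially)
        moreover have "A \<subseteq> G n"
          by (auto simp: G_def)
        ultimately show "\<exists>K G. closed K \<and> open G \<and> K \<subseteq> A \<and> A \<subseteq> G \<and> measure M (G - K) < e"
          using G \<open>closed A\<close> by blast
      qed
    qed
  next
    case Empty
    then show ?case by (intro allI impI exI[of _ "{}"]) auto
  next
    case (Compl A)
    show ?case
    proof (intro allI impI)
      fix e :: real assume "0 < e"
      from Compl.IH[rule_format, OF this]
      obtain K G where KG: "closed K" "open G" "K \<subseteq> A" "A \<subseteq> G" "measure M (G - K) < e"
        by (elim exE conjE) (rule that)
      moreover have "- K - - G = G - K" by auto
      ultimately show "\<exists>K G. closed K \<and> open G \<and> K \<subseteq> UNIV - A \<and> UNIV - A \<subseteq> G \<and> measure M (G - K) < e"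
        by (intro exI[of _ "- G"] exI[of _ "- K"]) (auto simp: closed_Compl open_Compl)
    qed
  next
    case (Union A)
    show ?case
    proof (intro allI impI)
      fix e :: real assume "0 < e"
      \<comment> \<open>The errors add up to \<open>e / 2\<close>; the other half pays for the passage to finitely many \<open>K n\<close>, which keeps
  the inner set closed.\<close>
      define d where "d n = (e / 2) * (1 / 2) ^ Suc n" for n
      have "\<exists>K G. closed K \<and> open G \<and> K \<subseteq> A n \<and> A n \<subseteq> G \<and> measure M (G - K) < d n" for n
        using \<open>0 < e\<close> by (intro Union.IH[rule_format]) (simp add: d_def)
      then obtain K G where KG: "\<And>n. closed (K n)" "\<And>n. open (G n)" "\<And>n. K n \<subseteq> A n" "\<And>n. A n \<subseteq> G n"
          "\<And>n. measure M (G n - K n) < d n"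
        by metis
      have [measurable]: "K n \<in> sets borel" "G n \<in> sets borel" for n
        using KG by auto
      have d: "summable d" "suminf d = e / 2"
        using sums_mult[OF power_half_series, of "e / 2"] by (simp_all add: d_def[abs_def] sums_iff)
      have summable: "summable (\<lambda>n. measure M (G n - K n))"
        using KG(5) by (intro summable_comparison_test[OF _ d(1)]) (auto intro!: exI[of _ 0] less_imp_le)
      have "measure M ((\<Union>n. G n) - (\<Union>n. K n)) \<le> measure M (\<Union>n. G n - K n)"
        by (intro finite_measure_mono) auto
      also have "\<dots> \<le> (\<Sum>n. measure M (G n - K n))"
        using summable by (intro finite_measure_subadditive_countably) auto
      also have "\<dots> \<le> e / 2"
        unfolding d(2)[symmetric] using KG(5) by (intro suminf_le summable d(1)) (auto intro: less_imp_le)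
      finally have le: "measure M ((\<Union>n. G n) - (\<Union>n. K n)) \<le> e / 2" .
      define D where "D N = (\<Union>n. G n) - (\<Union>n<N. K n)" for N
      have "D N \<in> sets borel" for N
        unfolding D_def by measurable
      moreover have "decseq D"
        by (force simp: decseq_def D_def)
      ultimately have "(\<lambda>N. measure M (D N)) \<longlonglongrightarrow> measure M (\<Inter>N. D N)"
        by (intro finite_Lim_measure_decseq) auto
      moreover have "(\<Inter>N. D N) = (\<Union>n. G n) - (\<Union>n. K n)"
        by (auto simp: D_def)
      ultimately have lim: "(\<lambda>N. measure M (D N)) \<longlonglongrightarrow> measure M ((\<Union>n. G n) - (\<Union>n. K n))"
        by simp
      have "\<forall>\<^sub>F N in sequentially. measure M (D N) < e"
        using le \<open>0 < e\<close> by (intro order_tendstoD(2)[OF lim]) auto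
      then obtain N where "measure M (D N) < e"
        by (auto simp: eventually_sequentially)
      moreover have "(\<Union>n<N. K n) \<subseteq> (\<Union>i. A i)" "(\<Union>i. A i) \<subseteq> (\<Union>n. G n)"
        using KG(3,4) by blast+
      moreover have "closed (\<Union>n<N. K n)" "open (\<Union>n. G n)"
        using KG(1,2) by auto
      ultimately show "\<exists>K G. closed K \<and> open G \<and> K \<subseteq> (\<Union>i. A i) \<and> (\<Union>i. A i) \<subseteq> G \<and> measure M (G - K) < e"
        unfolding D_def by blast
    qed
  qed
  from this[rule_format, OF \<open>0 < e\<close>]
  obtain K G where KG: "closed K" "open G" "K \<subseteq> A" "A \<subseteq> G" "measure M (G - K) < e"
    by (elim exE conjE) (rule that)
  have "measure M (A - K) \<le> measure M (G - K)"
    using KG by (intro finite_measure_mono) auto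
  then show ?thesis
    using that[of K] KG by simp
qed

section \<open>Time averages along a compact flow\<close>

locale compact_flow =
  fixes \<phi> :: "real \<Rightarrow> 'a::metric_space \<Rightarrow> 'a"
  assumes compact_UNIV: "compact (UNIV :: 'a set)" and flow: "continuous_flow \<phi>"
begin

lemma flow_zero [simp]: "\<phi> 0 x = x"
  using flow by (simp add: continuous_flow_def)

lemma flow_add: "\<phi> (s + t) x = \<phi> s (\<phi> t x)"
  using flow by (simp add: continuous_flow_def)

lemma funpow_flow: "(\<phi> s ^^ n) x = \<phi> (real n * s) x"
  by (induction n) (simp_all add: algebra_simps flow_add)

lemma continuous_flow_compose [continuous_intros]:
  assumes "continuous_on S f" "continuous_on S g"
  shows "continuous_on S (\<lambda>x. \<phi> (f x) (g x))"
proof -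
  have "continuous_on UNIV (\<lambda>(t, x). \<phi> t x)"
    using flow by (simp add: continuous_flow_def)
  then have "continuous_on S (\<lambda>x. (\<lambda>(t, x). \<phi> t x) (f x, g x))"
    by (rule continuous_on_compose2) (auto intro!: continuous_intros assms)
  then show ?thesis by simp
qed

lemma continuous_observable_flow:
  assumes "continuous_on UNIV f" "continuous_on S h" "continuous_on S g"
  shows "continuous_on S (\<lambda>x. f (\<phi> (h x) (g x)))"
  by (rule continuous_on_compose2[OF assms(1)]) (auto intro!: continuous_intros assms)

lemma observable_integrable:
  fixes f :: "'a \<Rightarrow> real"
  assumes "continuous_on UNIV f"
  shows "(\<lambda>t. f (\<phi> t x)) integrable_on {a..b}"
  by (intro integrable_continuous_interval continuous_observable_flow[OF assms] continuous_intros)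

lemma continuous_bounded:
  fixes f :: "'a \<Rightarrow> real"
  assumes "continuous_on UNIV f"
  obtains B where "0 < B" "\<And>x. \<bar>f x\<bar> \<le> B"
proof -
  have "bounded (range f)"
    using compact_continuous_image[OF assms compact_UNIV] by (rule compact_imp_bounded)
  then show ?thesis
    using that unfolding bounded_pos by auto
qed

lemma uniformly_close_orbits:
  assumes "0 < e"
  obtains d where "0 < d" "\<And>(x::'a) y t. dist x y < d \<Longrightarrow> 0 \<le> t \<Longrightarrow> t \<le> r \<Longrightarrow> dist (\<phi> t x) (\<phi> t y) < e"
proof -
  have "uniformly_continuous_on ({0..r} \<times> UNIV) (\<lambda>p. \<phi> (fst p) (snd p))"
    by (intro compact_uniformly_continuous compact_Times compact_UNIV continuous_intros) auto
  then obtain d where "0 < d" and d: "\<And>p q. p \<in> {0..r} \<times> UNIV \<Longrightarrow> q \<in> {0..r} \<times> UNIV \<Longrightarrow> dist q p < d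
      \<Longrightarrow> dist (\<phi> (fst q) (snd q)) (\<phi> (fst p) (snd p)) < e"
    using \<open>0 < e\<close> unfolding uniformly_continuous_on_def by blast
  show ?thesis
  proof (rule that[OF \<open>0 < d\<close>])
    fix x y :: 'a and t assume "dist x y < d" "0 \<le> t" "t \<le> r"
    then show "dist (\<phi> t x) (\<phi> t y) < e"
      using d[of "(t, y)" "(t, x)"] by (simp add: dist_Pair_Pair)
  qed
qed

lemma observable_short_time:
  fixes f :: "'a \<Rightarrow> real"
  assumes f: "continuous_on UNIV f" and "0 < e"
  obtains d where "0 < d" "\<And>x t. 0 \<le> t \<Longrightarrow> t \<le> d \<Longrightarrow> \<bar>f (\<phi> t x) - f x\<bar> < e"
proof -
  have "uniformly_continuous_on ({0..1} \<times> UNIV) (\<lambda>p. f (\<phi> (fst p) (snd p)))"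
    by (intro compact_uniformly_continuous compact_Times compact_UNIV continuous_observable_flow[OF f] continuous_intros) auto
  then obtain d where "0 < d" and d: "\<And>p q. p \<in> {0..1} \<times> UNIV \<Longrightarrow> q \<in> {0..1} \<times> UNIV \<Longrightarrow> dist q p < d
      \<Longrightarrow> dist (f (\<phi> (fst q) (snd q))) (f (\<phi> (fst p) (snd p))) < e"
    using \<open>0 < e\<close> unfolding uniformly_continuous_on_def by blast
  show ?thesis
  proof (rule that[of "min 1 (d / 2)"])
    fix x t assume t: "0 \<le> t" "t \<le> min 1 (d / 2)"
    then have "t < d" using \<open>0 < d\<close> by auto
    then show "\<bar>f (\<phi> t x) - f x\<bar> < e"
      using t d[of "(0, x)" "(t, x)"] by (simp add: dist_Pair_Pair dist_real_def)
  qed (use \<open>0 < d\<close> in auto)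
qed

text \<open>Integrals along orbits are compared with sums over iterates of \<open>\<phi> (1 / m)\<close>, with an error that is uniform
  in the starting point and proportional to time. This is how facts about maps are used for flows,
  and it takes the place of Fubini's theorem for the measure and the time.\<close>
lemma riemann_sum_approximation:
  fixes f :: "'a \<Rightarrow> real"
  assumes f: "continuous_on UNIV f" and "0 < e"
  obtains m :: nat where "1 \<le> m"
    "\<And>k x. \<bar>integral {0..real k / real m} (\<lambda>t. f (\<phi> t x)) - birkhoff_sum (\<phi> (1 / real m)) f k x / real m\<bar>
      \<le> e * (real k / real m)"
proof -
  obtain d where d: "0 < d" "\<And>x t. 0 \<le> t \<Longrightarrow> t \<le> d \<Longrightarrow> \<bar>f (\<phi> t x) - f x\<bar> < e"
    using observable_short_time[OF assms] by blast
  obtain n :: nat where n: "1 / real (Suc n) < d"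
    using nat_approx_posE d(1) by blast
  define m where "m = Suc n"
  have m: "1 \<le> m" "1 / real m < d" "0 < real m"
    using n by (auto simp: m_def)
  show ?thesis
  proof (rule that[OF m(1)])
    fix k x
    let ?g = "\<lambda>t. f (\<phi> t x)"
    show "\<bar>integral {0..real k / real m} ?g - birkhoff_sum (\<phi> (1 / real m)) f k x / real m\<bar>
      \<le> e * (real k / real m)"
    proof (induction k)
      case 0
      then show ?case by (simp add: birkhoff_sum_def)
    next
      case (Suc k)
      let ?a = "real k / real m" and ?b = "real (Suc k) / real m"
      have ab: "?a \<le> ?b" "?b - ?a = 1 / real m" "0 \<le> ?a"
        using m(3) by (auto simp: field_simps)
      have split: "integral {0..?b} ?g = integral {0..?a} ?g + integral {?a..?b} ?g"
        using ab by (intro Henstock_Kurzweil_Integration.integral_combine[symmetric] observable_integrable[OF f]) auto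
      have "norm (integral {?a..?b} (\<lambda>t. ?g t - f (\<phi> ?a x))) \<le> e * (?b - ?a)"
      proof (rule integral_bound[OF ab(1)])
        show "continuous_on {?a..?b} (\<lambda>t. ?g t - f (\<phi> ?a x))"
          by (intro continuous_intros continuous_observable_flow[OF f])
        fix t assume "t \<in> {?a..?b}"
        then have "\<bar>f (\<phi> (t - ?a) (\<phi> ?a x)) - f (\<phi> ?a x)\<bar> < e"
          using ab(2) m(2) by (intro d(2)) auto
        then show "norm (?g t - f (\<phi> ?a x)) \<le> e"
          using flow_add[of "t - ?a" ?a x] by simp
      qed
      moreover have "integral {?a..?b} (\<lambda>t. ?g t - f (\<phi> ?a x)) = integral {?a..?b} ?g - f (\<phi> ?a x) / real m"
        using ab by (subst Henstock_Kurzweil_Integration.integral_diff) (auto intro: observable_integrable[OF f])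
      ultimately have "\<bar>integral {?a..?b} ?g - f (\<phi> ?a x) / real m\<bar> \<le> e / real m"
        using ab(2) by simp
      moreover have "birkhoff_sum (\<phi> (1 / real m)) f (Suc k) x / real m
          = birkhoff_sum (\<phi> (1 / real m)) f k x / real m + f (\<phi> ?a x) / real m"
        by (simp add: birkhoff_sum_def funpow_flow add_divide_distrib)
      moreover have "e * ?b = e * ?a + e / real m"
        by (simp add: add_divide_distrib algebra_simps)
      ultimately show ?case
        using Suc.IH split by linarith
    qed
  qed
qed

definition time_average :: "real \<Rightarrow> ('a \<Rightarrow> real) \<Rightarrow> 'a \<Rightarrow> real" where
  "time_average T f x = (1 / T) * integral {0..T} (\<lambda>t. f (\<phi> t x))"

lemma orbit_integral_bound:
  fixes f :: "'a \<Rightarrow> real"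
  assumes f: "continuous_on UNIV f" and B: "\<And>x. \<bar>f x\<bar> \<le> B" and "a \<le> b"
  shows "\<bar>integral {a..b} (\<lambda>t. f (\<phi> t x))\<bar> \<le> B * (b - a)"
proof -
  have "norm (integral {a..b} (\<lambda>t. f (\<phi> t x))) \<le> B * (b - a)"
    using B by (intro integral_bound \<open>a \<le> b\<close> continuous_observable_flow[OF f] continuous_intros) auto
  then show ?thesis by simp
qed

lemma time_average_close:
  assumes f: "continuous_on UNIV f" and g: "continuous_on UNIV g"
    and close: "\<And>x. \<bar>f x - g x\<bar> \<le> e" and "0 < T"
  shows "\<bar>time_average T f x - time_average T g x\<bar> \<le> e"
proof -
  have "time_average T f x - time_average T g x = (1 / T) * integral {0..T} (\<lambda>t. f (\<phi> t x) - g (\<phi> t x))"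
    unfolding time_average_def
    by (subst Henstock_Kurzweil_Integration.integral_diff) (auto intro: observable_integrable[OF f] observable_integrable[OF g] simp: algebra_simps)
  moreover have "\<bar>integral {0..T} (\<lambda>t. f (\<phi> t x) - g (\<phi> t x))\<bar> \<le> e * T"
    using orbit_integral_bound[of "\<lambda>x. f x - g x" e 0 T x] f g close \<open>0 < T\<close>
    by (auto intro!: continuous_intros)
  ultimately have "\<bar>time_average T f x - time_average T g x\<bar> \<le> (1 / T) * (e * T)"
    using \<open>0 < T\<close> by (simp only: abs_mult) (intro mult_mono, auto)
  then show ?thesis
    using \<open>0 < T\<close> by simp
qed

lemma continuous_time_average:
  assumes "continuous_on UNIV f"
  shows "continuous_on UNIV (time_average T f)"
proof -
  have "continuous_on UNIV (\<lambda>x. integral (cbox 0 T) (\<lambda>t. f (\<phi> t x)))"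
    by (intro integral_continuous_on_param, unfold case_prod_beta, intro continuous_observable_flow[OF assms] continuous_intros)
  then show ?thesis
    unfolding time_average_def[abs_def] by (intro continuous_intros) simp
qed

text \<open>The two integrals range over \<open>[s, r + s]\<close> and \<open>[0, r]\<close>, which differ by two intervals of length \<open>s\<close>.\<close>
lemma orbit_integral_shift:
  fixes f :: "'a \<Rightarrow> real"
  assumes f: "continuous_on UNIV f" and B: "\<And>x. \<bar>f x\<bar> \<le> B" and "0 \<le> s" "0 \<le> r"
  shows "\<bar>integral {0..r} (\<lambda>t. f (\<phi> t (\<phi> s x))) - integral {0..r} (\<lambda>t. f (\<phi> t x))\<bar> \<le> 2 * B * s"
proof -
  let ?g = "\<lambda>t. f (\<phi> t x)"
  have "integral {0..r} (\<lambda>t. f (\<phi> t (\<phi> s x))) = integral {s - s..(r + s) - s} (\<lambda>t. ?g (t + s))"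
    by (simp add: flow_add)
  also have "\<dots> = integral {s..r + s} ?g"
    by (rule integral_shift_real_ivl)
  finally have shift: "integral {0..r} (\<lambda>t. f (\<phi> t (\<phi> s x))) = integral {s..r + s} ?g" .
  have "integral {0..s} ?g + integral {s..r + s} ?g = integral {0..r + s} ?g"
    using assms by (intro Henstock_Kurzweil_Integration.integral_combine observable_integrable[OF f]) auto
  moreover have "integral {0..r} ?g + integral {r..r + s} ?g = integral {0..r + s} ?g"
    using assms by (intro Henstock_Kurzweil_Integration.integral_combine observable_integrable[OF f]) auto
  moreover have "\<bar>integral {0..s} ?g\<bar> \<le> B * s" "\<bar>integral {r..r + s} ?g\<bar> \<le> B * s"
    using orbit_integral_bound[OF f B, of 0 s x] orbit_integral_bound[OF f B, of r "r + s" x] \<open>0 \<le> s\<close> by auto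
  ultimately show ?thesis
    using shift by linarith
qed

lemma limsup_time_average_invariant:
  fixes f :: "'a \<Rightarrow> real"
  assumes f: "continuous_on UNIV f"
  shows "limsup (\<lambda>n. ereal (time_average (real n) f (\<phi> s x))) = limsup (\<lambda>n. ereal (time_average (real n) f x))"
proof -
  obtain B where B: "0 < B" "\<And>x. \<bar>f x\<bar> \<le> B"
    using continuous_bounded[OF f] by blast
  have pos: "limsup (\<lambda>n. ereal (time_average (real n) f (\<phi> s x))) = limsup (\<lambda>n. ereal (time_average (real n) f x))"
    if "0 \<le> s" for s x
  proof -
    let ?d = "\<lambda>n. time_average (real n) f (\<phi> s x) - time_average (real n) f x"
    have "\<bar>?d n\<bar> \<le> 2 * B * s * (1 / real n)" for n
    proof -
      have "?d n = (1 / real n) * (integral {0..real n} (\<lambda>t. f (\<phi> t (\<phi> s x))) - integral {0..real n} (\<lambda>t. f (\<phi> t x)))"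
        by (simp add: time_average_def algebra_simps)
      then have "\<bar>?d n\<bar> = (1 / real n) * \<bar>integral {0..real n} (\<lambda>t. f (\<phi> t (\<phi> s x))) - integral {0..real n} (\<lambda>t. f (\<phi> t x))\<bar>"
        by (simp add: abs_mult)
      also have "\<dots> \<le> (1 / real n) * (2 * B * s)"
        using orbit_integral_shift[OF f B(2) that, of "real n" x] by (intro mult_left_mono) auto
      finally show ?thesis by simp
    qed
    moreover have "(\<lambda>n. 2 * B * s * (1 / real n)) \<longlonglongrightarrow> 2 * B * s * 0"
      by (intro tendsto_mult tendsto_const lim_1_over_n)
    ultimately have "?d \<longlonglongrightarrow> 0"
      by (intro Lim_null_comparison[of ?d]) auto
    then have "(\<lambda>n. ereal (?d n)) \<longlonglongrightarrow> ereal 0" by simp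
    then have "limsup (\<lambda>n. ereal (?d n) + ereal (time_average (real n) f x))
        = ereal 0 + limsup (\<lambda>n. ereal (time_average (real n) f x))"
      by (intro ereal_limsup_lim_add) auto
    then show ?thesis by simp
  qed
  show ?thesis
  proof (cases "0 \<le> s")
    case False
    have "x = \<phi> (- s) (\<phi> s x)"
      using flow_add[of "- s" s x] by simp
    then show ?thesis
      using pos[of "- s" "\<phi> s x"] False by simp
  qed (rule pos)
qed

text \<open>Between consecutive integers the integral moves by a bounded amount.\<close>
lemma time_average_tendsto_from_nat:
  fixes f :: "'a \<Rightarrow> real"
  assumes f: "continuous_on UNIV f" and lim: "(\<lambda>n. time_average (real n) f x) \<longlonglongrightarrow> c"
  shows "((\<lambda>T. time_average T f x) \<longlongrightarrow> c) at_top"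
proof -
  obtain B where B: "0 < B" "\<And>x. \<bar>f x\<bar> \<le> B"
    using continuous_bounded[OF f] by blast
  let ?I = "\<lambda>T. integral {0..T} (\<lambda>t. f (\<phi> t x))"
  have "\<bar>time_average T f x - time_average (of_int \<lfloor>T\<rfloor>) f x\<bar> \<le> 2 * B / T" if "1 \<le> T" for T :: real
  proof -
    define n where "n = real_of_int \<lfloor>T\<rfloor>"
    have n: "1 \<le> n" "n \<le> T" "T < n + 1"
      using that of_int_floor_le[of T] floor_correct[of T] unfolding n_def by (auto simp: le_floor_iff)
    have "?I n + integral {n..T} (\<lambda>t. f (\<phi> t x)) = ?I T"
      using n by (intro Henstock_Kurzweil_Integration.integral_combine observable_integrable[OF f]) auto
    moreover have "\<bar>integral {n..T} (\<lambda>t. f (\<phi> t x))\<bar> \<le> B * (T - n)"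
      using n by (intro orbit_integral_bound f B)
    moreover have "B * (T - n) \<le> B * 1"
      using n B by (intro mult_left_mono) auto
    ultimately have 1: "\<bar>?I T - ?I n\<bar> \<le> B" by linarith
    have "\<bar>?I n\<bar> \<le> B * (n - 0)"
      using n by (intro orbit_integral_bound f B) auto
    then have "\<bar>?I n / n\<bar> \<le> B"
      using n by (simp add: abs_divide field_simps)
    then have "\<bar>?I n / n\<bar> * (T - n) \<le> B * 1"
      using n B(1) by (intro mult_mono) auto
    then have 2: "\<bar>(?I n / n) * (T - n)\<bar> \<le> B"
      using n by (simp add: abs_mult)
    have "time_average T f x - time_average n f x = (?I T - ?I n - (?I n / n) * (T - n)) / T"
      using n by (simp add: time_average_def field_simps)
    then have "\<bar>time_average T f x - time_average n f x\<bar> = \<bar>?I T - ?I n - (?I n / n) * (T - n)\<bar> / T"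
      using n by (simp add: abs_divide)
    also have "\<dots> \<le> 2 * B / T"
    proof (rule divide_right_mono)
      show "\<bar>?I T - ?I n - (?I n / n) * (T - n)\<bar> \<le> 2 * B"
        using abs_triangle_ineq4[of "?I T - ?I n" "(?I n / n) * (T - n)"] 1 2
        by (intro order_trans[OF abs_triangle_ineq4]) simp
    qed (use n in simp)
    finally show ?thesis by (simp add: n_def)
  qed
  then have "\<forall>\<^sub>F T in at_top. norm (time_average T f x - time_average (of_int \<lfloor>T\<rfloor>) f x) \<le> 2 * B / T"
    by (intro eventually_at_top_linorderI[of 1]) auto
  moreover have "((\<lambda>T::real. 2 * B / T) \<longlongrightarrow> 0) at_top"
    by (intro tendsto_divide_0[OF tendsto_const] filterlim_at_top_imp_at_infinity filterlim_ident)
  ultimately have diff: "((\<lambda>T. time_average T f x - time_average (of_int \<lfloor>T\<rfloor>) f x) \<longlongrightarrow> 0) at_top"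
    by (rule Lim_null_comparison)
  have "filterlim (\<lambda>T::real. nat \<lfloor>T\<rfloor>) sequentially at_top"
    by (intro filterlim_compose[OF filterlim_nat_sequentially] filterlim_floor_sequentially)
  then have "((\<lambda>T::real. time_average (real (nat \<lfloor>T\<rfloor>)) f x) \<longlongrightarrow> c) at_top"
    by (rule filterlim_compose[OF lim])
  moreover have "\<forall>\<^sub>F T::real in at_top. time_average (real (nat \<lfloor>T\<rfloor>)) f x = time_average (of_int \<lfloor>T\<rfloor>) f x"
    by (intro eventually_at_top_linorderI[of 0]) simp
  ultimately have "((\<lambda>T::real. time_average (of_int \<lfloor>T\<rfloor>) f x) \<longlongrightarrow> c) at_top"
    by (rule Lim_transform_eventually)
  from tendsto_add[OF diff this] show ?thesis by simp
qed

end

section \<open>Almost every point is generic\<close>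

locale invariant_flow = compact_flow \<phi> for \<phi> :: "real \<Rightarrow> 'a::metric_space \<Rightarrow> 'a" +
  fixes M :: "'a measure"
  assumes borel_prob: "borel_probability M" and invariant: "flow_invariant \<phi> M"
begin

lemma sets_M [measurable_cong, simp]: "sets M = sets borel"
  using borel_prob by (simp add: borel_probability_def)

lemma space_M [simp]: "space M = UNIV"
  using sets_eq_imp_space_eq[OF sets_M] by simp

sublocale prob_space M
  using borel_prob by (simp add: borel_probability_def)

lemma continuous_measurable [measurable_dest]:
  fixes f :: "'a \<Rightarrow> 'b::topological_space"
  shows "continuous_on UNIV f \<Longrightarrow> f \<in> borel_measurable M"
  using borel_measurable_continuous_onI[of f] by (simp cong: measurable_cong_sets)

lemma time_map_preserving: "measure_preserving_map M (\<phi> s)"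
proof
  have "continuous_on UNIV (\<phi> s)"
    by (intro continuous_intros)
  then have "\<phi> s \<in> measurable M borel"
    by (rule continuous_measurable)
  then show meas: "\<phi> s \<in> measurable M M"
    by (simp cong: measurable_cong_sets)
  show "distr M M (\<phi> s) = M"
  proof (rule measure_eqI)
    fix A assume "A \<in> sets (distr M M (\<phi> s))"
    then have "A \<in> sets M" by simp
    then show "emeasure (distr M M (\<phi> s)) A = emeasure M A"
      using invariant unfolding flow_invariant_def by (simp only: emeasure_distr[OF meas])
  qed simp
qed simp

lemma continuous_integrable:
  fixes f :: "'a \<Rightarrow> real"
  assumes "continuous_on UNIV f"
  shows "integrable M f"
proof -
  obtain B where "\<And>x. \<bar>f x\<bar> \<le> B"
    using continuous_bounded[OF assms] by blast
  then show ?thesis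
    using continuous_measurable[OF assms] by (intro integrable_const_bound[of _ B]) auto
qed

text \<open>The set where the upper average exceeds \<open>c\<close> is invariant. If it had full measure, almost every orbit
  would have a long initial segment with average above \<open>c\<close>. This persists, with a slightly
  smaller constant \<open>c - e\<close>, for the iterates of \<open>\<phi> (1 / m)\<close> and contradicts the choice of \<open>c\<close>.\<close>
lemma AE_limsup_time_average_le:
  fixes f :: "'a \<Rightarrow> real"
  assumes erg: "flow_ergodic \<phi> M" and f: "continuous_on UNIV f" and c: "(\<integral>x. f x \<partial>M) < c"
  shows "AE x in M. limsup (\<lambda>n. ereal (time_average (real n) f x)) \<le> ereal c"
proof -
  define A where "A = {x\<in>space M. ereal c < limsup (\<lambda>n. ereal (time_average (real n) f x))}"
  have [measurable]: "time_average (real n) f \<in> borel_measurable M" for n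
    by (intro continuous_measurable continuous_time_average f)
  have A [measurable]: "A \<in> sets M"
    unfolding A_def by measurable
  have "\<phi> t -` A \<inter> space M = A" for t
    by (auto simp: A_def limsup_time_average_invariant[OF f])
  then consider "prob A = 0" | "prob A = 1"
    using erg A unfolding flow_ergodic_def by blast
  then show ?thesis
  proof cases
    case 1
    then have "AE x in M. x \<notin> A"
      using A by (intro AE_not_in) (simp add: null_sets_def emeasure_eq_measure)
    then show ?thesis
      by eventually_elim (auto simp: A_def not_less)
  next
    case 2
    define e where "e = (c - (\<integral>x. f x \<partial>M)) / 2"
    have e: "0 < e" "(\<integral>x. f x \<partial>M) < c - e"
      using c by (auto simp: e_def field_simps)
    obtain m :: nat where m: "1 \<le> m"
      "\<And>k x. \<bar>integral {0..real k / real m} (\<lambda>t. f (\<phi> t x)) - birkhoff_sum (\<phi> (1 / real m)) f k x / real m\<bar>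
        \<le> e * (real k / real m)"
      using riemann_sum_approximation[OF f e(1)] by blast
    obtain B where B: "\<And>x. \<bar>f x\<bar> \<le> B"
      using continuous_bounded[OF f] by blast
    interpret mpm: measure_preserving_map M "\<phi> (1 / real m)"
      by (rule time_map_preserving)
    have "AE x in M. x \<in> A"
      using 2 A by (simp add: prob_eq_1)
    then have "AE x in M. \<exists>n\<ge>1. real n * (c - e) \<le> birkhoff_sum (\<phi> (1 / real m)) f n x"
    proof eventually_elim
      case (elim x)
      have "\<exists>\<^sub>F n in sequentially. ereal c < ereal (time_average (real n) f x)"
      proof (rule ccontr)
        assume "\<not> ?thesis"
        then have "\<forall>\<^sub>F n in sequentially. ereal (time_average (real n) f x) \<le> ereal c"
          by (simp add: frequently_def not_less)
        then have "limsup (\<lambda>n. ereal (time_average (real n) f x)) \<le> ereal c"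
          by (rule Limsup_bounded)
        with elim show False by (simp add: A_def)
      qed
      from frequently_eventually_conj[OF this eventually_ge_at_top[of 1]]
      obtain n :: nat where n: "c < time_average (real n) f x" "1 \<le> n"
        by (auto dest: frequently_ex)
      then have "real n * c \<le> integral {0..real n} (\<lambda>t. f (\<phi> t x))"
        by (simp add: time_average_def field_simps)
      moreover have "real (n * m) / real m = real n"
        using m(1) by simp
      ultimately have "real n * c - e * real n \<le> birkhoff_sum (\<phi> (1 / real m)) f (n * m) x / real m"
        using m(2)[of "n * m" x] by (simp only: mult.commute[of c])
      then have "(real n * c - e * real n) * real m \<le> birkhoff_sum (\<phi> (1 / real m)) f (n * m) x"
        using m(1) by (simp add: field_simps)
      then have "real (n * m) * (c - e) \<le> birkhoff_sum (\<phi> (1 / real m)) f (n * m) x"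
        by (simp add: algebra_simps)
      then show ?case
        using n m(1) by (intro exI[of _ "n * m"]) (auto simp: Suc_le_eq)
    qed
    then have "c - e \<le> (\<integral>x. f x \<partial>M)"
      by (intro mpm.integral_ge_of_averages_ge[OF _ B] continuous_measurable f)
    with e(2) show ?thesis by simp
  qed
qed

lemma AE_limsup_time_average_le_integral:
  fixes f :: "'a \<Rightarrow> real"
  assumes "flow_ergodic \<phi> M" "continuous_on UNIV f"
  shows "AE x in M. \<forall>e>0. \<forall>\<^sub>F n in sequentially. time_average (real n) f x < (\<integral>x. f x \<partial>M) + e"
proof -
  have "AE x in M. \<forall>k. limsup (\<lambda>n. ereal (time_average (real n) f x)) \<le> ereal ((\<integral>x. f x \<partial>M) + 1 / real (Suc k))"
    unfolding AE_all_countable by (intro allI AE_limsup_time_average_le assms) simp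
  then show ?thesis
  proof eventually_elim
    case (elim x)
    show ?case
    proof (intro allI impI)
      fix e :: real assume "0 < e"
      then obtain k where "1 / real (Suc k) < e"
        using nat_approx_posE by blast
      then have "limsup (\<lambda>n. ereal (time_average (real n) f x)) < ereal ((\<integral>x. f x \<partial>M) + e)"
        by (intro le_less_trans[OF elim[rule_format, of k]]) simp
      then show "\<forall>\<^sub>F n in sequentially. time_average (real n) f x < (\<integral>x. f x \<partial>M) + e"
        by (auto dest: Limsup_lessD)
    qed
  qed
qed

lemma AE_time_average_tendsto:
  fixes f :: "'a \<Rightarrow> real"
  assumes erg: "flow_ergodic \<phi> M" and f: "continuous_on UNIV f"
  shows "AE x in M. ((\<lambda>T. time_average T f x) \<longlongrightarrow> (\<integral>x. f x \<partial>M)) at_top"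
proof -
  have neg: "time_average T (\<lambda>x. - f x) x = - time_average T f x" for T x
    by (simp add: time_average_def)
  have f': "continuous_on UNIV (\<lambda>x. - f x)"
    using f by (intro continuous_intros)
  show ?thesis
    using AE_limsup_time_average_le_integral[OF erg f] AE_limsup_time_average_le_integral[OF erg f']
  proof eventually_elim
    case (elim x)
    have "(\<lambda>n. time_average (real n) f x) \<longlonglongrightarrow> (\<integral>x. f x \<partial>M)"
    proof (rule order_tendstoI)
      fix a assume "a < (\<integral>x. f x \<partial>M)"
      then show "\<forall>\<^sub>F n in sequentially. a < time_average (real n) f x"
        using elim(2)[rule_format, of "(\<integral>x. f x \<partial>M) - a"]
        by (auto simp: neg elim!: eventually_mono)
    next
      fix a assume "(\<integral>x. f x \<partial>M) < a"
      then show "\<forall>\<^sub>F n in sequentially. time_average (real n) f x < a"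
        using elim(1)[rule_format, of "a - (\<integral>x. f x \<partial>M)"]
        by (auto elim!: eventually_mono)
    qed
    then show ?case by (rule time_average_tendsto_from_nat[OF f])
  qed
qed

end

context compact_flow
begin

text \<open>For a countable sequence of radii \<open>r\<close>, these functions span a dense set of continuous functions,
  with the values of a function as its coefficients; see \<open>partition_of_unity_approximation\<close>.\<close>
lemma fine_partition_of_unity:
  assumes "0 < r"
  obtains C and \<rho> :: "'a \<Rightarrow> 'a \<Rightarrow> real" where "finite C"
    "\<And>c. c \<in> C \<Longrightarrow> continuous_on UNIV (\<rho> c)" "\<And>c x. c \<in> C \<Longrightarrow> 0 \<le> \<rho> c x"
    "\<And>x. (\<Sum>c\<in>C. \<rho> c x) = 1" "\<And>c x. c \<in> C \<Longrightarrow> \<rho> c x \<noteq> 0 \<Longrightarrow> dist c x < r"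
proof -
  obtain C where C: "finite C" "(UNIV :: 'a set) \<subseteq> (\<Union>c\<in>C. ball c r)"
    using compactE_image[OF compact_UNIV, of UNIV "\<lambda>c. ball c r"] \<open>0 < r\<close> by (metis centre_in_ball open_ball UN_I subsetI)
  define b where "b c x = max 0 (r - dist c x)" for c x :: 'a
  have b: "0 \<le> b c x" "b c x \<noteq> 0 \<longleftrightarrow> dist c x < r" for c x
    by (auto simp: b_def)
  have pos: "0 < (\<Sum>c\<in>C. b c x)" for x
  proof -
    obtain c where "c \<in> C" "dist c x < r"
      using C(2) by force
    then show ?thesis
      using C(1) b by (intro sum_pos2[of _ c]) (auto simp: less_le)
  qed
  have b_cont: "continuous_on UNIV (b c)" for c
    unfolding b_def[abs_def] by (intro continuous_intros)
  show ?thesis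
  proof (rule that[of C "\<lambda>c x. b c x / (\<Sum>c\<in>C. b c x)"])
    show "continuous_on UNIV (\<lambda>x. b c x / (\<Sum>c\<in>C. b c x))" if "c \<in> C" for c
      using pos by (intro continuous_intros b_cont) (auto simp: less_imp_neq[symmetric])
    show "(\<Sum>c\<in>C. b c x / (\<Sum>c\<in>C. b c x)) = 1" for x
      using pos[of x] by (simp add: sum_divide_distrib[symmetric])
  qed (use C(1) b pos in \<open>auto simp: less_imp_le\<close>)
qed

lemma partition_of_unity_approximation:
  fixes f :: "'a \<Rightarrow> real"
  assumes \<rho>: "\<And>c x. c \<in> C \<Longrightarrow> 0 \<le> \<rho> c x" "(\<Sum>c\<in>C. \<rho> c x) = 1"
    "\<And>c x. c \<in> C \<Longrightarrow> \<rho> c x \<noteq> 0 \<Longrightarrow> dist c x < r"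
    and f: "\<And>x y. dist x y < r \<Longrightarrow> \<bar>f x - f y\<bar> \<le> e"
  shows "\<bar>f x - (\<Sum>c\<in>C. f c * \<rho> c x)\<bar> \<le> e"
proof -
  have "f x - (\<Sum>c\<in>C. f c * \<rho> c x) = (\<Sum>c\<in>C. f x * \<rho> c x) - (\<Sum>c\<in>C. f c * \<rho> c x)"
    by (simp add: sum_distrib_left[symmetric] \<rho>(2))
  also have "\<dots> = (\<Sum>c\<in>C. (f x - f c) * \<rho> c x)"
    by (simp add: sum_subtractf left_diff_distrib)
  also have "\<bar>\<dots>\<bar> \<le> (\<Sum>c\<in>C. \<bar>(f x - f c) * \<rho> c x\<bar>)"
    by (rule sum_abs)
  also have "\<dots> \<le> (\<Sum>c\<in>C. e * \<rho> c x)"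
  proof (intro sum_mono)
    fix c assume "c \<in> C"
    show "\<bar>(f x - f c) * \<rho> c x\<bar> \<le> e * \<rho> c x"
    proof (cases "\<rho> c x = 0")
      case False
      then show ?thesis
        using \<rho>(1)[OF \<open>c \<in> C\<close>, of x] \<rho>(3)[OF \<open>c \<in> C\<close> False] f[of c x]
        by (auto simp: abs_mult abs_minus_commute intro!: mult_right_mono)
    qed simp
  qed
  also have "\<dots> = e"
    by (simp add: sum_distrib_left[symmetric] \<rho>(2))
  finally show ?thesis .
qed

end

text \<open>Convergence for the countably many functions of partitions of unity passes to their finite linear
  combinations, and by uniform approximation to all continuous functions.\<close>
lemma (in invariant_flow) AE_generic:
  assumes erg: "flow_ergodic \<phi> M"
  shows "AE x in M. x \<in> generic_points \<phi> M"
proof -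
  define unity_at where "unity_at k C \<rho> \<longleftrightarrow> finite C \<and> (\<forall>c\<in>C. continuous_on UNIV (\<rho> c)) \<and> (\<forall>c\<in>C. \<forall>x. 0 \<le> \<rho> c x)
      \<and> (\<forall>x. (\<Sum>c\<in>C. \<rho> c x) = 1) \<and> (\<forall>c\<in>C. \<forall>x. \<rho> c x \<noteq> 0 \<longrightarrow> dist c x < 1 / real (Suc k))"
    for k :: nat and C :: "'a set" and \<rho> :: "'a \<Rightarrow> 'a \<Rightarrow> real"
  have "\<exists>C \<rho>. unity_at k C \<rho>" for k
  proof -
    have "0 < 1 / real (Suc k)" by simp
    then show ?thesis
    proof (rule fine_partition_of_unity)
      fix C :: "'a set" and \<rho> :: "'a \<Rightarrow> 'a \<Rightarrow> real"
      assume "finite C"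
        "\<And>c. c \<in> C \<Longrightarrow> continuous_on UNIV (\<rho> c)" "\<And>c x. c \<in> C \<Longrightarrow> 0 \<le> \<rho> c x"
        "\<And>x. (\<Sum>c\<in>C. \<rho> c x) = 1" "\<And>c x. c \<in> C \<Longrightarrow> \<rho> c x \<noteq> 0 \<Longrightarrow> dist c x < 1 / real (Suc k)"
      then have "unity_at k C \<rho>" by (simp add: unity_at_def)
      then show "\<exists>C \<rho>. unity_at k C \<rho>" by blast
    qed
  qed
  then obtain C \<rho> where "\<And>k. unity_at k (C k) (\<rho> k)"
    by metis
  then have fin: "\<And>k. finite (C k)"
    and cont: "\<And>k c. c \<in> C k \<Longrightarrow> continuous_on UNIV (\<rho> k c)"
    and unity: "\<And>k c x. c \<in> C k \<Longrightarrow> 0 \<le> \<rho> k c x" "\<And>k x. (\<Sum>c\<in>C k. \<rho> k c x) = 1"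
      "\<And>k c x. c \<in> C k \<Longrightarrow> \<rho> k c x \<noteq> 0 \<Longrightarrow> dist c x < 1 / real (Suc k)"
    by (simp_all add: unity_at_def)
  have "AE x in M. \<forall>k. \<forall>c\<in>C k. ((\<lambda>T. time_average T (\<rho> k c) x) \<longlongrightarrow> (\<integral>x. \<rho> k c x \<partial>M)) at_top"
    unfolding AE_all_countable using fin
    by (intro allI AE_finite_allI AE_time_average_tendsto[OF erg] cont) auto
  then show ?thesis
  proof eventually_elim
    case (elim x)
    have "((\<lambda>T. time_average T f x) \<longlongrightarrow> (\<integral>y. f y \<partial>M)) at_top" if f: "continuous_on UNIV f" for f :: "'a \<Rightarrow> real"
    proof (rule tendstoI)
      fix e :: real assume "0 < e"
      have "uniformly_continuous_on UNIV f"
        by (rule compact_uniformly_continuous[OF f compact_UNIV])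
      then obtain d where "0 < d" and d: "\<And>x y. dist x y < d \<Longrightarrow> dist (f x) (f y) < e / 3"
        using \<open>0 < e\<close> unfolding uniformly_continuous_on_def by (auto dest!: spec[of _ "e / 3"])
      obtain k where k: "1 / real (Suc k) < d"
        using nat_approx_posE \<open>0 < d\<close> by blast
      define g where "g y = (\<Sum>c\<in>C k. f c * \<rho> k c y)" for y
      have g: "continuous_on UNIV g"
        unfolding g_def[abs_def] by (intro continuous_intros cont)
      have close: "\<bar>f y - g y\<bar> \<le> e / 3" for y
        unfolding g_def using d k
        by (intro partition_of_unity_approximation[of "C k" "\<rho> k" _ "1 / real (Suc k)"] unity)
          (auto simp: dist_real_def intro: less_imp_le)
      have integrals: "\<bar>(\<integral>y. f y \<partial>M) - (\<integral>y. g y \<partial>M)\<bar> \<le> e / 3"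
      proof -
        have int: "integrable M f" "integrable M g"
          using f g by (auto intro: continuous_integrable)
        have "\<bar>\<integral>y. f y - g y \<partial>M\<bar> \<le> (\<integral>y. \<bar>f y - g y\<bar> \<partial>M)"
          by (rule integral_abs_bound)
        also have "\<dots> \<le> (\<integral>y. e / 3 \<partial>M)"
          using int close by (intro integral_mono) auto
        finally show ?thesis
          using int prob_space by simp
      qed
      have "time_average T g x = (\<Sum>c\<in>C k. f c * time_average T (\<rho> k c) x)" for T
      proof -
        have "integral {0..T} (\<lambda>t. g (\<phi> t x)) = (\<Sum>c\<in>C k. integral {0..T} (\<lambda>t. f c * \<rho> k c (\<phi> t x)))"
          unfolding g_def using fin
          by (intro Henstock_Kurzweil_Integration.integral_sum observable_integrable[of "\<lambda>y. f _ * \<rho> k _ y"])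
            (auto intro!: continuous_intros cont)
        then show ?thesis
          by (simp add: time_average_def sum_distrib_left algebra_simps)
      qed
      then have "((\<lambda>T. time_average T g x) \<longlongrightarrow> (\<Sum>c\<in>C k. f c * (\<integral>y. \<rho> k c y \<partial>M))) at_top"
        using elim by (auto intro!: tendsto_sum tendsto_mult)
      also have "(\<Sum>c\<in>C k. f c * (\<integral>y. \<rho> k c y \<partial>M)) = (\<integral>y. g y \<partial>M)"
        unfolding g_def using cont by (subst Bochner_Integration.integral_sum) (auto intro!: continuous_integrable)
      finally have "\<forall>\<^sub>F T in at_top. dist (time_average T g x) (\<integral>y. g y \<partial>M) < e / 3"
        using \<open>0 < e\<close> by (intro tendstoD) auto
      moreover have "\<forall>\<^sub>F T::real in at_top. 0 < T"
        by (rule eventually_gt_at_top)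
      ultimately show "\<forall>\<^sub>F T in at_top. dist (time_average T f x) (\<integral>y. f y \<partial>M) < e"
      proof eventually_elim
        case (elim T)
        have "\<bar>time_average T f x - time_average T g x\<bar> \<le> e / 3"
          by (intro time_average_close f g close elim)
        with elim integrals show ?case
          unfolding dist_real_def by linarith
      qed
    qed
    then show ?case
      by (auto simp: generic_points_def time_average_def)
  qed
qed

section \<open>Sets of vanishing Gamma measure\<close>

text \<open>The quantity whose limit for \<open>\<epsilon> \<rightarrow> 0\<close> is \<open>Gamma_measure\<close>.\<close>
definition cover_cost :: "(real \<Rightarrow> 'a \<Rightarrow> 'a) \<Rightarrow> 'a set set \<Rightarrow> real \<Rightarrow> real \<Rightarrow> 'a set \<Rightarrow> ennreal" where
  "cover_cost \<phi> \<U> \<alpha> \<epsilon> Y =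
     (INF E\<in>{E. Y \<subseteq> (\<Union>i. E i) \<and> (\<forall>i. D_size \<phi> \<U> (E i) < \<epsilon>)}. S_sum \<phi> \<U> \<alpha> E)"

lemma cover_cost_antimono: "\<epsilon> \<le> \<epsilon>' \<Longrightarrow> cover_cost \<phi> \<U> \<alpha> \<epsilon>' Y \<le> cover_cost \<phi> \<U> \<alpha> \<epsilon> Y"
  unfolding cover_cost_def by (intro INF_superset_mono) (auto intro: less_le_trans)

text \<open>The cost grows as \<open>\<epsilon>\<close> decreases, so its limit at zero is its supremum. In particular the measure
  vanishes exactly when the cost vanishes for each \<open>\<epsilon>\<close>.\<close>
lemma Gamma_measure_eq_SUP: "Gamma_measure \<phi> \<U> \<alpha> Y = (SUP \<epsilon>\<in>{0<..}. cover_cost \<phi> \<U> \<alpha> \<epsilon> Y)"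
proof -
  let ?g = "\<lambda>\<epsilon>. cover_cost \<phi> \<U> \<alpha> \<epsilon> Y"
  have "(?g \<longlongrightarrow> (SUP \<epsilon>\<in>{0<..}. ?g \<epsilon>)) (at_right 0)"
  proof (rule order_tendstoI)
    fix a assume "a < (SUP \<epsilon>\<in>{0<..}. ?g \<epsilon>)"
    then obtain d where d: "0 < d" "a < ?g d"
      by (auto simp: less_SUP_iff)
    have "\<forall>\<^sub>F \<epsilon> in at_right 0. \<epsilon> < d"
      using d(1) by (intro order_tendstoD(2)[OF tendsto_ident_at])
    then show "\<forall>\<^sub>F \<epsilon> in at_right 0. a < ?g \<epsilon>"
      by eventually_elim (intro less_le_trans[OF d(2) cover_cost_antimono] less_imp_le)
  next
    fix a assume a: "(SUP \<epsilon>\<in>{0<..}. ?g \<epsilon>) < a"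
    have "\<forall>\<^sub>F \<epsilon>::real in at_right 0. 0 < \<epsilon>"
      by (rule eventually_at_right_less)
    then show "\<forall>\<^sub>F \<epsilon> in at_right 0. ?g \<epsilon> < a"
      by eventually_elim (intro le_less_trans[OF SUP_upper a], auto)
  qed
  then show ?thesis
    unfolding Gamma_measure_def cover_cost_def[symmetric] by (intro tendsto_Lim) auto
qed

lemma Gamma_measure_eq_0_iff:
  "Gamma_measure \<phi> \<U> \<alpha> Y = 0 \<longleftrightarrow> (\<forall>\<epsilon>>0. cover_cost \<phi> \<U> \<alpha> \<epsilon> Y = 0)"
  unfolding Gamma_measure_eq_SUP le_zero_eq[symmetric] SUP_le_iff by (simp add: Ball_def)

lemma cover_cost_lessD:
  assumes "cover_cost \<phi> \<U> \<alpha> \<epsilon> Y < c"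
  obtains E where "Y \<subseteq> (\<Union>i. E i)" "\<And>i. D_size \<phi> \<U> (E i) < \<epsilon>" "S_sum \<phi> \<U> \<alpha> E < c"
  using assms unfolding cover_cost_def by (auto simp: INF_less_iff)

lemma cover_cost_le:
  assumes "Y \<subseteq> (\<Union>i. E i)" "\<And>i. D_size \<phi> \<U> (E i) < \<epsilon>"
  shows "cover_cost \<phi> \<U> \<alpha> \<epsilon> Y \<le> S_sum \<phi> \<U> \<alpha> E"
  unfolding cover_cost_def using assms by (intro INF_lower) auto

lemma ennreal_eq_0I:
  fixes x :: ennreal
  assumes "\<And>c::real. 0 < c \<Longrightarrow> x \<le> ennreal c"
  shows "x = 0"
proof -
  have "x \<le> 0"
    by (rule ennreal_le_epsilon) (use assms in auto)
  then show ?thesis by simp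
qed

lemma Gamma_measure_null_subset:
  assumes "Y \<subseteq> Y'" "Gamma_measure \<phi> \<U> \<alpha> Y' = 0"
  shows "Gamma_measure \<phi> \<U> \<alpha> Y = 0"
proof -
  have "cover_cost \<phi> \<U> \<alpha> \<epsilon> Y \<le> cover_cost \<phi> \<U> \<alpha> \<epsilon> Y'" for \<epsilon>
    unfolding cover_cost_def using assms(1) by (intro INF_superset_mono) auto
  with assms(2) show ?thesis
    unfolding Gamma_measure_eq_0_iff by (metis le_zero_eq)
qed

lemma Gamma_measure_null_UN:
  fixes Y :: "nat \<Rightarrow> 'a set"
  assumes "\<And>k. Gamma_measure \<phi> \<U> \<alpha> (Y k) = 0"
  shows "Gamma_measure \<phi> \<U> \<alpha> (\<Union>k. Y k) = 0"
  unfolding Gamma_measure_eq_0_iff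
proof (intro allI impI ennreal_eq_0I)
  fix \<epsilon> c :: real assume "0 < \<epsilon>" "0 < c"
  define d where "d k = c * (1 / 2) ^ Suc k" for k :: nat
  have "\<exists>E. Y k \<subseteq> (\<Union>i. E i) \<and> (\<forall>i. D_size \<phi> \<U> (E i) < \<epsilon>) \<and> S_sum \<phi> \<U> \<alpha> E < ennreal (d k)" for k
  proof -
    have "cover_cost \<phi> \<U> \<alpha> \<epsilon> (Y k) < ennreal (d k)"
      using assms \<open>0 < \<epsilon>\<close> \<open>0 < c\<close> by (simp add: Gamma_measure_eq_0_iff d_def)
    then show ?thesis by (rule cover_cost_lessD) blast
  qed
  then obtain E where E: "\<And>k. Y k \<subseteq> (\<Union>i. E k i)" "\<And>k i. D_size \<phi> \<U> (E k i) < \<epsilon>"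
      "\<And>k. S_sum \<phi> \<U> \<alpha> (E k) < ennreal (d k)"
    by metis
  define F where "F i = (case prod_decode i of (k, j) \<Rightarrow> E k j)" for i
  have cover: "(\<Union>k. Y k) \<subseteq> (\<Union>i. F i)"
  proof
    fix x assume "x \<in> (\<Union>k. Y k)"
    then obtain k j where "x \<in> E k j"
      using E(1) by blast
    then have "x \<in> F (prod_encode (k, j))"
      by (simp add: F_def)
    then show "x \<in> (\<Union>i. F i)" by blast
  qed
  have "S_sum \<phi> \<U> \<alpha> F = (\<Sum>i. (\<lambda>(k, j). ennreal (D_size \<phi> \<U> (E k j) powr \<alpha>)) (prod_decode i))"
    by (simp add: S_sum_def F_def case_prod_beta)
  also have "\<dots> = (\<Sum>k. S_sum \<phi> \<U> \<alpha> (E k))"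
    by (rule suminf_ennreal_2dimen) (simp add: S_sum_def)
  also have "\<dots> \<le> (\<Sum>k. ennreal (d k))"
    using E(3) by (intro suminf_le) (auto intro: less_imp_le)
  also have "\<dots> = ennreal c"
    using sums_mult[OF power_half_series, of c] \<open>0 < c\<close>
    by (intro suminf_ennreal_eq) (simp_all add: d_def[abs_def])
  finally have le: "S_sum \<phi> \<U> \<alpha> F \<le> ennreal c" .
  have "D_size \<phi> \<U> (F i) < \<epsilon>" for i
    by (simp add: F_def case_prod_beta E(2))
  then show "cover_cost \<phi> \<U> \<alpha> \<epsilon> (\<Union>k. Y k) \<le> ennreal c"
    by (rule order_trans[OF cover_cost_le[OF cover] le])
qed

lemma D_size_nonneg: "0 \<le> D_size \<phi> \<U> E"
  by (simp add: D_size_def)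

lemma D_size_empty:
  assumes "\<U> \<noteq> {}"
  shows "D_size \<phi> \<U> {} = 0"
  using assms escape_time_eq_PInf[of \<phi> "{}" \<U>] by (auto simp: D_size_def subordinate_def)

lemma D_size_le:
  assumes "0 \<le> n" and "\<And>t. 0 \<le> t \<Longrightarrow> t < n \<Longrightarrow> subordinate (\<phi> t ` E) \<U>"
  shows "D_size \<phi> \<U> E \<le> exp (- n)"
proof -
  have "ereal n \<le> escape_time \<phi> \<U> E"
    using assms by (intro escape_time_greatest(3)) (auto simp: stays_subordinate_def)
  then show ?thesis
    by (cases "escape_time \<phi> \<U> E") (auto simp: D_size_def)
qed

lemma Gamma_measure_null_finite_covers:
  assumes "\<U> \<noteq> {}" "0 < \<alpha>"
    and covers: "\<And>\<epsilon> c. 0 < \<epsilon> \<Longrightarrow> 0 < c \<Longrightarrow> \<exists>(I :: 'i set) F. finite I \<and> Y \<subseteq> (\<Union>i\<in>I. F i)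
      \<and> (\<forall>i\<in>I. D_size \<phi> \<U> (F i) < \<epsilon>) \<and> (\<Sum>i\<in>I. D_size \<phi> \<U> (F i) powr \<alpha>) \<le> c"
  shows "Gamma_measure \<phi> \<U> \<alpha> Y = 0"
  unfolding Gamma_measure_eq_0_iff
proof (intro allI impI ennreal_eq_0I)
  fix \<epsilon> c :: real assume "0 < \<epsilon>" "0 < c"
  then obtain I :: "'i set" and F where F: "finite I" "Y \<subseteq> (\<Union>i\<in>I. F i)"
      "\<And>i. i \<in> I \<Longrightarrow> D_size \<phi> \<U> (F i) < \<epsilon>" "(\<Sum>i\<in>I. D_size \<phi> \<U> (F i) powr \<alpha>) \<le> c"
    using covers by metis
  obtain h where h: "bij_betw h {0..<card I} I"
    using ex_bij_betw_nat_finite[OF F(1)] by blast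
  define E where "E k = (if k < card I then F (h k) else {})" for k
  have "Y \<subseteq> (\<Union>k. E k)"
  proof
    fix x assume "x \<in> Y"
    then obtain i where "i \<in> I" "x \<in> F i" using F(2) by blast
    then obtain k where "k < card I" "x \<in> F (h k)"
      using bij_betw_imp_surj_on[OF h] by force
    then show "x \<in> (\<Union>k. E k)" by (auto simp: E_def)
  qed
  moreover have "D_size \<phi> \<U> (E k) < \<epsilon>" for k
    using bij_betwE[OF h] F(3) \<open>0 < \<epsilon>\<close> D_size_empty[OF assms(1)] by (auto simp: E_def)
  ultimately have "cover_cost \<phi> \<U> \<alpha> \<epsilon> Y \<le> S_sum \<phi> \<U> \<alpha> E"
    by (rule cover_cost_le)
  also have "S_sum \<phi> \<U> \<alpha> E = (\<Sum>k<card I. ennreal (D_size \<phi> \<U> (E k) powr \<alpha>))"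
    unfolding S_sum_def using D_size_empty[OF assms(1)] by (intro suminf_finite) (auto simp: E_def)
  also have "\<dots> = ennreal (\<Sum>k<card I. D_size \<phi> \<U> (E k) powr \<alpha>)"
    by (simp add: sum_ennreal)
  also have "(\<Sum>k<card I. D_size \<phi> \<U> (E k) powr \<alpha>) = (\<Sum>k\<in>{0..<card I}. D_size \<phi> \<U> (F (h k)) powr \<alpha>)"
    by (intro sum.cong) (auto simp: E_def)
  also have "\<dots> = (\<Sum>i\<in>I. D_size \<phi> \<U> (F i) powr \<alpha>)"
    by (rule sum.reindex_bij_betw[OF h])
  finally show "cover_cost \<phi> \<U> \<alpha> \<epsilon> Y \<le> ennreal c"
    using F(4) by (auto elim: order_trans intro: ennreal_leI)
qed

lemma cover_entropy_le:
  assumes "0 \<le> h" and null: "\<And>\<alpha>. 0 < \<alpha> \<Longrightarrow> h < ereal \<alpha> \<Longrightarrow> Gamma_measure \<phi> \<U> \<alpha> Y = 0"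
  shows "cover_entropy \<phi> \<U> Y \<le> h"
proof (rule ccontr)
  assume "\<not> ?thesis"
  then obtain \<alpha> where \<alpha>: "h < ereal \<alpha>" "ereal \<alpha> < cover_entropy \<phi> \<U> Y"
    using ereal_dense2[of h "cover_entropy \<phi> \<U> Y"] by (auto simp: not_le)
  have "0 < \<alpha>"
    using le_less_trans[OF assms(1) \<alpha>(1)] by simp
  then have "cover_entropy \<phi> \<U> Y \<le> ereal \<alpha>"
    unfolding cover_entropy_def using null \<alpha>(1) by (intro Inf_lower) auto
  with \<alpha>(2) show False by simp
qed

text \<open>Rounding the escape time up to an integer \<open>n\<close> keeps the times \<open>0, \<dots>, n - 1\<close> below it and decreases
  \<open>exp (- \<alpha> n)\<close>. The error \<open>\<kappa>\<close> serves sets with infinite escape time, for which \<open>n\<close> is chosen large.\<close>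
lemma integer_escape_time:
  assumes "0 < \<alpha>" "0 < \<kappa>" and D: "D_size \<phi> \<U> E < 1"
  obtains n :: nat where "1 \<le> n" "\<And>t. t < n \<Longrightarrow> subordinate (\<phi> (real t) ` E) \<U>"
    "exp (- \<alpha> * real n) \<le> D_size \<phi> \<U> E powr \<alpha> + \<kappa>"
proof -
  have stays: "subordinate (\<phi> t ` E) \<U>" if "0 \<le> t" "ereal t < escape_time \<phi> \<U> E" for t
    using escape_time_greatest(2)[of \<phi> \<U> E] that by (auto simp: stays_subordinate_def)
  show ?thesis
  proof (cases "escape_time \<phi> \<U> E = \<infinity>")
    case True
    obtain n :: nat where n: "- ln \<kappa> / \<alpha> < real n"
      using reals_Archimedean2 by blast
    have "exp (- \<alpha> * real (Suc n)) \<le> exp (ln \<kappa>)"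
      using n \<open>0 < \<alpha>\<close> by (simp add: field_simps)
    then show ?thesis
      using that[of "Suc n"] stays True \<open>0 < \<kappa>\<close> by (simp add: D_size_def)
  next
    case False
    then obtain N where N: "escape_time \<phi> \<U> E = ereal N"
      using escape_time_greatest(1)[of \<phi> \<U> E] by (cases "escape_time \<phi> \<U> E") auto
    then have "0 < N"
      using D by (simp add: D_size_def)
    define n where "n = nat \<lceil>N\<rceil>"
    have n: "N \<le> real n" "real n < N + 1"
      using \<open>0 < N\<close> unfolding n_def by linarith+
    show ?thesis
    proof (rule that[of n])
      show "1 \<le> n" using \<open>0 < N\<close> n by linarith
      show "subordinate (\<phi> (real t) ` E) \<U>" if "t < n" for t
        using that n by (intro stays) (auto simp: N)
      have "exp (- \<alpha> * real n) \<le> exp (- \<alpha> * N)"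
        using n \<open>0 < \<alpha>\<close> by simp
      also have "\<dots> = D_size \<phi> \<U> E powr \<alpha>"
        by (simp add: D_size_def N powr_def)
      finally show "exp (- \<alpha> * real n) \<le> D_size \<phi> \<U> E powr \<alpha> + \<kappa>"
        using \<open>0 < \<kappa>\<close> by simp
    qed
  qed
qed

section \<open>Metric entropy is bounded by the topological entropy of a carrier\<close>

text \<open>The total weight of all ways to cut a word into nonempty blocks, where a cut has the product of the
  weights of its blocks. Summing over all cuts makes the weight supermultiplicative, and on words of a
  fixed length it is a subprobability by the renewal equation (\<open>sum_parse_weight_le_1\<close>).\<close>
function parse_weight :: "('b list \<Rightarrow> real) \<Rightarrow> 'b list \<Rightarrow> real" where
  "parse_weight W u =
     (if u = [] then 1 else \<Sum>j\<in>{1..length u}. W (take j u) * parse_weight W (drop j u))"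
  by pat_completeness auto
termination by (relation "Wellfounded.measure (\<lambda>(W, u). length u)") auto

declare parse_weight.simps [simp del]

lemma parse_weight_Nil [simp]: "parse_weight W [] = 1"
  by (simp add: parse_weight.simps)

lemma parse_weight_nonneg:
  assumes "\<And>u. 0 \<le> W u"
  shows "0 \<le> parse_weight W u"
proof (induction u rule: length_induct)
  case (1 u)
  then show ?case
    by (subst parse_weight.simps) (auto intro!: sum_nonneg mult_nonneg_nonneg assms)
qed

lemma parse_weight_ge:
  assumes W: "\<And>u. 0 \<le> W u" and "u \<noteq> []"
  shows "W u \<le> parse_weight W u"
proof -
  have "W (take (length u) u) * parse_weight W (drop (length u) u)
      \<le> (\<Sum>j\<in>{1..length u}. W (take j u) * parse_weight W (drop j u))"
    using \<open>u \<noteq> []\<close>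
    by (intro member_le_sum) (auto intro!: mult_nonneg_nonneg W parse_weight_nonneg simp: Suc_le_eq)
  then show ?thesis
    using \<open>u \<noteq> []\<close> by (subst parse_weight.simps) simp
qed

lemma parse_weight_append:
  assumes W: "\<And>u. 0 \<le> W u"
  shows "parse_weight W u * parse_weight W v \<le> parse_weight W (u @ v)"
proof (induction u rule: length_induct)
  case (1 u)
  show ?case
  proof (cases "u = []")
    case False
    have "parse_weight W u * parse_weight W v
        = (\<Sum>j\<in>{1..length u}. W (take j u) * (parse_weight W (drop j u) * parse_weight W v))"
      using False by (subst parse_weight.simps) (simp add: sum_distrib_right mult.assoc)
    also have "\<dots> \<le> (\<Sum>j\<in>{1..length u}. W (take j u) * parse_weight W (drop j u @ v))"
      using 1 False by (intro sum_mono mult_left_mono W) auto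
    also have "\<dots> = (\<Sum>j\<in>{1..length u}. W (take j (u @ v)) * parse_weight W (drop j (u @ v)))"
      by (intro sum.cong) auto
    also have "\<dots> \<le> (\<Sum>j\<in>{1..length (u @ v)}. W (take j (u @ v)) * parse_weight W (drop j (u @ v)))"
      by (intro sum_mono2) (auto intro!: mult_nonneg_nonneg W parse_weight_nonneg)
    also have "\<dots> = parse_weight W (u @ v)"
      using False by (subst (2) parse_weight.simps) simp
    finally show ?thesis .
  qed simp
qed

lemma sum_parse_weight_le_1:
  fixes \<Lambda> :: "'b set"
  assumes W: "\<And>u. 0 \<le> W u"
    and sub: "\<And>L. (\<Sum>j\<in>{1..L}. \<Sum>v\<in>words \<Lambda> j. W v) \<le> 1"
  shows "(\<Sum>u\<in>words \<Lambda> L. parse_weight W u) \<le> 1"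
proof (induction L rule: less_induct)
  case (less L)
  show ?case
  proof (cases "L = 0")
    case False
    have "(\<Sum>u\<in>words \<Lambda> L. parse_weight W u)
        = (\<Sum>u\<in>words \<Lambda> L. \<Sum>j\<in>{1..L}. W (take j u) * parse_weight W (drop j u))"
      using False by (intro sum.cong refl, subst parse_weight.simps) (auto simp: words_def)
    also have "\<dots> = (\<Sum>j\<in>{1..L}. \<Sum>u\<in>words \<Lambda> (j + (L - j)). W (take j u) * parse_weight W (drop j u))"
      by (subst sum.swap) simp
    also have "\<dots> = (\<Sum>j\<in>{1..L}. (\<Sum>v\<in>words \<Lambda> j. W v) * (\<Sum>u\<in>words \<Lambda> (L - j). parse_weight W u))"
      unfolding sum_words_add by simp
    also have "\<dots> \<le> (\<Sum>j\<in>{1..L}. (\<Sum>v\<in>words \<Lambda> j. W v) * 1)"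
      using False by (intro sum_mono mult_left_mono less.IH sum_nonneg W) auto
    also have "\<dots> \<le> 1"
      using sub[of L] by simp
    finally show ?thesis .
  qed simp
qed

text \<open>The probability of receiving \<open>u\<close> when \<open>v\<close> is sent letter by letter through a channel with error rate
  \<open>\<eta>\<close> and \<open>k\<close> letters. It lets a block describe a word with a few wrong letters.\<close>
definition noisy_copy :: "real \<Rightarrow> real \<Rightarrow> 'b list \<Rightarrow> 'b list \<Rightarrow> real" where
  "noisy_copy \<eta> k v u = (\<Prod>t<length v. if u ! t = v ! t then 1 - \<eta> else \<eta> / k)"

text \<open>In each position the letters have total weight at most \<open>(1 - \<eta>) + k * (\<eta> / k)\<close>.\<close>
lemma sum_noisy_copy_le_1:
  assumes "finite \<Lambda>" "0 < \<eta>" "\<eta> < 1"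
  shows "(\<Sum>u\<in>words \<Lambda> (length v). noisy_copy \<eta> (real (card \<Lambda>)) v u) \<le> 1"
proof -
  let ?k = "real (card \<Lambda>)"
  have "(\<Sum>b\<in>\<Lambda>. if b = a then 1 - \<eta> else \<eta> / ?k) \<le> 1" for a
  proof -
    have "(\<Sum>b\<in>\<Lambda>. if b = a then 1 - \<eta> else \<eta> / ?k) \<le> (\<Sum>b\<in>\<Lambda>. (if b = a then 1 - \<eta> else 0) + \<eta> / ?k)"
      using assms by (intro sum_mono) auto
    also have "\<dots> = (if a \<in> \<Lambda> then 1 - \<eta> else 0) + ?k * (\<eta> / ?k)"
      using assms(1) by (simp add: sum.distrib)
    also have "\<dots> \<le> 1"
      using assms by auto
    finally show ?thesis .
  qed
  then have "(\<Prod>t<length v. \<Sum>b\<in>\<Lambda>. if b = v ! t then 1 - \<eta> else \<eta> / ?k) \<le> 1"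
    using assms by (intro prod_le_1) (auto intro!: sum_nonneg)
  then show ?thesis
    unfolding noisy_copy_def sum_words_prod[of "\<lambda>t b. if b = v ! t then 1 - \<eta> else \<eta> / ?k"] .
qed

context labelled_map
begin

text \<open>The points of \<open>Q i\<close> have itineraries that agree with the pattern \<open>pat i\<close> except at visits to \<open>B\<close>.
  Starting at a point of \<open>Q i\<close>, the next \<open>length (pat i)\<close> letters are coded by \<open>i\<close> at cost \<open>\<alpha>\<close> per letter,
  plus \<open>- ln (1 - \<eta>)\<close> for each correct and \<open>ln (k / \<eta>)\<close> for each wrong letter. At points outside all
  \<open>Q i\<close> a single letter is coded at cost \<open>ln (2 * k)\<close>. Half of the total block weight is reserved for
  single letters, the other half for the patterns.\<close>
lemma block_entropy_le_by_covering:
  fixes pat :: "'i \<Rightarrow> 'b list"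
  assumes I: "finite I" "\<And>i. i \<in> I \<Longrightarrow> pat i \<noteq> []"
    and weights: "(\<Sum>i\<in>I. exp (- \<alpha> * real (length (pat i)))) \<le> 1 / 2" and "0 < \<alpha>"
    and \<eta>: "0 < \<eta>" "\<eta> < 1"
    and B: "B \<in> events" and Q: "\<And>i. i \<in> I \<Longrightarrow> Q i \<in> events"
    and match: "\<And>i x t. i \<in> I \<Longrightarrow> x \<in> Q i \<Longrightarrow> t < length (pat i)
      \<Longrightarrow> (T ^^ t) x \<notin> B \<Longrightarrow> c ((T ^^ t) x) = pat i ! t"
  defines "k \<equiv> real (card \<Lambda>)"
  obtains C where "\<And>L. block_entropy L \<le> real L * (\<alpha> - ln (1 - \<eta>) + prob B * ln (k / \<eta>)
      + prob (- (\<Union>i\<in>I. Q i)) * ln (2 * k)) + C"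
proof -
  have "\<Lambda> \<noteq> {}" using label_in by auto
  then have k: "1 \<le> k"
    using finite_labels unfolding k_def by (simp add: Suc_le_eq card_gt_0_iff)
  define Z where "Z = - (\<Union>i\<in>I. Q i)"
  have Z: "Z \<in> events"
    using sets.compl_sets[OF sets.finite_UN[OF I(1) Q]] by (simp add: Z_def space_UNIV Compl_eq_Diff_UNIV)
  \<comment> \<open>Weights of blocks: single letters share \<open>1 / 2\<close>, and pattern \<open>i\<close> spreads its weight over the words near \<open>pat i\<close>.\<close>
  define W where "W u = (if length u = 1 then 1 / (2 * k) else 0)
    + (\<Sum>i\<in>I. if length u = length (pat i) then exp (- \<alpha> * real (length u)) * noisy_copy \<eta> k (pat i) u else 0)"
    for u
  have copy_pos: "0 < noisy_copy \<eta> k v u" for v u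
    unfolding noisy_copy_def using \<eta> k by (intro prod_pos) auto
  note copy_nonneg = copy_pos[THEN less_imp_le]
  have W_nonneg: "0 \<le> W u" for u
    unfolding W_def using k
    by (auto intro!: add_nonneg_nonneg sum_nonneg mult_nonneg_nonneg copy_nonneg)
  have W_sum: "(\<Sum>j\<in>{1..L}. \<Sum>v\<in>words \<Lambda> j. W v) \<le> 1" for L
  proof -
    have 1: "(\<Sum>j\<in>{1..L}. \<Sum>v\<in>words \<Lambda> j. if length v = 1 then 1 / (2 * k) else 0) \<le> 1 / 2"
    proof -
      have "(\<Sum>v\<in>words \<Lambda> j. if length v = 1 then 1 / (2 * k) else 0) = (if j = 1 then 1 / 2 else 0)" for j
      proof (cases "j = 1")
        case True
        have "(\<Sum>v\<in>words \<Lambda> j. if length v = 1 then 1 / (2 * k) else 0) = (\<Sum>v\<in>words \<Lambda> 1. 1 / (2 * k))"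
          using True by (intro sum.cong) (auto simp: words_def)
        also have "\<dots> = 1 / 2"
          using k by (simp add: words_1[unfolded One_nat_def] card_image inj_on_def k_def[symmetric])
        finally show ?thesis using True by simp
      next
        case False
        then show ?thesis by (auto simp: words_def intro!: sum.neutral)
      qed
      then show ?thesis by simp
    qed
    have "(\<Sum>j\<in>{1..L}. \<Sum>v\<in>words \<Lambda> j. \<Sum>i\<in>I.
          if length v = length (pat i) then exp (- \<alpha> * real (length v)) * noisy_copy \<eta> k (pat i) v else 0)
        = (\<Sum>i\<in>I. \<Sum>j\<in>{1..L}. \<Sum>v\<in>words \<Lambda> j.
          if length v = length (pat i) then exp (- \<alpha> * real (length v)) * noisy_copy \<eta> k (pat i) v else 0)"
      by (subst sum.swap, subst (2) sum.swap) simp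
    also have "\<dots> \<le> (\<Sum>i\<in>I. exp (- \<alpha> * real (length (pat i))))"
    proof (intro sum_mono)
      fix i assume "i \<in> I"
      let ?n = "length (pat i)"
      have "(\<Sum>v\<in>words \<Lambda> j. if length v = ?n then exp (- \<alpha> * real (length v)) * noisy_copy \<eta> k (pat i) v else 0)
          \<le> (if j = ?n then exp (- \<alpha> * real ?n) else 0)" for j
      proof (cases "j = ?n")
        case True
        have "(\<Sum>v\<in>words \<Lambda> j. if length v = ?n then exp (- \<alpha> * real (length v)) * noisy_copy \<eta> k (pat i) v else 0)
            = exp (- \<alpha> * real ?n) * (\<Sum>v\<in>words \<Lambda> ?n. noisy_copy \<eta> k (pat i) v)"
          unfolding sum_distrib_left using True by (intro sum.cong) (auto simp: words_def)
        also have "\<dots> \<le> exp (- \<alpha> * real ?n) * 1"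
          unfolding k_def by (intro mult_left_mono sum_noisy_copy_le_1 finite_labels \<eta>) simp
        finally show ?thesis using True by simp
      next
        case False
        then show ?thesis by (auto simp: words_def intro!: sum_nonpos)
      qed
      then have "(\<Sum>j\<in>{1..L}. \<Sum>v\<in>words \<Lambda> j.
            if length v = ?n then exp (- \<alpha> * real (length v)) * noisy_copy \<eta> k (pat i) v else 0)
          \<le> (\<Sum>j\<in>{1..L}. if j = ?n then exp (- \<alpha> * real ?n) else 0)"
        by (intro sum_mono)
      also have "\<dots> \<le> exp (- \<alpha> * real ?n)"
        by simp
      finally show "(\<Sum>j\<in>{1..L}. \<Sum>v\<in>words \<Lambda> j.
            if length v = ?n then exp (- \<alpha> * real (length v)) * noisy_copy \<eta> k (pat i) v else 0)
          \<le> exp (- \<alpha> * real ?n)" .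
    qed
    also have "\<dots> \<le> 1 / 2" by (rule weights)
    finally show ?thesis
      using 1 unfolding W_def sum.distrib by linarith
  qed
  let ?pw = "parse_weight W"
  have letter: "1 / (2 * k) \<le> ?pw [b]" for b
  proof -
    have "1 / (2 * k) \<le> W [b]"
      unfolding W_def by (auto intro!: sum_nonneg mult_nonneg_nonneg copy_nonneg)
    also have "\<dots> \<le> ?pw [b]"
      by (intro parse_weight_ge W_nonneg) simp
    finally show ?thesis .
  qed
  have pw_pos: "0 < ?pw u" for u
  proof (induction u)
    case (Cons b u)
    have "0 < ?pw [b] * ?pw u"
      using letter[of b] Cons k by (intro mult_pos_pos) (auto intro: less_le_trans[of 0 "1 / (2 * k)"])
    also have "\<dots> \<le> ?pw (b # u)"
      using parse_weight_append[of W "[b]" u, OF W_nonneg] by simp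
    finally show ?case .
  qed simp
  define a where "a n x = - ln (?pw (word T c n x))" for n x
  \<comment> \<open>A bound for the cost per letter: \<open>B\<close> charges wrong letters, \<open>Z\<close> charges single-letter blocks.\<close>
  define G where "G x = \<alpha> - ln (1 - \<eta>) + indicator B x * ln (k / \<eta>) + indicator Z x * ln (2 * k)" for x
  have ln_nonneg: "0 \<le> - ln (1 - \<eta>)" "0 \<le> ln (k / \<eta>)" "0 \<le> ln (2 * k)"
    using \<eta> k by (auto intro!: ln_ge_zero simp: field_simps)
  have G_ge: "\<alpha> - ln (1 - \<eta>) + indicator B x * ln (k / \<eta>) \<le> G x" "indicator Z x * ln (2 * k) \<le> G x" for x
    using ln_nonneg \<open>0 < \<alpha>\<close> by (auto simp: G_def indicator_def)
  have a1: "a 1 x \<le> ln (2 * k)" for x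
  proof -
    have "ln (1 / (2 * k)) \<le> ln (?pw [c x])"
      using letter[of "c x"] pw_pos[of "[c x]"] k by (subst ln_le_cancel_iff) auto
    then show ?thesis
      using k by (simp add: a_def word_def ln_div)
  qed
  define N where "N = Suc (\<Sum>i\<in>I. length (pat i))"
  have stop: "\<exists>n. 1 \<le> n \<and> n \<le> N \<and> a n x \<le> birkhoff_sum T G n x" for x
  proof (cases "x \<in> Z")
    case True
    then show ?thesis
      using a1[of x] G_ge(2)[of x] by (intro exI[of _ 1]) (auto simp: N_def birkhoff_sum_def)
  next
    case False
    then obtain i where i: "i \<in> I" "x \<in> Q i"
      by (auto simp: Z_def)
    define n where "n = length (pat i)"
    have n: "1 \<le> n" "n \<le> N"
      using I(2)[OF i(1)] member_le_sum[of i I "\<lambda>i. length (pat i)"] i(1) I(1)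
      by (auto simp: n_def N_def Suc_le_eq)
    let ?w = "word T c n x"
    have "exp (- \<alpha> * real n) * noisy_copy \<eta> k (pat i) ?w
        = (if length ?w = length (pat i) then exp (- \<alpha> * real (length ?w)) * noisy_copy \<eta> k (pat i) ?w else 0)"
      by (simp add: n_def)
    also have "\<dots> \<le> (\<Sum>i\<in>I. if length ?w = length (pat i)
        then exp (- \<alpha> * real (length ?w)) * noisy_copy \<eta> k (pat i) ?w else 0)"
      using i(1) I(1)
      by (intro member_le_sum[of i I "\<lambda>i. if length ?w = length (pat i)
        then exp (- \<alpha> * real (length ?w)) * noisy_copy \<eta> k (pat i) ?w else 0"])
        (auto intro!: mult_nonneg_nonneg copy_nonneg)
    also have "\<dots> \<le> W ?w"
      unfolding W_def using k by simp
    also have "\<dots> \<le> ?pw ?w"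
      using n(1) by (intro parse_weight_ge W_nonneg) (auto simp: word_def)
    finally have "ln (exp (- \<alpha> * real n) * noisy_copy \<eta> k (pat i) ?w) \<le> ln (?pw ?w)"
      using copy_pos pw_pos by (subst ln_le_cancel_iff) (auto intro!: mult_pos_pos)
    moreover have "ln (exp (- \<alpha> * real n) * noisy_copy \<eta> k (pat i) ?w)
        = - \<alpha> * real n + ln (noisy_copy \<eta> k (pat i) ?w)"
      using copy_pos[of "pat i" ?w] by (subst ln_mult) auto
    ultimately have "a n x \<le> \<alpha> * real n - ln (noisy_copy \<eta> k (pat i) ?w)"
      by (simp add: a_def)
    also have "ln (noisy_copy \<eta> k (pat i) ?w)
        = (\<Sum>t<n. ln (if ?w ! t = pat i ! t then 1 - \<eta> else \<eta> / k))"
      unfolding noisy_copy_def n_def using \<eta> k by (intro ln_prod) auto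
    also have "\<alpha> * real n - \<dots> = (\<Sum>t<n. \<alpha> - ln (if ?w ! t = pat i ! t then 1 - \<eta> else \<eta> / k))"
      by (simp add: sum_subtractf mult.commute)
    also have "\<dots> \<le> birkhoff_sum T G n x"
      unfolding birkhoff_sum_def
    proof (intro sum_mono)
      fix t assume "t \<in> {..<n}"
      then have t: "t < n" by simp
      let ?y = "(T ^^ t) x"
      have "- ln (if ?w ! t = pat i ! t then 1 - \<eta> else \<eta> / k) \<le> - ln (1 - \<eta>) + indicator B ?y * ln (k / \<eta>)"
      proof (cases "?y \<in> B")
        case True
        have "ln (\<eta> / k) = - ln (k / \<eta>)"
          using \<eta> k by (simp add: ln_div)
        then show ?thesis using True ln_nonneg by auto
      next
        case False
        then have "?w ! t = pat i ! t"
          using match[OF i, of t] t by (simp add: n_def)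
        then show ?thesis using False by simp
      qed
      then show "\<alpha> - ln (if ?w ! t = pat i ! t then 1 - \<eta> else \<eta> / k) \<le> G ?y"
        using G_ge(1)[of ?y] by linarith
    qed
    finally show ?thesis
      using n by blast
  qed
  have int_ind: "integrable M (\<lambda>x. indicator A x * r)" if "A \<in> events" for A :: "'a set" and r :: real
    using that by (intro integrable_mult_left integrable_real_indicator) (auto simp: emeasure_eq_measure)
  have int_G: "integrable M G"
    unfolding G_def[abs_def] using B Z by (intro Bochner_Integration.integrable_add int_ind) auto
  have G_int: "(\<integral>x. G x \<partial>M) = \<alpha> - ln (1 - \<eta>) + prob B * ln (k / \<eta>) + prob Z * ln (2 * k)"
    unfolding G_def using B Z int_ind
    by (subst Bochner_Integration.integral_add, (auto)[2])+ (simp add: prob_space)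
  have "block_entropy L \<le> real L * (\<integral>x. G x \<partial>M) + real N * ln (2 * k)" for L
  proof -
    have "block_entropy L \<le> (\<integral>x. a L x \<partial>M)"
      unfolding a_def using pw_pos
      by (intro block_entropy_le_coding sum_parse_weight_le_1 W_nonneg W_sum) (auto intro: less_imp_le)
    also have "\<dots> \<le> real L * (\<integral>x. G x \<partial>M) + real N * ln (2 * k)"
    proof (rule integral_stopping_time_bound[OF _ _ a1 ln_nonneg(3) _ stop int_G])
      fix m n x
      have "ln (?pw (word T c m x) * ?pw (word T c n ((T ^^ m) x))) \<le> ln (?pw (word T c (m + n) x))"
        using pw_pos parse_weight_append[of W, OF W_nonneg]
        by (subst ln_le_cancel_iff) (auto simp: word_add)
      then show "a (m + n) x \<le> a m x + a n ((T ^^ m) x)"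
        using pw_pos[of "word T c m x"] pw_pos[of "word T c n ((T ^^ m) x)"]
        by (simp add: a_def ln_mult)
    next
      show "a 0 x \<le> 0" for x
        by (simp add: a_def word_def)
      show "0 \<le> G x" for x
        using ln_nonneg(3) by (intro order_trans[OF _ G_ge(2)] mult_nonneg_nonneg) auto
      show "integrable M (a L)"
        unfolding a_def[abs_def] by (rule integrable_word)
    qed
    finally show ?thesis .
  qed
  then show ?thesis
    using that[of "real N * ln (2 * k)"] G_int unfolding Z_def by simp
qed

end

lemma small_coding_overhead:
  fixes k \<kappa> :: real
  assumes "1 \<le> k" "0 < \<kappa>"
  obtains \<delta> where "0 < \<delta>" "\<delta> < 1" "- ln (1 - \<delta>) + \<delta> * ln (k / \<delta>) + \<delta> * ln (2 * k) < \<kappa>"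
proof -
  have "((\<lambda>\<delta>. - ln (1 - \<delta>) + \<delta> * ln (k / \<delta>) + \<delta> * ln (2 * k)) \<longlongrightarrow> 0) (at_right 0)"
    using \<open>1 \<le> k\<close> by real_asymp
  then have "\<forall>\<^sub>F \<delta> in at_right 0. - ln (1 - \<delta>) + \<delta> * ln (k / \<delta>) + \<delta> * ln (2 * k) < \<kappa>"
    using \<open>0 < \<kappa>\<close> by (rule order_tendstoD)
  moreover have "\<forall>\<^sub>F \<delta>::real in at_right 0. 0 < \<delta> \<and> \<delta> < 1"
    by (intro eventually_conj eventually_at_right_less order_tendstoD(2)[OF tendsto_ident_at]) simp
  ultimately have "\<forall>\<^sub>F \<delta> in at_right 0. 0 < \<delta> \<and> \<delta> < 1
      \<and> - ln (1 - \<delta>) + \<delta> * ln (k / \<delta>) + \<delta> * ln (2 * k) < \<kappa>"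
    by eventually_elim simp
  then have "\<exists>\<delta>. 0 < \<delta> \<and> \<delta> < 1 \<and> - ln (1 - \<delta>) + \<delta> * ln (k / \<delta>) + \<delta> * ln (2 * k) < \<kappa>"
    by (intro eventually_happens'[of "at_right (0::real)"]) auto
  then show ?thesis using that by blast
qed

text \<open>The cells are replaced by closed subsets \<open>K A\<close>, up to a set \<open>B\<close> of small measure. The open set \<open>V A\<close>
  avoids the closed parts of all cells other than \<open>A\<close>, so a point of \<open>V A\<close> outside \<open>B\<close> lies in \<open>A\<close>, and a set
  that follows the cover \<open>\<V>\<close> determines itineraries up to visits to \<open>B\<close>.\<close>
lemma (in invariant_flow) entropy_wrt_partition_le:
  assumes \<xi>: "finite_measurable_partition M \<xi>" and Y0: "AE x in M. x \<in> Y"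
  shows "ereal (entropy_wrt_partition M (\<phi> 1) \<xi>) \<le> flow_top_entropy \<phi> Y"
proof (rule ccontr)
  let ?h = "entropy_wrt_partition M (\<phi> 1) \<xi>"
  assume "\<not> ?thesis"
  then obtain \<beta> where \<beta>: "flow_top_entropy \<phi> Y < ereal \<beta>" "\<beta> < ?h"
    using ereal_dense2[of "flow_top_entropy \<phi> Y" "ereal ?h"] by (auto simp: not_le)
  interpret mpm: measure_preserving_map M "\<phi> 1"
    by (rule time_map_preserving)
  interpret lab: labelled_map M "\<phi> 1" "cell \<xi>" \<xi>
    by (rule mpm.labelled_map_cell[OF \<xi>])
  have part: "partition_on UNIV \<xi>" and fin: "finite \<xi>" and meas: "\<And>A. A \<in> \<xi> \<Longrightarrow> A \<in> sets M"
    using \<xi> by (auto simp: finite_measurable_partition_def)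
  note cell = cell_eq_iff[OF part]
  define k where "k = real (card \<xi>)"
  have "\<xi> \<noteq> {}" using lab.label_in by auto
  then have k: "1 \<le> k"
    using fin unfolding k_def by (simp add: Suc_le_eq card_gt_0_iff)
  obtain \<delta> where \<delta>: "0 < \<delta>" "\<delta> < 1"
      "- ln (1 - \<delta>) + \<delta> * ln (k / \<delta>) + \<delta> * ln (2 * k) < ?h - \<beta>"
    using small_coding_overhead[OF k] \<beta>(2) by (metis diff_gt_0_iff_gt)
  have "\<exists>K. closed K \<and> K \<subseteq> A \<and> prob (A - K) < \<delta> / k" if "A \<in> \<xi>" for A
    using closed_inner_regular[OF finite_measure_axioms sets_M meas[OF that], of "\<delta> / k"] \<delta>(1) k
    by (metis divide_pos_pos less_le_trans zero_less_one)
  then obtain K where K: "\<And>A. A \<in> \<xi> \<Longrightarrow> closed (K A)" "\<And>A. A \<in> \<xi> \<Longrightarrow> K A \<subseteq> A"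
      "\<And>A. A \<in> \<xi> \<Longrightarrow> prob (A - K A) < \<delta> / k"
    by metis
  define B where "B = (\<Union>A\<in>\<xi>. A - K A)"
  have B_meas: "B \<in> sets M"
    unfolding B_def using fin meas K(1) by (intro sets.finite_UN) auto
  have "prob B \<le> (\<Sum>A\<in>\<xi>. prob (A - K A))"
    unfolding B_def using fin meas K(1) by (intro finite_measure_subadditive_finite) auto
  also have "\<dots> \<le> (\<Sum>A\<in>\<xi>. \<delta> / k)"
    using K(3) by (intro sum_mono) (auto intro: less_imp_le)
  also have "\<dots> = \<delta>"
    using k by (simp add: k_def)
  finally have prob_B: "prob B \<le> \<delta>" .
  define V where "V A = - (\<Union>A'\<in>\<xi> - {A}. K A')" for A
  have V_open: "open (V A)" for A
    unfolding V_def using fin K(1) by (intro open_Compl closed_UN) auto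
  have in_V: "x \<in> V (cell \<xi> x)" for x
    using K(2) cell(1)[of _ x] by (auto simp: V_def)
  have V_cell: "cell \<xi> x = A" if "x \<in> V A" "x \<notin> B" "A \<in> \<xi>" for x A
  proof (rule ccontr)
    assume "cell \<xi> x \<noteq> A"
    moreover have "x \<in> K (cell \<xi> x)"
      using that(2) cell(1)[of "cell \<xi> x" x] cell(2)[of x] by (auto simp: B_def)
    ultimately show False
      using that(1) cell(2)[of x] by (auto simp: V_def)
  qed
  define \<V> where "\<V> = V ` \<xi>"
  have "finite_open_cover \<V>"
    using fin V_open in_V cell(2) by (auto simp: finite_open_cover_def \<V>_def)
  then have "cover_entropy \<phi> \<V> Y < ereal \<beta>"
    using \<beta>(1) unfolding flow_top_entropy_def by (intro le_less_trans[OF SUP_upper \<beta>(1)[unfolded flow_top_entropy_def]]) simp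
  then obtain \<alpha> where \<alpha>: "0 < \<alpha>" "\<alpha> < \<beta>" "Gamma_measure \<phi> \<V> \<alpha> Y = 0"
    by (auto simp: cover_entropy_def Inf_less_iff)
  then have "cover_cost \<phi> \<V> \<alpha> 1 Y < ennreal (1 / 4)"
    by (simp add: Gamma_measure_eq_0_iff)
  then obtain E where E: "Y \<subseteq> (\<Union>i. E i)" "\<And>i. D_size \<phi> \<V> (E i) < 1" "S_sum \<phi> \<V> \<alpha> E < ennreal (1 / 4)"
    by (rule cover_cost_lessD) blast
  have "\<exists>n::nat. 1 \<le> n \<and> (\<forall>t<n. subordinate (\<phi> (real t) ` E i) \<V>)
      \<and> exp (- \<alpha> * real n) \<le> D_size \<phi> \<V> (E i) powr \<alpha> + (1 / 4) * (1 / 2) ^ Suc i" for i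
    using integer_escape_time[OF \<alpha>(1) _ E(2), of "(1 / 4) * (1 / 2) ^ Suc i" i]
    by (metis mult_pos_pos zero_less_divide_1_iff zero_less_numeral zero_less_power)
  then obtain n where n: "\<And>i. 1 \<le> (n i :: nat)" "\<And>i t. t < n i \<Longrightarrow> subordinate (\<phi> (real t) ` E i) \<V>"
      "\<And>i. exp (- \<alpha> * real (n i)) \<le> D_size \<phi> \<V> (E i) powr \<alpha> + (1 / 4) * (1 / 2) ^ Suc i"
    by metis
  define itin where "itin i t = (SOME A. A \<in> \<xi> \<and> \<phi> (real t) ` E i \<subseteq> V A)" for i t
  have itin: "itin i t \<in> \<xi> \<and> \<phi> (real t) ` E i \<subseteq> V (itin i t)" if "t < n i" for i t
  proof -
    have "subordinate (\<phi> (real t) ` E i) \<V>"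
      using that by (rule n(2))
    then obtain A where "A \<in> \<xi>" "\<phi> (real t) ` E i \<subseteq> V A"
      unfolding subordinate_def \<V>_def by blast
    then have "A \<in> \<xi> \<and> \<phi> (real t) ` E i \<subseteq> V A" ..
    then show ?thesis
      unfolding itin_def by (rule someI)
  qed
  define pat where "pat i = map (itin i) [0..<n i]" for i
  have pat: "length (pat i) = n i" "\<And>t. t < n i \<Longrightarrow> pat i ! t = itin i t" for i
    by (auto simp: pat_def)
  \<comment> \<open>The sets \<open>E i\<close> may fail to be measurable; \<open>Q i\<close> is an open set containing \<open>E i\<close> with the same property.\<close>
  define Q where "Q i = (\<Inter>t\<in>{..<n i}. \<phi> (real t) -` V (itin i t))" for i
  have "open (Q i)" for i
    unfolding Q_def by (intro open_INT ballI open_vimage V_open continuous_intros) auto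
  then have Q_meas: "Q i \<in> sets M" for i
    by simp
  have E_Q: "E i \<subseteq> Q i" for i
    using itin by (force simp: Q_def)
  have "AE x in M. \<exists>R. x \<in> (\<Union>i<R. Q i)"
    using Y0
  proof eventually_elim
    case (elim x)
    then obtain i where "x \<in> E i" using E(1) by blast
    then show ?case using E_Q by (intro exI[of _ "Suc i"]) auto
  qed
  moreover have "incseq (\<lambda>R. \<Union>i<R. Q i)"
    by (intro monoI UN_mono) auto
  moreover have "(\<Union>i<R. Q i) \<in> sets M" for R
    using Q_meas by (intro sets.finite_UN) auto
  ultimately obtain R where R: "prob (- (\<Union>i<R. Q i)) < \<delta>"
    using mpm.exceptional_prob_small[of "\<lambda>R. \<Union>i<R. Q i" \<delta>] \<delta>(1) by blast
  have "(\<Sum>i<R. exp (- \<alpha> * real (length (pat i)))) \<le> (\<Sum>i<R. D_size \<phi> \<V> (E i) powr \<alpha> + (1 / 4) * (1 / 2) ^ Suc i)"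
    unfolding pat by (intro sum_mono n(3))
  also have "\<dots> = (\<Sum>i<R. D_size \<phi> \<V> (E i) powr \<alpha>) + (1 / 4) * (\<Sum>i<R. (1 / 2) ^ Suc i)"
    by (simp add: sum.distrib sum_distrib_left)
  also have "\<dots> \<le> 1 / 4 + (1 / 4) * 1"
  proof (intro add_mono mult_left_mono)
    have "ennreal (\<Sum>i<R. D_size \<phi> \<V> (E i) powr \<alpha>) = (\<Sum>i<R. ennreal (D_size \<phi> \<V> (E i) powr \<alpha>))"
      by (simp add: sum_ennreal)
    also have "\<dots> \<le> S_sum \<phi> \<V> \<alpha> E"
      unfolding S_sum_def by (intro sum_le_suminf) auto
    finally have "ennreal (\<Sum>i<R. D_size \<phi> \<V> (E i) powr \<alpha>) \<le> ennreal (1 / 4)"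
      by (rule order_trans[OF _ less_imp_le[OF E(3)]])
    then show "(\<Sum>i<R. D_size \<phi> \<V> (E i) powr \<alpha>) \<le> 1 / 4"
      by (subst (asm) ennreal_le_iff) auto
    show "(\<Sum>i<R. (1 / 2) ^ Suc i) \<le> (1::real)"
      using sum_le_suminf[of "\<lambda>i. (1 / 2 :: real) ^ Suc i" "{..<R}"] power_half_series by (simp add: sums_iff)
  qed simp
  finally have weights: "(\<Sum>i<R. exp (- \<alpha> * real (length (pat i)))) \<le> 1 / 2" by simp
  obtain C where C: "\<And>L. lab.block_entropy L \<le> real L * (\<alpha> - ln (1 - \<delta>) + prob B * ln (k / \<delta>)
      + prob (- (\<Union>i<R. Q i)) * ln (2 * k)) + C"
  proof (rule lab.block_entropy_le_by_covering[of "{..<R}" pat \<alpha> \<delta> B Q])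
    fix i x t assume "x \<in> Q i" "t < length (pat i)" "(\<phi> 1 ^^ t) x \<notin> B"
    then have "x \<in> Q i" "t < n i" "\<phi> (real t) x \<notin> B"
      by (auto simp: pat funpow_flow)
    moreover from this have "\<phi> (real t) x \<in> V (itin i t)"
      by (auto simp: Q_def)
    ultimately show "cell \<xi> ((\<phi> 1 ^^ t) x) = pat i ! t"
      using itin[of t i] V_cell[of "\<phi> (real t) x" "itin i t"] by (simp add: funpow_flow pat)
  next
    show "pat i \<noteq> []" for i
      using n(1)[of i] by (auto simp: pat_def)
  qed (use weights \<alpha> \<delta> B_meas Q_meas that in \<open>auto simp: k_def\<close>)
  define g where "g = \<alpha> - ln (1 - \<delta>) + prob B * ln (k / \<delta>) + prob (- (\<Union>i<R. Q i)) * ln (2 * k)"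
  have "(\<lambda>L. g + C / real L) \<longlonglongrightarrow> g + 0"
    by (intro tendsto_intros lim_const_over_n)
  moreover have "(\<lambda>L. lab.block_entropy L / real L) \<longlonglongrightarrow> ?h"
    by (rule mpm.entropy_wrt_partition_tendsto[OF \<xi>])
  moreover have "\<forall>\<^sub>F L in sequentially. lab.block_entropy L / real L \<le> g + C / real L"
    using eventually_gt_at_top[of "0::nat"]
  proof eventually_elim
    case (elim L)
    then show ?case
      using C[of L] by (simp add: g_def field_simps)
  qed
  ultimately have "?h \<le> g"
    using tendsto_le[OF sequentially_bot] by fastforce
  also have "g \<le> \<alpha> - ln (1 - \<delta>) + \<delta> * ln (k / \<delta>) + \<delta> * ln (2 * k)"
    unfolding g_def using prob_B R \<delta> k
    by (intro add_mono mult_right_mono) (auto intro!: ln_ge_zero simp: field_simps)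
  also have "\<dots> < ?h"
    using \<delta>(3) \<alpha>(2) by linarith
  finally show False by simp
qed

lemma (in invariant_flow) metric_entropy_le_top_entropy:
  assumes "AE x in M. x \<in> Y"
  shows "flow_metric_entropy M \<phi> \<le> flow_top_entropy \<phi> Y"
  unfolding flow_metric_entropy_def KS_entropy_def
  by (intro SUP_least) (auto intro: entropy_wrt_partition_le assms)

section \<open>The topological entropy of the generic points is bounded by metric entropy\<close>

text \<open>The words of length \<open>J\<close> have total weight at most one, and each word counted here has weight at
  least \<open>exp (- r)\<close>.\<close>
lemma card_words_cost_le:
  fixes cost :: "'l \<Rightarrow> real"
  assumes "finite \<Lambda>" and kraft: "(\<Sum>l\<in>\<Lambda>. exp (- cost l)) \<le> 1"
  shows "real (card {w \<in> words \<Lambda> J. (\<Sum>j<J. cost (w ! j)) \<le> r}) \<le> exp r"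
proof -
  let ?W = "{w \<in> words \<Lambda> J. (\<Sum>j<J. cost (w ! j)) \<le> r}"
  have "real (card ?W) = (\<Sum>w\<in>?W. 1)" by simp
  also have "\<dots> \<le> (\<Sum>w\<in>?W. exp (r - (\<Sum>j<J. cost (w ! j))))"
    by (intro sum_mono) simp
  also have "\<dots> \<le> (\<Sum>w\<in>words \<Lambda> J. exp (r - (\<Sum>j<J. cost (w ! j))))"
    using finite_words[OF assms(1)] by (intro sum_mono2) auto
  also have "\<dots> = exp r * (\<Sum>w\<in>words \<Lambda> J. \<Prod>j<J. exp (- cost (w ! j)))"
    unfolding sum_distrib_left
  proof (rule sum.cong[OF refl])
    fix w
    have "exp (r - (\<Sum>j<J. cost (w ! j))) = exp r * exp (\<Sum>j<J. - cost (w ! j))"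
      by (simp add: exp_add[symmetric] sum_negf)
    then show "exp (r - (\<Sum>j<J. cost (w ! j))) = exp r * (\<Prod>j<J. exp (- cost (w ! j)))"
      by (simp only: exp_sum[OF finite_lessThan])
  qed
  also have "\<dots> = exp r * (\<Sum>l\<in>\<Lambda>. exp (- cost l)) ^ J"
    unfolding sum_words_prod[of "\<lambda>_ l. exp (- cost l)"] by simp
  also have "\<dots> \<le> exp r * 1"
    using kraft by (intro mult_left_mono power_le_one sum_nonneg) auto
  finally show ?thesis by simp
qed

context compact_flow
begin

text \<open>The time average up to \<open>n * J\<close> is, approximately, a mean over phases \<open>p / m\<close> in \<open>[0, n]\<close> of averages over the
  times \<open>p / m + n * j\<close>, so one phase does at least as well as the mean. The finite number of
  phases, which does not depend on \<open>J\<close>, is what makes the later counting work.\<close>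
lemma cheap_phase:
  fixes \<psi> :: "'a \<Rightarrow> real"
  assumes \<psi>: "continuous_on UNIV \<psi>" and "1 \<le> n" and "s < s'"
  obtains m :: nat where "1 \<le> m"
    "\<And>J x. 1 \<le> J \<Longrightarrow> time_average (real n * real J) \<psi> x < real n * s \<Longrightarrow>
       \<exists>p<n * m. (\<Sum>j<J. \<psi> (\<phi> (real p / real m + real n * real j) x)) \<le> real J * (real n * s')"
proof -
  obtain m :: nat where m: "1 \<le> m"
    "\<And>k x. \<bar>integral {0..real k / real m} (\<lambda>t. \<psi> (\<phi> t x)) - birkhoff_sum (\<phi> (1 / real m)) \<psi> k x / real m\<bar>
      \<le> (real n * (s' - s)) * (real k / real m)"
    using riemann_sum_approximation[OF \<psi>, of "real n * (s' - s)"] assms(2,3) by auto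
  show ?thesis
  proof (rule that[OF m(1)])
    fix J :: nat and x assume J: "1 \<le> J" and avg: "time_average (real n * real J) \<psi> x < real n * s"
    let ?k = "n * m"
    let ?g = "\<lambda>p j. \<psi> (\<phi> (real p / real m + real n * real j) x)"
    have "birkhoff_sum (\<phi> (1 / real m)) \<psi> (J * ?k) x
        = (\<Sum>j<J. \<Sum>i\<in>{j * ?k..<j * ?k + ?k}. \<psi> (\<phi> (real i * (1 / real m)) x))"
      unfolding birkhoff_sum_def funpow_flow by (rule sum.nat_group[symmetric])
    also have "\<dots> = (\<Sum>j<J. \<Sum>p<?k. ?g p j)"
    proof (rule sum.cong[OF refl])
      fix j
      have "(\<Sum>i\<in>{j * ?k..<j * ?k + ?k}. \<psi> (\<phi> (real i * (1 / real m)) x))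
          = (\<Sum>p<?k. \<psi> (\<phi> (real (p + j * ?k) * (1 / real m)) x))"
        by (rule sum.reindex_bij_witness[of _ "\<lambda>p. p + j * ?k" "\<lambda>i. i - j * ?k"]) auto
      also have "\<dots> = (\<Sum>p<?k. ?g p j)"
        using m(1) by (intro sum.cong refl) (simp add: add_divide_distrib mult.commute)
      finally show "(\<Sum>i\<in>{j * ?k..<j * ?k + ?k}. \<psi> (\<phi> (real i * (1 / real m)) x)) = (\<Sum>p<?k. ?g p j)" .
    qed
    also have "\<dots> = (\<Sum>p<?k. \<Sum>j<J. ?g p j)"
      by (rule sum.swap)
    finally have total: "birkhoff_sum (\<phi> (1 / real m)) \<psi> (J * ?k) x = (\<Sum>p<?k. \<Sum>j<J. ?g p j)" .
    have k: "real (J * ?k) / real m = real n * real J"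
      using m(1) by simp
    have nJ: "0 < real n * real J"
      using J \<open>1 \<le> n\<close> by simp
    have "integral {0..real n * real J} (\<lambda>t. \<psi> (\<phi> t x)) < (real n * s) * (real n * real J)"
      using avg nJ unfolding time_average_def by (simp add: divide_less_eq)
    moreover have "birkhoff_sum (\<phi> (1 / real m)) \<psi> (J * ?k) x / real m
        \<le> integral {0..real n * real J} (\<lambda>t. \<psi> (\<phi> t x)) + (real n * (s' - s)) * (real n * real J)"
      using m(2)[of "J * ?k" x] unfolding k by linarith
    ultimately have "birkhoff_sum (\<phi> (1 / real m)) \<psi> (J * ?k) x / real m
        < (real n * s) * (real n * real J) + (real n * (s' - s)) * (real n * real J)"
      by linarith
    also have "\<dots> = real n * real J * (real n * s')"
      by (simp add: algebra_simps)
    finally have less: "birkhoff_sum (\<phi> (1 / real m)) \<psi> (J * ?k) x < real ?k * (real J * (real n * s'))"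
      using m(1) by (simp add: field_simps)
    show "\<exists>p<?k. (\<Sum>j<J. ?g p j) \<le> real J * (real n * s')"
    proof (rule ccontr)
      assume "\<not> ?thesis"
      then have "(\<Sum>p<?k. real J * (real n * s')) \<le> (\<Sum>p<?k. \<Sum>j<J. ?g p j)"
        by (intro sum_mono) (auto simp: not_le intro: less_imp_le)
      with less total show False by simp
    qed
  qed
qed

text \<open>The sets \<open>Q l\<close> consist of points whose orbits stay close up to time \<open>n\<close>, and \<open>\<psi>\<close> bounds the cost of a
  set containing a given point. A point of \<open>Y\<close> is described by a phase \<open>p\<close>, a set \<open>Q l\<close> that controls its
  orbit up to the phase, and a word of \<open>J\<close> labels that controls the orbit from there until time
  \<open>n * J\<close>. There are at most \<open>n * m * card \<Lambda> * exp (J * n * s')\<close> descriptions, which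
  \<open>exp (- \<alpha> * n * J)\<close> beats as \<open>s' < \<alpha>\<close>.\<close>
lemma Gamma_measure_null_by_cost:
  fixes Q :: "'l \<Rightarrow> 'a set"
  assumes ne: "\<U> \<noteq> {}" and lam: "\<And>S. (\<And>x y. x \<in> S \<Longrightarrow> y \<in> S \<Longrightarrow> dist x y < \<zeta>) \<Longrightarrow> subordinate S \<U>"
    and "finite \<Lambda>" and kraft: "(\<Sum>l\<in>\<Lambda>. exp (- cost l)) \<le> 1" and "1 \<le> (n :: nat)"
    and close: "\<And>l x y t. l \<in> \<Lambda> \<Longrightarrow> x \<in> Q l \<Longrightarrow> y \<in> Q l \<Longrightarrow> 0 \<le> t \<Longrightarrow> t \<le> real n \<Longrightarrow> dist (\<phi> t x) (\<phi> t y) < \<zeta>"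
    and \<psi>: "continuous_on UNIV \<psi>" and cost: "\<And>x. \<exists>l\<in>\<Lambda>. x \<in> Q l \<and> cost l \<le> \<psi> x"
    and "s < \<alpha>" "0 < \<alpha>"
    and avg: "\<And>x. x \<in> Y \<Longrightarrow> \<forall>\<^sub>F J in sequentially. time_average (real n * real J) \<psi> x < real n * s"
  shows "Gamma_measure \<phi> \<U> \<alpha> Y = 0"
proof -
  define s' where "s' = (s + \<alpha>) / 2"
  have s': "s < s'" "s' < \<alpha>"
    using \<open>s < \<alpha>\<close> by (auto simp: s'_def)
  obtain m :: nat where m: "1 \<le> m"
    "\<And>J x. 1 \<le> J \<Longrightarrow> time_average (real n * real J) \<psi> x < real n * s \<Longrightarrow>
       \<exists>p<n * m. (\<Sum>j<J. \<psi> (\<phi> (real p / real m + real n * real j) x)) \<le> real J * (real n * s')"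
    using cheap_phase[OF \<psi> \<open>1 \<le> n\<close> s'(1)] by blast
  define E where "E J p l w = {x \<in> Q l. \<forall>j<J. \<phi> (real p / real m + real n * real j) x \<in> Q (w ! j)}"
    for J p :: nat and l :: 'l and w
  define W where "W J = {w \<in> words \<Lambda> J. (\<Sum>j<J. cost (w ! j)) \<le> real J * (real n * s')}" for J
  have finW: "finite (W J)" for J
    unfolding W_def using finite_words[OF \<open>finite \<Lambda>\<close>] by simp
  have small: "D_size \<phi> \<U> (E J p l w) \<le> exp (- (real n * real J))"
    if "p < n * m" "l \<in> \<Lambda>" "w \<in> W J" for J p l w
  proof (rule D_size_le)
    fix t assume t: "0 \<le> t" "t < real n * real J"
    have p: "0 \<le> real p / real m" "real p / real m \<le> real n"
      using that(1) m(1) by (auto simp: divide_le_eq simp flip: of_nat_mult)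
    show "subordinate (\<phi> t ` E J p l w) \<U>"
    proof (rule lam)
      fix x' y' assume "x' \<in> \<phi> t ` E J p l w" "y' \<in> \<phi> t ` E J p l w"
      then obtain x y where xy: "x \<in> E J p l w" "y \<in> E J p l w" "x' = \<phi> t x" "y' = \<phi> t y"
        by auto
      show "dist x' y' < \<zeta>"
      proof (cases "t \<le> real p / real m")
        case True
        then show ?thesis
          using xy t p that(2) by (auto simp: E_def intro!: close[of l])
      next
        case False
        define r where "r = (t - real p / real m) / real n"
        define j where "j = nat \<lfloor>r\<rfloor>"
        have r: "0 \<le> r" "r * real n = t - real p / real m"
          using False \<open>1 \<le> n\<close> by (auto simp: r_def)
        have j: "real j \<le> r" "r < real j + 1"
          using r(1) unfolding j_def by linarith+
        have "real j * real n \<le> r * real n" "r * real n \<le> (real j + 1) * real n"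
          using j \<open>1 \<le> n\<close> by (auto intro!: mult_right_mono)
        then have u: "0 \<le> t - (real p / real m + real n * real j)"
            "t - (real p / real m + real n * real j) \<le> real n"
          using r(2) by (auto simp: algebra_simps)
        have "r * real n < real J * real n"
          using t(2) p(1) r(2) mult.commute[of "real n" "real J"] by linarith
        then have "j < J"
          using j(1) \<open>1 \<le> n\<close> by simp
        then have "w ! j \<in> \<Lambda>"
          using that(3) by (auto simp: W_def words_def)
        moreover have "\<phi> (real p / real m + real n * real j) x \<in> Q (w ! j)"
            "\<phi> (real p / real m + real n * real j) y \<in> Q (w ! j)"
          using xy \<open>j < J\<close> by (auto simp: E_def)
        ultimately have "dist (\<phi> (t - (real p / real m + real n * real j)) (\<phi> (real p / real m + real n * real j) x))
            (\<phi> (t - (real p / real m + real n * real j)) (\<phi> (real p / real m + real n * real j) y)) < \<zeta>"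
          by (intro close u)
        then show ?thesis
          by (simp add: xy flow_add[symmetric])
      qed
    qed
  qed simp
  \<comment> \<open>On \<open>Z J0\<close> the averages are small from a common \<open>J0\<close> on, so a single large \<open>J\<close> serves the whole set.\<close>
  define Z where "Z J0 = {x. \<forall>J\<ge>J0. time_average (real n * real J) \<psi> x < real n * s}" for J0 :: nat
  have cover: "Z J0 \<subseteq> (\<Union>(p, l, w)\<in>{..<n * m} \<times> \<Lambda> \<times> W J. E J p l w)" if "J0 \<le> J" "1 \<le> J" for J J0
  proof
    fix x assume "x \<in> Z J0"
    then have "time_average (real n * real J) \<psi> x < real n * s"
      using that(1) by (simp add: Z_def)
    from m(2)[OF that(2) this] obtain p where p: "p < n * m"
      "(\<Sum>j<J. \<psi> (\<phi> (real p / real m + real n * real j) x)) \<le> real J * (real n * s')"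
      by blast
    obtain f where f: "\<And>y. f y \<in> \<Lambda>" "\<And>y. y \<in> Q (f y)" "\<And>y. cost (f y) \<le> \<psi> y"
      using cost by metis
    define w where "w = map (\<lambda>j. f (\<phi> (real p / real m + real n * real j) x)) [0..<J]"
    have "(\<Sum>j<J. cost (w ! j)) \<le> (\<Sum>j<J. \<psi> (\<phi> (real p / real m + real n * real j) x))"
      by (intro sum_mono) (simp add: w_def f)
    then have "w \<in> W J"
      using p(2) f(1) by (auto simp: W_def words_def w_def)
    moreover have "x \<in> E J p (f x) w"
      using f(2) by (simp add: E_def w_def)
    ultimately show "x \<in> (\<Union>(p, l, w)\<in>{..<n * m} \<times> \<Lambda> \<times> W J. E J p l w)"
      using p(1) f(1) by (auto intro!: bexI[of _ "(p, f x, w)"])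
  qed
  have "Gamma_measure \<phi> \<U> \<alpha> (Z J0) = 0" for J0
  proof (rule Gamma_measure_null_finite_covers[OF ne \<open>0 < \<alpha>\<close>])
    fix \<epsilon> c :: real assume "0 < \<epsilon>" "0 < c"
    define \<theta> where "\<theta> = exp (- (real n * (\<alpha> - s')))"
    have \<theta>: "0 < \<theta>" "\<theta> < 1"
      using s'(2) \<open>1 \<le> n\<close> by (auto simp: \<theta>_def)
    define C where "C = real (n * m) * real (card \<Lambda>)"
    have "(\<lambda>J. C * \<theta> ^ J) \<longlonglongrightarrow> C * 0"
      using \<theta> by (intro tendsto_mult tendsto_const LIMSEQ_realpow_zero) auto
    then have "\<forall>\<^sub>F J in sequentially. C * \<theta> ^ J < c"
      using \<open>0 < c\<close> by (intro order_tendstoD) auto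
    moreover have "(\<lambda>J. exp (- real n) ^ J) \<longlonglongrightarrow> 0"
      using \<open>1 \<le> n\<close> by (intro LIMSEQ_realpow_zero) auto
    then have "\<forall>\<^sub>F J in sequentially. exp (- real n) ^ J < \<epsilon>"
      using \<open>0 < \<epsilon>\<close> by (intro order_tendstoD) auto
    moreover have "\<forall>\<^sub>F J in sequentially. max 1 J0 \<le> J"
      by (rule eventually_ge_at_top)
    ultimately have "\<forall>\<^sub>F J in sequentially. C * \<theta> ^ J < c \<and> exp (- real n) ^ J < \<epsilon> \<and> max 1 J0 \<le> J"
      by eventually_elim simp
    then obtain J where J: "C * \<theta> ^ J < c" "exp (- real n) ^ J < \<epsilon>" "max 1 J0 \<le> J"
      by (auto dest!: eventually_happens)
    define I where "I = {..<n * m} \<times> \<Lambda> \<times> W J"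
    define F where "F = (\<lambda>(p, l, w). E J p l w)"
    have D_le: "D_size \<phi> \<U> (F i) \<le> exp (- (real n * real J))" if "i \<in> I" for i
      using that small by (auto simp: F_def I_def)
    have "(\<Sum>i\<in>I. D_size \<phi> \<U> (F i) powr \<alpha>) \<le> (\<Sum>i\<in>I. exp (- (real n * real J)) powr \<alpha>)"
      using D_le \<open>0 < \<alpha>\<close> by (intro sum_mono powr_mono2 D_size_nonneg) auto
    also have "\<dots> = C * (real (card (W J)) * exp (- (real n * real J * \<alpha>)))"
      by (simp add: I_def C_def card_cartesian_product powr_def algebra_simps)
    also have "\<dots> \<le> C * (exp (real J * (real n * s')) * exp (- (real n * real J * \<alpha>)))"
      unfolding W_def C_def
      by (intro mult_left_mono mult_right_mono card_words_cost_le \<open>finite \<Lambda>\<close> kraft) auto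
    also have "\<dots> = C * \<theta> ^ J"
      by (simp add: \<theta>_def exp_of_nat_mult[symmetric] exp_add[symmetric] algebra_simps)
    finally have "(\<Sum>i\<in>I. D_size \<phi> \<U> (F i) powr \<alpha>) \<le> c"
      using J(1) by simp
    moreover have "exp (- (real n * real J)) < \<epsilon>"
      using J(2) by (simp add: exp_of_nat_mult[symmetric] mult.commute)
    then have "D_size \<phi> \<U> (F i) < \<epsilon>" if "i \<in> I" for i
      using D_le[OF that] by simp
    moreover have "Z J0 \<subseteq> (\<Union>i\<in>I. F i)"
      using cover[of J0 J] J(3) by (auto simp: I_def F_def)
    moreover have "finite I"
      using finW \<open>finite \<Lambda>\<close> by (simp add: I_def)
    ultimately show "\<exists>(I :: (nat \<times> 'l \<times> 'l list) set) F. finite I \<and> Z J0 \<subseteq> (\<Union>i\<in>I. F i)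
        \<and> (\<forall>i\<in>I. D_size \<phi> \<U> (F i) < \<epsilon>) \<and> (\<Sum>i\<in>I. D_size \<phi> \<U> (F i) powr \<alpha>) \<le> c"
      by blast
  qed
  then have "Gamma_measure \<phi> \<U> \<alpha> (\<Union>J0. Z J0) = 0"
    by (rule Gamma_measure_null_UN)
  moreover have "Y \<subseteq> (\<Union>J0. Z J0)"
    using avg by (fastforce simp: Z_def eventually_sequentially)
  ultimately show ?thesis
    by (rule Gamma_measure_null_subset[rotated])
qed

end

text \<open>A continuous function that is at most \<open>cost l\<close> on \<open>K l\<close>, and at each point is at least the cost of some label whose
  neighbourhood contains the point, or else the default cost \<open>C\<close>. It is the minimum over \<open>l\<close> of
  functions that dip from \<open>C\<close> to \<open>cost l\<close> on \<open>K l\<close> if \<open>cost l < C\<close>, and are constant otherwise.\<close>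
lemma continuous_cost_function:
  fixes K :: "'l \<Rightarrow> 'a::metric_space set" and cost :: "'l \<Rightarrow> real"
  assumes "finite F" and "0 < \<rho>" and "\<And>l. l \<in> F \<Longrightarrow> K l \<noteq> {}"
  obtains \<psi> :: "'a \<Rightarrow> real" where "continuous_on UNIV \<psi>" "\<And>y. \<psi> y \<le> C"
    "\<And>l y. l \<in> F \<Longrightarrow> y \<in> K l \<Longrightarrow> \<psi> y \<le> cost l"
    "\<And>y. \<psi> y = C \<or> (\<exists>l\<in>F. (\<exists>z\<in>K l. dist z y < \<rho>) \<and> cost l \<le> \<psi> y)"
proof -
  have "\<exists>\<psi>. continuous_on UNIV \<psi> \<and> (\<forall>y. \<psi> y \<le> C) \<and> (\<forall>l\<in>F. \<forall>y\<in>K l. \<psi> y \<le> cost l)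
    \<and> (\<forall>y. \<psi> y = C \<or> (\<exists>l\<in>F. (\<exists>z\<in>K l. dist z y < \<rho>) \<and> cost l \<le> \<psi> y))"
    using assms(1,3)
  proof (induction F rule: finite_induct)
    case empty
    show ?case by (intro exI[of _ "\<lambda>_. C"]) auto
  next
    case (insert l F)
    then obtain \<psi> where \<psi>: "continuous_on UNIV \<psi>" "\<And>y. \<psi> y \<le> C" "\<And>l y. l \<in> F \<Longrightarrow> y \<in> K l \<Longrightarrow> \<psi> y \<le> cost l"
      "\<And>y. \<psi> y = C \<or> (\<exists>l\<in>F. (\<exists>z\<in>K l. dist z y < \<rho>) \<and> cost l \<le> \<psi> y)"
      by auto
    define b where "b y = max 0 (1 - infdist y (K l) / \<rho>)" for y
    define v where "v y = C - b y * max 0 (C - cost l)" for y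
    have b: "0 \<le> b y" "b y \<le> 1" for y
      using \<open>0 < \<rho>\<close> infdist_nonneg[of y "K l"] by (auto simp: b_def)
    have "continuous_on UNIV v"
      unfolding v_def[abs_def] b_def[abs_def] using \<open>0 < \<rho>\<close> by (intro continuous_intros) auto
    then have "continuous_on UNIV (\<lambda>y. min (\<psi> y) (v y))"
      by (intro continuous_on_min \<psi>(1))
    moreover have "v y \<le> cost l" if "y \<in> K l" for y
      using that by (simp add: v_def b_def)
    moreover have "v y = C \<or> ((\<exists>z\<in>K l. dist z y < \<rho>) \<and> cost l \<le> v y)" for y
    proof (cases "b y = 0 \<or> C \<le> cost l")
      case False
      then have "infdist y (K l) < \<rho>"
        using \<open>0 < \<rho>\<close> by (auto simp: b_def max_def field_simps split: if_splits)
      then have "\<exists>z\<in>K l. dist y z < \<rho>"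
        using insert.prems[of l] cInf_lessD[of "dist y ` K l" \<rho>] by (auto simp: infdist_notempty)
      moreover have "cost l \<le> v y"
      proof -
        have "b y * (C - cost l) \<le> C - cost l"
          using mult_right_mono[of "b y" 1 "C - cost l"] False b by auto
        moreover have "v y = C - b y * (C - cost l)"
          using False by (simp add: v_def max_def)
        ultimately show ?thesis by simp
      qed
      ultimately show ?thesis
        by (auto simp: dist_commute)
    qed (auto simp: v_def)
    ultimately show ?case
    proof (intro exI[of _ "\<lambda>y. min (\<psi> y) (v y)"] conjI allI ballI)
      fix y
      assume v: "\<And>y. v y = C \<or> ((\<exists>z\<in>K l. dist z y < \<rho>) \<and> cost l \<le> v y)"
      show "min (\<psi> y) (v y) \<le> C" using \<psi>(2)[of y] by simp
      show "min (\<psi> y) (v y) = C \<or> (\<exists>l'\<in>insert l F. (\<exists>z\<in>K l'. dist z y < \<rho>) \<and> cost l' \<le> min (\<psi> y) (v y))"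
      proof (cases "\<psi> y \<le> v y")
        case True
        then show ?thesis using \<psi>(4)[of y] by (auto simp: min_def)
      next
        case False
        then have "v y \<noteq> C" using \<psi>(2)[of y] by auto
        then show ?thesis using v[of y] False by (auto simp: min_def)
      qed
    next
      fix l' y assume "\<And>y. y \<in> K l \<Longrightarrow> v y \<le> cost l" "l' \<in> insert l F" "y \<in> K l'"
      then show "min (\<psi> y) (v y) \<le> cost l'"
        using \<psi>(3)[of l' y] by (auto simp: min_le_iff_disj)
    qed auto
  qed
  then show ?thesis using that by blast
qed

text \<open>Two points get the same label if the same balls of a finite cover contain them.\<close>
lemma (in invariant_flow) fine_partition:
  assumes "0 < d"
  obtains \<xi> where "finite_measurable_partition M \<xi>" "\<And>A x y. A \<in> \<xi> \<Longrightarrow> x \<in> A \<Longrightarrow> y \<in> A \<Longrightarrow> dist x y < d"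
proof -
  obtain C where C: "finite C" "(UNIV :: 'a set) \<subseteq> (\<Union>c\<in>C. ball c (d / 2))"
    using compactE_image[OF compact_UNIV, of UNIV "\<lambda>c. ball c (d / 2)"] \<open>0 < d\<close>
    by (metis centre_in_ball half_gt_zero open_ball UN_I subsetI)
  define lab where "lab x = {c \<in> C. x \<in> ball c (d / 2)}" for x
  define \<xi> where "\<xi> = range (\<lambda>x. {y. lab y = lab x})"
  show ?thesis
  proof (rule that[of \<xi>])
    have "\<xi> \<subseteq> (\<lambda>D. {y. lab y = D}) ` Pow C"
      by (auto simp: \<xi>_def lab_def)
    then have "finite \<xi>"
      using C(1) by (auto intro: finite_subset)
    moreover have "{y. lab y = D} \<in> sets M" for D
    proof (cases "D \<subseteq> C")
      case True
      have "{y. lab y = D} = {y\<in>space M. \<forall>c\<in>C. (y \<in> ball c (d / 2)) = (c \<in> D)}"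
        using True by (auto simp: lab_def)
      also have "\<dots> \<in> sets M"
      proof (intro sets.sets_Collect_finite_All' C(1))
        fix c
        have "{y\<in>space M. (y \<in> ball c (d / 2)) = (c \<in> D)} = (if c \<in> D then ball c (d / 2) else - ball c (d / 2))"
          by auto
        then show "{y\<in>space M. (y \<in> ball c (d / 2)) = (c \<in> D)} \<in> sets M"
          by (simp only: sets_M) (simp add: borel_open borel_comp)
      qed (use C(2) in auto)
      finally show ?thesis .
    next
      case False
      then have "{y. lab y = D} = {}" by (auto simp: lab_def)
      then show ?thesis by simp
    qed
    moreover have "partition_on UNIV \<xi>"
      by (rule partition_onI) (auto simp: \<xi>_def disjnt_def)
    ultimately show "finite_measurable_partition M \<xi>"
      by (auto simp: finite_measurable_partition_def \<xi>_def)
    fix A x y assume "A \<in> \<xi>" "x \<in> A" "y \<in> A"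
    then have eq: "lab x = lab y" by (auto simp: \<xi>_def)
    have "x \<in> (\<Union>c\<in>C. ball c (d / 2))"
      using C(2) by blast
    then obtain c where "c \<in> lab x"
      by (auto simp: lab_def)
    then have "dist c x < d / 2" "dist c y < d / 2"
      using eq by (auto simp: lab_def)
    then show "dist x y < d"
      using dist_triangle3[of x y c] by linarith
  qed
qed

text \<open>Labels for \<open>Gamma_measure_null_by_cost\<close> are the words of length \<open>n\<close> over a fine partition, with cost
  essentially \<open>- ln\<close> of their probability, and small balls with a large constant cost for the points that
  lie near none of the closed sets \<open>K u\<close> inside the cylinders. The parameters are
  chosen in this order: \<open>n\<close> with entropy of \<open>n\<close>-blocks below \<open>n * s\<close>, then the weight \<open>\<eta>\<close> left for the
  balls, then the balls, which depend on \<open>n\<close>, and finally the measure \<open>\<delta>\<close> missed by the sets \<open>K u\<close>, so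
  small that the large constant does not affect the mean. The gap \<open>g\<close> is spent as \<open>g / 4\<close> on \<open>\<eta>\<close> and
  \<open>g / 4\<close> on \<open>\<delta>\<close>.\<close>
lemma (in invariant_flow) Gamma_measure_generic_null:
  assumes U: "finite_open_cover \<U>" and "0 < \<alpha>" and \<alpha>: "flow_metric_entropy M \<phi> < ereal \<alpha>"
  shows "Gamma_measure \<phi> \<U> \<alpha> (generic_points \<phi> M) = 0"
proof -
  have U': "UNIV \<subseteq> \<Union>\<U>" "\<And>V. V \<in> \<U> \<Longrightarrow> open V"
    using U by (auto simp: finite_open_cover_def)
  then have ne: "\<U> \<noteq> {}" by auto
  obtain \<zeta> where \<zeta>: "0 < \<zeta>" "\<And>x. \<exists>V\<in>\<U>. ball x \<zeta> \<subseteq> V"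
    using Heine_Borel_lemma[OF compact_UNIV U'] by (metis UNIV_I)
  have lam: "subordinate S \<U>" if S: "\<And>x y. x \<in> S \<Longrightarrow> y \<in> S \<Longrightarrow> dist x y < \<zeta>" for S
  proof (cases "S = {}")
    case True
    then show ?thesis using ne by (auto simp: subordinate_def)
  next
    case False
    then obtain x where "x \<in> S" by auto
    moreover obtain V where "V \<in> \<U>" "ball x \<zeta> \<subseteq> V" using \<zeta>(2) by blast
    ultimately show ?thesis
      unfolding subordinate_def using S by (intro bexI[of _ V]) auto
  qed
  have lam3: "0 < \<zeta> / 3" using \<zeta>(1) by simp
  obtain d1 where d1: "0 < d1" "\<And>(x::'a) y t. dist x y < d1 \<Longrightarrow> 0 \<le> t \<Longrightarrow> t \<le> 1 \<Longrightarrow> dist (\<phi> t x) (\<phi> t y) < \<zeta> / 3"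
    using uniformly_close_orbits[OF lam3, of 1] by blast
  obtain \<xi> where \<xi>: "finite_measurable_partition M \<xi>" "\<And>A x y. A \<in> \<xi> \<Longrightarrow> x \<in> A \<Longrightarrow> y \<in> A \<Longrightarrow> dist x y < d1"
    using fine_partition[OF d1(1)] by blast
  interpret mpm: measure_preserving_map M "\<phi> 1"
    by (rule time_map_preserving)
  interpret lab: labelled_map M "\<phi> 1" "cell \<xi>" \<xi>
    by (rule mpm.labelled_map_cell[OF \<xi>(1)])
  have part: "partition_on UNIV \<xi>" and fin: "finite \<xi>"
    using \<xi>(1) by (auto simp: finite_measurable_partition_def)
  note cell = cell_eq_iff[OF part]
  have same_cell: "dist x y < d1" if "cell \<xi> x = cell \<xi> y" for x y
    using that cell(1)[OF cell(2)] by (intro \<xi>(2)[OF cell(2)[of x]]) metis+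
  obtain s where s: "flow_metric_entropy M \<phi> < ereal s" "s < \<alpha>"
    using ereal_dense2[OF \<alpha>] by auto
  have "ereal (entropy_wrt_partition M (\<phi> 1) \<xi>) \<le> flow_metric_entropy M \<phi>"
    unfolding flow_metric_entropy_def KS_entropy_def using \<xi>(1) by (intro SUP_upper) simp
  then have "entropy_wrt_partition M (\<phi> 1) \<xi> < s"
    using s(1) by (metis le_less_trans less_ereal.simps(1))
  then have "\<forall>\<^sub>F n in sequentially. lab.block_entropy n / real n < s"
    using mpm.entropy_wrt_partition_tendsto[OF \<xi>(1)] by (intro order_tendstoD)
  then have "\<forall>\<^sub>F n in sequentially. lab.block_entropy n / real n < s \<and> 1 \<le> n"
    using eventually_ge_at_top[of "1::nat"] by eventually_elim simp
  then obtain n :: nat where n: "lab.block_entropy n / real n < s" "1 \<le> n"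
    by (auto dest!: eventually_happens)
  define g where "g = real n * s - lab.block_entropy n"
  have g: "0 < g"
    using n by (simp add: g_def field_simps)
  define \<eta> where "\<eta> = 1 - exp (- g / 4)"
  have \<eta>: "0 < \<eta>" "\<eta> < 1" "- ln (1 - \<eta>) = g / 4"
    using g by (auto simp: \<eta>_def)
  \<comment> \<open>Neighbourhoods of the cylinders must be small enough to keep orbits close up to time \<open>n\<close>.\<close>
  obtain d2 where d2: "0 < d2" "\<And>(x::'a) y t. dist x y < d2 \<Longrightarrow> 0 \<le> t \<Longrightarrow> t \<le> real n \<Longrightarrow> dist (\<phi> t x) (\<phi> t y) < \<zeta> / 3"
    using uniformly_close_orbits[OF lam3, of "real n"] by blast
  obtain C where C: "finite C" "(UNIV :: 'a set) \<subseteq> (\<Union>c\<in>C. ball c (d2 / 2))"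
    using compactE_image[OF compact_UNIV, of UNIV "\<lambda>c. ball c (d2 / 2)"] d2(1)
    by (metis centre_in_ball half_gt_zero open_ball UN_I subsetI)
  define N where "N = real (card C)"
  have "C \<noteq> {}" using C(2) by auto
  then have N: "1 \<le> N"
    using C(1) unfolding N_def by (simp add: Suc_le_eq card_gt_0_iff)
  define top_cost where "top_cost = ln (N / \<eta>)"
  have top_cost: "0 \<le> top_cost"
    unfolding top_cost_def using N \<eta> by (intro ln_ge_zero) (auto simp: field_simps)
  define \<delta> where "\<delta> = g / (4 * (top_cost + 1))"
  have \<delta>: "0 < \<delta>" "top_cost * \<delta> \<le> g / 4"
    using g top_cost by (auto simp: \<delta>_def field_simps)
  let ?W = "words \<xi> n"
  let ?cyl = "\<lambda>u. {x. word (\<phi> 1) (cell \<xi>) n x = u}"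
  have finW: "finite ?W" by (rule finite_words[OF fin])
  have W_pos: "0 < real (card ?W)"
    using finW lab.word_in_words[of n] by (auto simp: card_gt_0_iff)
  have "\<exists>K. closed K \<and> K \<subseteq> ?cyl u \<and> prob (?cyl u - K) < \<delta> / real (card ?W)
      \<and> (lab.word_prob n u = 0 \<longrightarrow> K = {})" for u
  proof (cases "lab.word_prob n u = 0")
    case True
    then show ?thesis
      using \<delta>(1) W_pos by (intro exI[of _ "{}"]) (auto simp: lab.word_prob_def)
  next
    case False
    have "0 < \<delta> / real (card ?W)" using \<delta>(1) W_pos by simp
    from closed_inner_regular[OF finite_measure_axioms sets_M lab.cylinder_measurable this]
    obtain K where "closed K" "K \<subseteq> ?cyl u" "prob (?cyl u - K) < \<delta> / real (card ?W)"
      by blast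
    with False show ?thesis by blast
  qed
  then obtain K where K: "\<And>u. closed (K u)" "\<And>u. K u \<subseteq> ?cyl u"
      "\<And>u. prob (?cyl u - K u) < \<delta> / real (card ?W)" "\<And>u. lab.word_prob n u = 0 \<Longrightarrow> K u = {}"
    by metis
  define F where "F = {u \<in> ?W. K u \<noteq> {}}"
  have F: "finite F" "F \<subseteq> ?W" "\<And>u. u \<in> F \<Longrightarrow> 0 < lab.word_prob n u"
    using finW K(4) lab.word_prob_nonneg by (auto simp: F_def less_le)
  define word_cost where "word_cost u = - ln ((1 - \<eta>) * lab.word_prob n u)" for u
  have word_cost: "word_cost u = g / 4 - ln (lab.word_prob n u)" if "u \<in> F" for u
    using F(3)[OF that] \<eta> by (simp add: word_cost_def ln_mult)
  have word_cost_nonneg: "0 \<le> word_cost u" if "u \<in> F" for u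
  proof -
    have "ln (lab.word_prob n u) \<le> 0"
      using F(3)[OF that] lab.word_prob_le_1[of n u] by simp
    then show ?thesis
      using word_cost[OF that] g by simp
  qed
  obtain \<psi> :: "'a \<Rightarrow> real" where \<psi>: "continuous_on UNIV \<psi>" "\<And>y. \<psi> y \<le> top_cost"
    "\<And>u y. u \<in> F \<Longrightarrow> y \<in> K u \<Longrightarrow> \<psi> y \<le> word_cost u"
    "\<And>y. \<psi> y = top_cost \<or> (\<exists>u\<in>F. (\<exists>z\<in>K u. dist z y < d2) \<and> word_cost u \<le> \<psi> y)"
    using continuous_cost_function[OF F(1) d2(1), of K top_cost word_cost] by (auto simp: F_def)
  define \<Lambda> where "\<Lambda> = Inl ` F \<union> Inr ` C"
  define Q where "Q l = (case l of Inl u \<Rightarrow> {y. \<exists>z\<in>K u. dist z y < d2} | Inr c \<Rightarrow> ball c (d2 / 2))" for l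
  define cost where "cost l = (case l of Inl u \<Rightarrow> word_cost u | Inr c \<Rightarrow> top_cost)" for l :: "'a set list + 'a"
  have kraft: "(\<Sum>l\<in>\<Lambda>. exp (- cost l)) \<le> 1"
  proof -
    have "(\<Sum>l\<in>\<Lambda>. exp (- cost l)) = (\<Sum>u\<in>F. exp (- word_cost u)) + (\<Sum>c\<in>C. exp (- top_cost))"
      unfolding \<Lambda>_def using F(1) C(1)
      by (subst sum.union_disjoint) (auto simp: sum.reindex cost_def)
    also have "(\<Sum>u\<in>F. exp (- word_cost u)) = (\<Sum>u\<in>F. (1 - \<eta>) * lab.word_prob n u)"
      using F(3) \<eta> by (intro sum.cong) (auto simp: word_cost_def)
    also have "\<dots> \<le> (\<Sum>u\<in>?W. (1 - \<eta>) * lab.word_prob n u)"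
      using F(2) finW \<eta> by (intro sum_mono2) (auto simp: lab.word_prob_nonneg)
    also have "\<dots> = 1 - \<eta>"
      by (simp add: sum_distrib_left[symmetric] lab.sum_word_prob)
    also have "(\<Sum>c\<in>C. exp (- top_cost)) = \<eta>"
      using N \<eta> by (simp add: top_cost_def exp_minus N_def[symmetric])
    finally show ?thesis by simp
  qed
  have close: "dist (\<phi> t x) (\<phi> t y) < \<zeta>"
    if "l \<in> \<Lambda>" and Q: "x \<in> Q l" "y \<in> Q l" and t: "0 \<le> t" "t \<le> real n" for l x y t
  proof (cases l)
    case (Inl u)
    then obtain z z' where z: "z \<in> K u" "dist z x < d2" "z' \<in> K u" "dist z' y < d2"
      using Q by (auto simp: Q_def)
    \<comment> \<open>At \<open>t = n\<close> the last letter, at time \<open>n - 1\<close>, controls the orbit for one more unit of time.\<close>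
    define i where "i = min (nat \<lfloor>t\<rfloor>) (n - 1)"
    have i: "i < n" "0 \<le> t - real i" "t - real i \<le> 1"
      using t n(2) unfolding i_def by (auto simp: min_def of_nat_diff) linarith+
    have "word (\<phi> 1) (cell \<xi>) n z = word (\<phi> 1) (cell \<xi>) n z'"
      using K(2)[of u] z by auto
    from arg_cong[OF this, of "\<lambda>w. w ! i"] i(1)
    have "cell \<xi> (\<phi> (real i) z) = cell \<xi> (\<phi> (real i) z')"
      by (simp add: funpow_flow)
    from d1(2)[OF same_cell[OF this] i(2,3)] have "dist (\<phi> t z) (\<phi> t z') < \<zeta> / 3"
      by (simp add: flow_add[symmetric])
    moreover have "dist (\<phi> t z) (\<phi> t x) < \<zeta> / 3" "dist (\<phi> t z') (\<phi> t y) < \<zeta> / 3"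
      using z t by (auto simp del: less_divide_eq_numeral1 intro!: d2(2))
    ultimately show ?thesis
      using dist_triangle3[of "\<phi> t x" "\<phi> t y" "\<phi> t z"] dist_triangle[of "\<phi> t z" "\<phi> t y" "\<phi> t z'"]
      by linarith
  next
    case (Inr c)
    then have "dist c x < d2 / 2" "dist c y < d2 / 2"
      using Q by (auto simp: Q_def)
    then have "dist x y < d2"
      using dist_triangle3[of x y c] by linarith
    from d2(2)[OF this t] show ?thesis
      using \<zeta>(1) by linarith
  qed
  have cost: "\<exists>l\<in>\<Lambda>. x \<in> Q l \<and> cost l \<le> \<psi> x" for x
    using \<psi>(4)[of x]
  proof
    assume "\<psi> x = top_cost"
    moreover obtain c where "c \<in> C" "x \<in> ball c (d2 / 2)" using C(2) by blast
    ultimately show ?thesis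
      by (intro bexI[of _ "Inr c"]) (auto simp: Q_def cost_def \<Lambda>_def)
  next
    assume "\<exists>u\<in>F. (\<exists>z\<in>K u. dist z x < d2) \<and> word_cost u \<le> \<psi> x"
    then obtain u where "u \<in> F" "\<exists>z\<in>K u. dist z x < d2" "word_cost u \<le> \<psi> x" by blast
    then show ?thesis
      by (intro bexI[of _ "Inl u"]) (auto simp: Q_def cost_def \<Lambda>_def)
  qed
  define R where "R = - (\<Union>u\<in>F. K u)"
  have K_meas: "K u \<in> sets M" for u using K(1) by simp
  have R_meas: "R \<in> sets M"
    unfolding R_def using F(1) K(1) by (auto intro!: borel_open open_Compl closed_UN)
  have prob_R: "prob R \<le> \<delta>"
  proof -
    have "R \<subseteq> (\<Union>u\<in>?W. ?cyl u - K u)"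
      using lab.word_in_words[of n] by (fastforce simp: R_def F_def)
    then have "prob R \<le> prob (\<Union>u\<in>?W. ?cyl u - K u)"
      using finW K_meas lab.cylinder_measurable by (intro finite_measure_mono sets.finite_UN sets.Diff) auto
    also have "\<dots> \<le> (\<Sum>u\<in>?W. prob (?cyl u - K u))"
      using finW K_meas lab.cylinder_measurable by (intro finite_measure_subadditive_finite) auto
    also have "\<dots> \<le> (\<Sum>u\<in>?W. \<delta> / real (card ?W))"
      using K(3) by (intro sum_mono) (auto intro: less_imp_le)
    also have "\<dots> = \<delta>"
      using W_pos by simp
    finally show ?thesis .
  qed
  have int_ind: "integrable M (\<lambda>x. indicator A x * r)" if "A \<in> sets M" for A :: "'a set" and r :: real
    using that by (intro integrable_mult_left integrable_real_indicator) (auto simp: emeasure_eq_measure)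
  have "(\<integral>x. \<psi> x \<partial>M) \<le> (\<integral>x. (\<Sum>u\<in>F. indicator (K u) x * word_cost u) + indicator R x * top_cost \<partial>M)"
  proof (rule integral_mono)
    show "integrable M \<psi>" by (rule continuous_integrable[OF \<psi>(1)])
    show "integrable M (\<lambda>x. (\<Sum>u\<in>F. indicator (K u) x * word_cost u) + indicator R x * top_cost)"
      using K_meas R_meas by (intro Bochner_Integration.integrable_add Bochner_Integration.integrable_sum int_ind)
    show "\<psi> x \<le> (\<Sum>u\<in>F. indicator (K u) x * word_cost u) + indicator R x * top_cost" for x
    proof (cases "x \<in> R")
      case True
      then show ?thesis
        using \<psi>(2)[of x] word_cost_nonneg by (intro add_increasing sum_nonneg mult_nonneg_nonneg) auto
    next
      case False
      then obtain u where u: "u \<in> F" "x \<in> K u" by (auto simp: R_def)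
      have "\<psi> x \<le> indicator (K u) x * word_cost u"
        using \<psi>(3)[OF u] u by simp
      also have "\<dots> \<le> (\<Sum>u\<in>F. indicator (K u) x * word_cost u)"
        using u(1) F(1) word_cost_nonneg by (intro member_le_sum mult_nonneg_nonneg) auto
      finally show ?thesis using False by simp
    qed
  qed
  also have "\<dots> = (\<Sum>u\<in>F. prob (K u) * word_cost u) + prob R * top_cost"
    using K_meas R_meas int_ind
    by (simp add: Bochner_Integration.integral_add Bochner_Integration.integrable_sum Bochner_Integration.integral_sum)
  also have "\<dots> \<le> (g / 4 + lab.block_entropy n) + g / 4"
  proof (rule add_mono)
    have "(\<Sum>u\<in>F. prob (K u) * word_cost u) \<le> (\<Sum>u\<in>F. lab.word_prob n u * (g / 4 - ln (lab.word_prob n u)))"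
    proof (rule sum_mono)
      fix u assume "u \<in> F"
      have "prob (K u) \<le> lab.word_prob n u"
        unfolding lab.word_prob_def using K(2) by (intro finite_measure_mono lab.cylinder_measurable) auto
      then show "prob (K u) * word_cost u \<le> lab.word_prob n u * (g / 4 - ln (lab.word_prob n u))"
        using word_cost_nonneg[OF \<open>u \<in> F\<close>] word_cost[OF \<open>u \<in> F\<close>] by (simp add: mult_right_mono)
    qed
    also have "\<dots> \<le> (\<Sum>u\<in>?W. lab.word_prob n u * (g / 4 - ln (lab.word_prob n u)))"
    proof (intro sum_mono2 finW F(2))
      fix u
      show "0 \<le> lab.word_prob n u * (g / 4 - ln (lab.word_prob n u))"
      proof (cases "lab.word_prob n u = 0")
        case False
        then have "ln (lab.word_prob n u) \<le> 0"
          using lab.word_prob_nonneg[of n u] lab.word_prob_le_1[of n u] by simp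
        then show ?thesis
          using lab.word_prob_nonneg[of n u] g by (intro mult_nonneg_nonneg) linarith+
      qed simp
    qed
    also have "\<dots> = (\<Sum>u\<in>?W. lab.word_prob n u) * (g / 4) + lab.block_entropy n"
      by (simp add: lab.block_entropy_def right_diff_distrib sum_subtractf sum_distrib_right sum_divide_distrib)
    also have "\<dots> = g / 4 + lab.block_entropy n"
      by (simp add: lab.sum_word_prob)
    finally show "(\<Sum>u\<in>F. prob (K u) * word_cost u) \<le> g / 4 + lab.block_entropy n" .
    have "prob R * top_cost \<le> \<delta> * top_cost"
      using prob_R top_cost by (rule mult_right_mono)
    then show "prob R * top_cost \<le> g / 4"
      using \<delta>(2) by (simp add: mult.commute)
  qed
  also have "\<dots> < real n * s"
    using g g_def by linarith
  finally have \<psi>_int: "(\<integral>x. \<psi> x \<partial>M) < real n * s" .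
  show ?thesis
  proof (rule Gamma_measure_null_by_cost[OF ne lam _ kraft n(2) close \<psi>(1) cost s(2) \<open>0 < \<alpha>\<close>])
    show "finite \<Lambda>" using F(1) C(1) by (simp add: \<Lambda>_def)
    fix x assume "x \<in> generic_points \<phi> M"
    then have "((\<lambda>T. time_average T \<psi> x) \<longlongrightarrow> (\<integral>x. \<psi> x \<partial>M)) at_top"
      using \<psi>(1) by (simp add: generic_points_def time_average_def)
    moreover have "filterlim (\<lambda>J. real n * real J) at_top sequentially"
      using n(2) by (intro filterlim_tendsto_pos_mult_at_top[OF tendsto_const] filterlim_real_sequentially) simp
    ultimately have "(\<lambda>J. time_average (real n * real J) \<psi> x) \<longlonglongrightarrow> (\<integral>x. \<psi> x \<partial>M)"
      by (rule filterlim_compose)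
    then show "\<forall>\<^sub>F J in sequentially. time_average (real n * real J) \<psi> x < real n * s"
      using \<psi>_int by (rule order_tendstoD)
  qed
qed

lemma (in invariant_flow) flow_metric_entropy_nonneg: "0 \<le> flow_metric_entropy M \<phi>"
proof -
  interpret mpm: measure_preserving_map M "\<phi> 1"
    by (rule time_map_preserving)
  have triv: "finite_measurable_partition M {UNIV}"
    by (auto simp: finite_measurable_partition_def partition_on_def)
  have "0 \<le> entropy_wrt_partition M (\<phi> 1) {UNIV}"
    using mpm.entropy_wrt_partition_tendsto[OF triv]
    by (rule LIMSEQ_le_const)
      (auto intro!: exI[of _ 0] divide_nonneg_nonneg labelled_map.block_entropy_nonneg[OF mpm.labelled_map_cell[OF triv]])
  then have "0 \<le> ereal (entropy_wrt_partition M (\<phi> 1) {UNIV})" by simp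
  also have "\<dots> \<le> flow_metric_entropy M \<phi>"
    unfolding flow_metric_entropy_def KS_entropy_def using triv by (intro SUP_upper) simp
  finally show ?thesis .
qed

lemma (in invariant_flow) top_entropy_generic_le:
  "flow_top_entropy \<phi> (generic_points \<phi> M) \<le> flow_metric_entropy M \<phi>"
  unfolding flow_top_entropy_def
  by (intro SUP_least cover_entropy_le flow_metric_entropy_nonneg Gamma_measure_generic_null) auto

theorem theorem2:
  fixes \<phi> :: "real \<Rightarrow> 'a::metric_space \<Rightarrow> 'a"
  assumes "compact (UNIV :: 'a set)"
    and "continuous_flow \<phi>"
  shows "\<forall>\<mu>. borel_probability \<mu> \<and> flow_invariant \<phi> \<mu> \<longrightarrow>
           flow_top_entropy \<phi> (generic_points \<phi> \<mu>) \<le> flow_metric_entropy \<mu> \<phi> \<and>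
           (flow_ergodic \<phi> \<mu> \<longrightarrow>
             flow_top_entropy \<phi> (generic_points \<phi> \<mu>) = flow_metric_entropy \<mu> \<phi>)"
proof (intro allI impI conjI)
  fix \<mu> :: "'a measure"
  assume "borel_probability \<mu> \<and> flow_invariant \<phi> \<mu>"
  then interpret invariant_flow \<phi> \<mu>
    using assms by unfold_locales auto
  show upper: "flow_top_entropy \<phi> (generic_points \<phi> \<mu>) \<le> flow_metric_entropy \<mu> \<phi>"
    by (rule top_entropy_generic_le)
  assume "flow_ergodic \<phi> \<mu>"
  then have "flow_metric_entropy \<mu> \<phi> \<le> flow_top_entropy \<phi> (generic_points \<phi> \<mu>)"
    by (intro metric_entropy_le_top_entropy AE_generic)
  with upper show "flow_top_entropy \<phi> (generic_points \<phi> \<mu>) = flow_metric_entropy \<mu> \<phi>"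
    by (rule antisym)
qed

end
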